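(* Let $b\ge 1$ be an integer and let $c$ be a constant with $0<c<c_{b+2}$. Let $G\sim\mathcal{G}(n,c/n)$. Then with high probability (i.e. with probability tending to $1$ as $n\to\infty$), $s_b^*(G)=o(\log^3 n)$; that is, Breaker has a strategy in the $(1:b)$ component game on $G$ ensuring that every connected component of Maker's graph has $o(\log^3 n)$ vertices. This holds regardless of which player moves first.
   Context: $\mathcal{G}(n,p)$ is the binomial random graph on $n$ labelled vertices where each of the $\binom n2$ possible edges is present independently with probability $p$. The $(1:b)$ component game on a graph $G$: two players, Maker and Breaker, alternately claim previously unclaimed edges of $G$; on each of her moves Maker claims one edge, on each of his moves Breaker claims $b$ edges (or all remaining ones if fewer than $b$ remain); the game ends when all edges are claimed. $s_b^*(G)$ denotes the largest $s$ such that Maker has a strategy guaranteeing that, at the end of the game, her graph (the edges she claimed) contains a connected component with at least $s$ vertices, whatever Breaker does. For an integer $k\ge 3$ and $c>0$, let $\beta(c)$ be the largest $x\in[0,1]$ satisfying $x=\Pr[\mathrm{Poisson}(cx)\ge k-1]$, and define $c_k=\inf\{c>0:\beta(c)>0\}$ (this is the threshold constant for the appearance of a nonempty $k$-core in $\mathcal{G}(n,c/n)$, where the $k$-core of a graph is its largest subgraph of minimum degree at least $k$). *)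

theory Defs
  imports "HOL-Probability.Probability" "HOL-Library.Landau_Symbols"
begin

text \<open>A simple graph on a vertex set \<open>V\<close> is given by its set of edges, each edge being a
  two-element subset of \<open>V\<close>.\<close>

definition all_edges :: "'a set \<Rightarrow> 'a set set" where
  "all_edges V = {e. e \<subseteq> V \<and> card e = 2}"

text \<open>Isolated vertices form components of size 1.\<close>

definition graph_components :: "'a set \<Rightarrow> 'a set set \<Rightarrow> 'a set set" where
  "graph_components V E = (\<lambda>v. {w \<in> V. (v, w) \<in> {(x, y). {x, y} \<in> E}\<^sup>*}) ` V"

text \<open>\<^const>\<open>bernoulli_pmf\<close> truncates its parameter to the unit interval, so \<open>Gnp n (c / n)\<close> is also
  defined for the finitely many \<open>n < c\<close>.\<close>

definition Gnp :: "nat \<Rightarrow> real \<Rightarrow> nat set set pmf" where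
  "Gnp n p = map_pmf (\<lambda>f. {e \<in> all_edges {..<n}. f e})
     (Pi_pmf (all_edges {..<n}) False (\<lambda>_. bernoulli_pmf p))"

datatype player = Maker | Breaker

text \<open>A history is the list of all moves made so far, a move being the set of edges claimed in it.
  The argument \<open>first\<close> is the player making the first move, and \<open>E\<close> is the set of edges of the
  graph on which the game is played.\<close>

definition mover :: "player \<Rightarrow> nat \<Rightarrow> player" where
  "mover first i = (if even i then first else (case first of Maker \<Rightarrow> Breaker | Breaker \<Rightarrow> Maker))"

definition unclaimed :: "'e set \<Rightarrow> 'e set list \<Rightarrow> 'e set" where
  "unclaimed E h = E - \<Union>(set h)"

definition maker_graph :: "player \<Rightarrow> 'e set list \<Rightarrow> 'e set" where
  "maker_graph first h = \<Union>{h ! i | i. i < length h \<and> mover first i = Maker}"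

definition legal_move :: "nat \<Rightarrow> 'e set \<Rightarrow> player \<Rightarrow> 'e set list \<Rightarrow> 'e set \<Rightarrow> bool" where
  "legal_move b E p h m \<longleftrightarrow>
     unclaimed E h \<noteq> {} \<and> m \<subseteq> unclaimed E h \<and>
     card m = (case p of Maker \<Rightarrow> 1 | Breaker \<Rightarrow> min b (card (unclaimed E h)))"

definition is_play :: "nat \<Rightarrow> 'e set \<Rightarrow> player \<Rightarrow> 'e set list \<Rightarrow> bool" where
  "is_play b E first h \<longleftrightarrow>
     (\<forall>i < length h. legal_move b E (mover first i) (take i h) (h ! i))"

text \<open>A strategy of player \<open>p\<close> maps histories to moves; it must return a legal move whenever it is
  the turn of \<open>p\<close> and the game is not over.\<close>

definition strategy :: "nat \<Rightarrow> 'e set \<Rightarrow> player \<Rightarrow> player \<Rightarrow> ('e set list \<Rightarrow> 'e set) \<Rightarrow> bool" where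
  "strategy b E first p \<sigma> \<longleftrightarrow>
     (\<forall>h. is_play b E first h \<and> unclaimed E h \<noteq> {} \<and> mover first (length h) = p
        \<longrightarrow> legal_move b E p h (\<sigma> h))"

definition follows :: "player \<Rightarrow> player \<Rightarrow> ('e set list \<Rightarrow> 'e set) \<Rightarrow> 'e set list \<Rightarrow> bool" where
  "follows first p \<sigma> h \<longleftrightarrow> (\<forall>i < length h. mover first i = p \<longrightarrow> h ! i = \<sigma> (take i h))"

definition can_ensure ::
    "nat \<Rightarrow> 'e set \<Rightarrow> player \<Rightarrow> player \<Rightarrow> ('e set \<Rightarrow> bool) \<Rightarrow> bool" where
  "can_ensure b E first p Q \<longleftrightarrow>
     (\<exists>\<sigma>. strategy b E first p \<sigma> \<and>
        (\<forall>h. is_play b E first h \<and> unclaimed E h = {} \<and> follows first p \<sigma> h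
           \<longrightarrow> Q (maker_graph first h)))"

definition s_star :: "nat \<Rightarrow> player \<Rightarrow> 'a set \<Rightarrow> 'a set set \<Rightarrow> nat" where
  "s_star b first V E =
     (GREATEST s. can_ensure b E first Maker (\<lambda>M. \<exists>C \<in> graph_components V M. s \<le> card C))"

text \<open>The library only specifies \<^const>\<open>poisson_pmf\<close> for positive rates; \<open>Poisson(0)\<close> is the point
  mass at 0.\<close>

definition poisson0_pmf :: "real \<Rightarrow> nat pmf" where
  "poisson0_pmf r = (if r = 0 then return_pmf 0 else poisson_pmf r)"

definition core_beta :: "nat \<Rightarrow> real \<Rightarrow> real" where
  "core_beta k c =
     (GREATEST x. x \<in> {0..1} \<and> x = measure_pmf.prob (poisson0_pmf (c * x)) {j. j \<ge> k - 1})"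

definition core_threshold :: "nat \<Rightarrow> real" where
  "core_threshold k = Inf {c. c > 0 \<and> core_beta k c > 0}"

end

theory Submission
  imports Defs "HOL-Real_Asymp.Real_Asymp"
begin

text \<open>
  Put \<open>k = b + 2\<close>. Below the threshold the iteration \<open>x \<mapsto> Pr[Poisson(c x) \<ge> k - 1]\<close> started at \<open>1\<close> tends
  to \<open>0\<close>, so after a constant number \<open>t\<close> of rounds of simultaneously deleting all vertices of degree less
  than \<open>k\<close> only a set \<open>S\<close> of few vertices is left. A connected \<open>U \<subseteq> S\<close> of size about \<open>ln n\<close> would be
  sparse, hence a constant fraction of its vertices would have a neighbour outside \<open>U\<close> that survives
  almost as long in \<open>G - U\<close>; as the edges leaving \<open>U\<close> are independent of \<open>G - U\<close>, a union bound excludes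
  this. So the components of \<open>G[S]\<close> have size less than \<open>ln n\<close>, and by sparsity \<open>G[S]\<close> is \<open>(k - 1)\<close>-degenerate.

  Rank the vertices by round of deletion, refined by a proper \<open>k\<close>-colouring within each round, with \<open>S\<close>
  on top in a degenerate order: every vertex has at most \<open>b + 1\<close> neighbours of higher rank. When Maker
  claims an edge from \<open>v\<close> to a higher vertex, Breaker claims the other upward edges at \<open>v\<close>. Thus Maker's
  graph has at most one upward edge per vertex, and each of its components lies within distance \<open>t k\<close> of a
  single vertex or of a component of \<open>G[S]\<close>. Since connected sets of logarithmic size expand by a
  bounded factor only, all of Maker's components have size \<open>O(ln n)\<close>.
\<close>

section \<open>Random subsets of a finite set\<close>

text \<open>Whether a vertex outside \<open>U\<close> survives depends on the edges at
  \<open>U\<close>, so ordinary survival cannot be combined with independence. Rooted survival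
  \<open>rsurv\<close>, evaluated without \<open>U\<close>, repairs this: one neighbour is granted
  and k - 1 others are required. That is the origin of the k - 1 in the iteration, since
  \<open>rsurv\<close> rather than \<open>surv\<close> obeys the branching recursion. The two
  notions differ only through a short second connection to \<open>U\<close>, an ear, and sparsity
  leaves room for few of these. The same device with a set \<open>M\<close> of bounded size in place
  of \<open>U\<close> yields the recursion for the number of rooted survivors. At least a quarter of
  the vertices of a cluster are attached, each at a cost of about \<epsilon> c, while connected sets
  and the choice of the attached vertices contribute only an exponential factor per vertex; so a
  suitable \<epsilon> depends on \<open>c\<close> alone, and the number of rounds can be chosen
  after it. Layers are coloured, not linearly ordered, because the number of ranks below
  \<open>S\<close> bounds the length of an upward path before it reaches \<open>S\<close>, and this
  must be a constant for the expansion argument.\<close>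

abbreviation pr :: "'a pmf \<Rightarrow> 'a set \<Rightarrow> real" where
  "pr P A \<equiv> measure_pmf.prob P A"

definition random_subset :: "'a set \<Rightarrow> real \<Rightarrow> 'a set pmf" where
  "random_subset A p = map_pmf (\<lambda>f. {e \<in> A. f e}) (Pi_pmf A False (\<lambda>_. bernoulli_pmf p))"

lemma Gnp_eq_random_subset: "Gnp n p = random_subset (all_edges {..<n}) p"
  by (simp add: Gnp_def random_subset_def)

lemma random_subset_subset: "X \<in> set_pmf (random_subset A p) \<Longrightarrow> X \<subseteq> A"
  by (auto simp: random_subset_def)

lemma prob_mono_support:
  assumes "\<And>x. x \<in> set_pmf P \<Longrightarrow> x \<in> A \<Longrightarrow> x \<in> B"
  shows "pr P A \<le> pr P B"
  by (rule measure_pmf.finite_measure_mono_AE) (use assms in \<open>auto simp: AE_measure_pmf_iff\<close>)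

lemma random_subset_Un:
  assumes "finite A" "finite B" "A \<inter> B = {}"
  shows "random_subset (A \<union> B) p = map_pmf (\<lambda>(X, Y). X \<union> Y) (pair_pmf (random_subset A p) (random_subset B p))"
proof -
  have "random_subset (A \<union> B) p = map_pmf (\<lambda>(f, g). {e \<in> A. f e} \<union> {e \<in> B. g e})
     (pair_pmf (Pi_pmf A False (\<lambda>_. bernoulli_pmf p)) (Pi_pmf B False (\<lambda>_. bernoulli_pmf p)))"
    unfolding random_subset_def Pi_pmf_union[OF assms] map_pmf_comp
    using assms(3) by (intro map_pmf_cong) auto
  also have "\<dots> = map_pmf (\<lambda>(X, Y). X \<union> Y) (pair_pmf (random_subset A p) (random_subset B p))"
    unfolding random_subset_def map_pair[symmetric] map_pmf_comp by (simp add: case_prod_unfold)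
  finally show ?thesis .
qed

text \<open>Conditioning on the second coordinate: by independence it may be generated
  first.\<close>

lemma prob_pair_pmf_le:
  assumes "\<And>y. y \<in> set_pmf Q \<Longrightarrow> pr P {x. \<phi> x y} \<le> q"
  shows "pr (pair_pmf P Q) {(x, y). \<phi> x y} \<le> q"
proof -
  have eq: "pair_pmf P Q = bind_pmf Q (\<lambda>y. map_pmf (\<lambda>x. (x, y)) P)"
    unfolding pair_pmf_def map_pmf_def by (rule bind_commute_pmf)
  obtain y0 where "y0 \<in> set_pmf Q" using set_pmf_not_empty[of Q] by blast
  hence q: "0 \<le> q" using assms[of y0] measure_nonneg[of P "{x. \<phi> x y0}"] by linarith
  have "emeasure (pair_pmf P Q) {(x, y). \<phi> x y} =
    (\<integral>\<^sup>+ y. emeasure P {x. \<phi> x y} \<partial>Q)"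
    unfolding eq by (simp add: vimage_def)
  also have "\<dots> \<le> (\<integral>\<^sup>+ y. ennreal q \<partial>Q)"
    using assms by (intro nn_integral_mono_AE)
      (auto simp: AE_measure_pmf_iff measure_pmf.emeasure_eq_measure q)
  also have "\<dots> = ennreal q" by (simp add: measure_pmf.emeasure_space_1)
  finally show ?thesis using q by (simp add: measure_pmf.emeasure_eq_measure)
qed

text \<open>Two-stage exposure: the edges in \<open>B\<close> are revealed first, and a bound valid
  for every outcome \<open>Y\<close> survives averaging. Later \<open>B\<close> consists of the
  edges avoiding a vertex set, so what they determine is fixed before the edges at that set are
  drawn.\<close>

lemma prob_random_subset_split_le:
  assumes "finite A" "finite B" "A \<inter> B = {}"
    and "\<And>Y. Y \<subseteq> B \<Longrightarrow> pr (random_subset A p) {X. \<phi> X Y} \<le> q"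
  shows "pr (random_subset (A \<union> B) p) {Z. \<phi> (Z \<inter> A) (Z \<inter> B)} \<le> q"
proof -
  have "pr (random_subset (A \<union> B) p) {Z. \<phi> (Z \<inter> A) (Z \<inter> B)} \<le>
    pr (pair_pmf (random_subset A p) (random_subset B p)) {(X, Y). \<phi> X Y}"
    unfolding random_subset_Un[OF assms(1-3)] measure_map_pmf
  proof (rule prob_mono_support, clarsimp)
    fix X Y assume *: "X \<in> set_pmf (random_subset A p)" "Y \<in> set_pmf (random_subset B p)"
      "\<phi> ((X \<union> Y) \<inter> A) ((X \<union> Y) \<inter> B)"
    have "X \<subseteq> A" "Y \<subseteq> B" using * random_subset_subset by blast+
    then have "(X \<union> Y) \<inter> A = X" "(X \<union> Y) \<inter> B = Y" using assms(3) by blast+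
    then show "\<phi> X Y" using * by simp
  qed
  also have "\<dots> \<le> q"
    by (rule prob_pair_pmf_le) (use assms(4) random_subset_subset in blast)
  finally show ?thesis .
qed

lemma prob_random_subset_Int:
  assumes "finite A" "B \<subseteq> A"
  shows "pr (random_subset A p) {X. \<phi> (X \<inter> B)} = pr (random_subset B p) {X. \<phi> X}"
proof -
  have "finite B" using assms finite_subset by blast
  have "random_subset B p = map_pmf (\<lambda>X. X \<inter> B) (random_subset A p)"
    unfolding random_subset_def Pi_pmf_subset[OF assms] map_pmf_comp
    using assms(2) by (intro map_pmf_cong) auto
  then show ?thesis by (simp add: vimage_def)
qed

lemma prob_random_subset_indep_le:
  assumes "finite A" "finite B" "A \<inter> B = {}"
  shows "pr (random_subset (A \<union> B) p) {Z. \<phi> (Z \<inter> A) \<and> \<psi> (Z \<inter> B)}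
    \<le> pr (random_subset A p) {X. \<phi> X} * pr (random_subset B p) {Y. \<psi> Y}"
proof -
  have "countable (Pow A)" "countable (Pow B)"
    using assms by (auto intro: countable_finite)
  have "pr (random_subset (A \<union> B) p) {Z. \<phi> (Z \<inter> A) \<and> \<psi> (Z \<inter> B)} \<le>
    pr (pair_pmf (random_subset A p) (random_subset B p)) ({X \<in> Pow A. \<phi> X} \<times> {Y \<in> Pow B. \<psi> Y})"
    unfolding random_subset_Un[OF assms] measure_map_pmf
  proof (rule prob_mono_support, clarsimp)
    fix X Y assume *: "X \<in> set_pmf (random_subset A p)" "Y \<in> set_pmf (random_subset B p)"
      "\<phi> ((X \<union> Y) \<inter> A)" "\<psi> ((X \<union> Y) \<inter> B)"
    have "X \<subseteq> A" "Y \<subseteq> B" using * random_subset_subset by blast+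
    moreover from this have "(X \<union> Y) \<inter> A = X" "(X \<union> Y) \<inter> B = Y" using assms(3) by blast+
    ultimately show "X \<subseteq> A \<and> \<phi> X \<and> Y \<subseteq> B \<and> \<psi> Y" using * by simp
  qed
  also have "\<dots> = pr (random_subset A p) {X \<in> Pow A. \<phi> X} * pr (random_subset B p) {Y \<in> Pow B. \<psi> Y}"
    using assms by (intro measure_pmf_prob_product countable_finite) auto
  also have "\<dots> \<le> pr (random_subset A p) {X. \<phi> X} * pr (random_subset B p) {Y. \<psi> Y}"
    by (intro mult_mono measure_pmf.finite_measure_mono) auto
  finally show ?thesis .
qed

text \<open>Independence on disjoint sets, one index at a time. In the application
  \<open>S i\<close> is the bundle of possible edges from the vertex \<open>i\<close> to a fixed
  target set.\<close>

lemma prob_random_subset_family_le: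
  assumes "finite I" "finite A" "\<And>i. i \<in> I \<Longrightarrow> S i \<subseteq> A"
    and "\<And>i j. i \<in> I \<Longrightarrow> j \<in> I \<Longrightarrow> i \<noteq> j \<Longrightarrow> S i \<inter> S j = {}"
    and "\<And>i. i \<in> I \<Longrightarrow> pr (random_subset (S i) p) {X. \<phi> i X} \<le> q" and "0 \<le> q"
  shows "pr (random_subset A p) {X. \<forall>i\<in>I. \<phi> i (X \<inter> S i)} \<le> q ^ card I"
  using assms
proof (induction I arbitrary: A rule: finite_induct)
  case empty
  then show ?case by simp
next
  case (insert i I)
  let ?B = "\<Union>(S ` I)"
  have fin: "finite (S i)" "finite ?B"
  proof -
    show "finite (S i)" by (rule finite_subset[OF insert.prems(2) insert.prems(1)]) simp
    show "finite ?B" by (rule finite_subset[OF _ insert.prems(1)]) (use insert.prems(2) in blast)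
  qed
  have disj: "S i \<inter> ?B = {}" using insert.prems(3)[of i] insert.hyps(2) by blast
  have "pr (random_subset A p) {X. \<forall>j\<in>insert i I. \<phi> j (X \<inter> S j)} =
    pr (random_subset A p) {X. \<phi> i (X \<inter> (S i \<union> ?B) \<inter> S i) \<and> (\<forall>j\<in>I. \<phi> j (X \<inter> (S i \<union> ?B) \<inter> ?B \<inter> S j))}"
  proof (intro arg_cong[where f = "pr (random_subset A p)"] Collect_cong)
    fix X
    have "X \<inter> (S i \<union> ?B) \<inter> S i = X \<inter> S i" by blast
    moreover have "X \<inter> (S i \<union> ?B) \<inter> ?B \<inter> S j = X \<inter> S j" if "j \<in> I" for j using that by blast
    ultimately show "(\<forall>j\<in>insert i I. \<phi> j (X \<inter> S j)) \<longleftrightarrow>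
      \<phi> i (X \<inter> (S i \<union> ?B) \<inter> S i) \<and> (\<forall>j\<in>I. \<phi> j (X \<inter> (S i \<union> ?B) \<inter> ?B \<inter> S j))" by simp
  qed
  also have "\<dots> = pr (random_subset (S i \<union> ?B) p) {X. \<phi> i (X \<inter> S i) \<and> (\<forall>j\<in>I. \<phi> j (X \<inter> ?B \<inter> S j))}"
    using insert.prems(1,2)
    by (intro prob_random_subset_Int[where \<phi> = "\<lambda>X. \<phi> i (X \<inter> S i) \<and> (\<forall>j\<in>I. \<phi> j (X \<inter> ?B \<inter> S j))"]) auto
  also have "\<dots> \<le> pr (random_subset (S i) p) {X. \<phi> i X} *
      pr (random_subset ?B p) {X. \<forall>j\<in>I. \<phi> j (X \<inter> S j)}"
    by (rule prob_random_subset_indep_le[OF fin disj, where \<psi> = "\<lambda>X. \<forall>j\<in>I. \<phi> j (X \<inter> S j)"])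
  also have "\<dots> \<le> q * q ^ card I"
  proof (intro mult_mono)
    show "pr (random_subset (S i) p) {X. \<phi> i X} \<le> q"
      using insert.prems(4) by blast
    show "pr (random_subset ?B p) {X. \<forall>j\<in>I. \<phi> j (X \<inter> S j)} \<le> q ^ card I"
      using insert.prems(3,4) by (intro insert.IH fin(2) insert.prems(5)) blast+
  qed (use insert.prems(5) in simp_all)
  finally show ?case using insert.hyps by simp
qed

lemma prob_random_subset_superset:
  assumes "finite A" "F \<subseteq> A" "0 \<le> p" "p \<le> 1"
  shows "pr (random_subset A p) {X. F \<subseteq> X} = p ^ card F"
proof -
  have "pr (random_subset A p) {X. F \<subseteq> X} = pr (random_subset F p) {X. F \<subseteq> X}"
  proof -
    have "{X. F \<subseteq> X} = {X. F \<subseteq> X \<inter> F}" by auto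
    then show ?thesis using prob_random_subset_Int[OF assms(1,2), of p "\<lambda>X. F \<subseteq> X"] by metis
  qed
  also have "\<dots> = pr (Pi_pmf F False (\<lambda>_. bernoulli_pmf p)) (Pi F (\<lambda>_. {True}))"
  proof -
    have "(\<lambda>f. {e \<in> F. f e}) -` {X. F \<subseteq> X} = Pi F (\<lambda>_. {True})" by auto
    then show ?thesis by (simp add: random_subset_def measure_map_pmf)
  qed
  also have "\<dots> = p ^ card F"
    using assms(3,4) by (simp add: measure_Pi_pmf_Pi[OF finite_subset[OF assms(2,1)]] measure_pmf_single)
  finally show ?thesis .
qed

lemma prob_random_subset_Bex_superset_le:
  fixes p :: real
  assumes "finite A" "finite \<F>" "\<And>F. F \<in> \<F> \<Longrightarrow> F \<subseteq> A \<and> card F = m" "0 \<le> p" "p \<le> 1"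
  shows "pr (random_subset A p) {X. \<exists>F\<in>\<F>. F \<subseteq> X} \<le> card \<F> * p ^ m"
proof -
  have "{X. \<exists>F\<in>\<F>. F \<subseteq> X} = (\<Union>F\<in>\<F>. {X. F \<subseteq> X})" by auto
  then have "pr (random_subset A p) {X. \<exists>F\<in>\<F>. F \<subseteq> X} \<le>
    (\<Sum>F\<in>\<F>. pr (random_subset A p) {X. F \<subseteq> X})"
    using measure_pmf.finite_measure_subadditive_finite[OF assms(2), of "\<lambda>F. {X. F \<subseteq> X}" "random_subset A p"] by simp
  also have "\<dots> = (\<Sum>F\<in>\<F>. p ^ m)"
    using assms by (intro sum.cong refl) (simp add: prob_random_subset_superset)
  finally show ?thesis by simp
qed

lemma prob_random_subset_card_eq_binomial:
  assumes "finite A" "0 \<le> p" "p \<le> 1"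
  shows "pr (random_subset A p) {X. d \<le> card X} = pr (binomial_pmf (card A) p) {d..}"
proof -
  have "p \<in> {0..1}" using assms by simp
  from binomial_pmf_altdef'[OF assms(1) refl this, of False] have
    "binomial_pmf (card A) p = map_pmf card (random_subset A p)"
    by (simp only: random_subset_def map_pmf_comp o_def)
  then show ?thesis by (simp add: vimage_def)
qed

text \<open>Coupling: a random subset of the smaller ground set is the trace of one of the
  larger.\<close>

lemma prob_binomial_ge_mono:
  assumes "N \<le> N'" "0 \<le> p" "p \<le> 1"
  shows "pr (binomial_pmf N p) {d..} \<le> pr (binomial_pmf N' p) {d..}"
proof -
  have "pr (binomial_pmf N p) {d..} = pr (random_subset {..<N} p) {X. d \<le> card X}"
    using prob_random_subset_card_eq_binomial[of "{..<N}" p d] assms by simp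
  also have "\<dots> = pr (random_subset {..<N'} p) {X. d \<le> card (X \<inter> {..<N})}"
    using prob_random_subset_Int[of "{..<N'}" "{..<N}" p "\<lambda>X. d \<le> card X"] assms by simp
  also have "\<dots> \<le> pr (random_subset {..<N'} p) {X. d \<le> card X}"
  proof (rule prob_mono_support, clarsimp)
    fix X assume "X \<in> set_pmf (random_subset {..<N'} p)" and d: "d \<le> card (X \<inter> {..<N})"
    then have "finite X" by (meson random_subset_subset finite_lessThan finite_subset)
    then have "card (X \<inter> {..<N}) \<le> card X" by (simp add: card_mono)
    with d show "d \<le> card X" by simp
  qed
  also have "\<dots> = pr (binomial_pmf N' p) {d..}"
    using prob_random_subset_card_eq_binomial[of "{..<N'}" p d] assms by simp
  finally show ?thesis .
qed

section \<open>Poisson tails and the fixed point iteration\<close>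

text \<open>Closed form of Pr[Poisson(y) \<ge> d], defined for every real \<open>y\<close>, so that
  continuity and derivatives are available at 0 as well.\<close>

definition poisson_tail :: "nat \<Rightarrow> real \<Rightarrow> real" where
  "poisson_tail d y = 1 - exp (- y) * (\<Sum>i<d. y ^ i / fact i)"

lemma prob_ge_eq_1_minus_sum:
  "pr (P :: nat pmf) {d..} = 1 - (\<Sum>i<d. pmf P i)"
proof -
  have "{d..} = space (measure_pmf P) - {..<d}" by auto
  then have "pr P {d..} = 1 - pr P {..<d}"
    by (metis measure_pmf.prob_compl sets_measure_pmf UNIV_I)
  then show ?thesis by (simp add: measure_measure_pmf_finite)
qed

lemma prob_poisson0_ge:
  assumes "0 \<le> y" "1 \<le> d"
  shows "pr (poisson0_pmf y) {j. j \<ge> d} = poisson_tail d y"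
proof (cases "y = 0")
  case True
  have "(\<Sum>i<d. (0::real) ^ i / fact i) = (\<Sum>i<d. if i = 0 then 1 else 0)"
    by (intro sum.cong) auto
  also have "\<dots> = 1" using assms by simp
  finally show ?thesis using True assms by (simp add: poisson0_pmf_def poisson_tail_def)
next
  case False
  then have "y > 0" using assms by simp
  have "pr (poisson_pmf y) {d..} = 1 - (\<Sum>i<d. y ^ i / fact i * exp (- y))"
    using \<open>y > 0\<close> by (simp add: prob_ge_eq_1_minus_sum)
  then show ?thesis using False
    by (simp add: poisson0_pmf_def poisson_tail_def atLeast_def sum_distrib_left mult.commute)
qed

text \<open>The derivative of the sum telescopes and leaves the Poisson weight at \<open>d\<close>;
  its sign gives monotonicity of the tail.\<close>

lemma poisson_tail_deriv: "(poisson_tail (Suc d) has_real_derivative exp (- y) * y ^ d / fact d) (at y)"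
proof (induction d)
  case 0
  show ?case unfolding poisson_tail_def[abs_def] by (auto intro!: derivative_eq_intros)
next
  case (Suc d)
  have eq: "poisson_tail (Suc (Suc d)) = (\<lambda>y. poisson_tail (Suc d) y - exp (- y) * y ^ Suc d / fact (Suc d))"
    by (auto simp: poisson_tail_def fun_eq_iff algebra_simps)
  have "((\<lambda>y. poisson_tail (Suc d) y - exp (- y) * y ^ Suc d / fact (Suc d)) has_real_derivative
    exp (- y) * y ^ d / fact d -
      (exp (- y) * (real (Suc d) * y ^ d) - exp (- y) * y ^ Suc d) / fact (Suc d)) (at y)"
  proof (intro DERIV_diff Suc DERIV_cdivide)
    have "((\<lambda>y. exp (- y)) has_real_derivative - exp (- y)) (at y)"
      by (auto intro!: derivative_eq_intros)
    from DERIV_mult[OF this DERIV_pow[of "Suc d" y]]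
    show "((\<lambda>y. exp (- y) * y ^ Suc d) has_real_derivative
      exp (- y) * (real (Suc d) * y ^ d) - exp (- y) * y ^ Suc d) (at y)"
      by (simp add: algebra_simps del: power_Suc)
  qed
  moreover have "exp (- y) * y ^ d / fact d -
      (exp (- y) * (real (Suc d) * y ^ d) - exp (- y) * y ^ Suc d) / fact (Suc d)
    = exp (- y) * y ^ Suc d / fact (Suc d)"
  proof -
    have "exp (- y) * (real (Suc d) * y ^ d) / fact (Suc d) = exp (- y) * y ^ d / fact d"
      unfolding fact_Suc by (simp del: of_nat_Suc)
    then show ?thesis unfolding diff_divide_distrib by simp
  qed
  ultimately show ?case unfolding eq by simp
qed

lemma poisson_tail_mono: "0 \<le> x \<Longrightarrow> x \<le> y \<Longrightarrow> 1 \<le> d \<Longrightarrow> poisson_tail d x \<le> poisson_tail d y"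
  by (cases d; clarsimp; rule DERIV_nonneg_imp_nondecreasing[where f = "poisson_tail _"])
     (use poisson_tail_deriv in \<open>auto intro!: exI\<close>)

lemma poisson_tail_0: "1 \<le> d \<Longrightarrow> poisson_tail d 0 = 0"
  using prob_poisson0_ge[of 0 d] by (auto simp: poisson0_pmf_def)

lemma poisson_tail_le_1: "0 \<le> y \<Longrightarrow> poisson_tail d y \<le> 1"
  by (auto simp: poisson_tail_def intro!: mult_nonneg_nonneg sum_nonneg)

lemma continuous_poisson_tail: "isCont (poisson_tail d) y"
  unfolding poisson_tail_def[abs_def] by (intro continuous_intros) auto

text \<open>With d = k - 1 this is the chance that the root of a Poisson(c) branching tree survives
  \<open>j\<close> rounds when every vertex needs \<open>d\<close> surviving children. It will bound
  the proportion of vertices in \<open>rsurv k G j\<close>.\<close>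

fun survival_iter :: "nat \<Rightarrow> real \<Rightarrow> nat \<Rightarrow> real" where
  "survival_iter d c 0 = 1"
| "survival_iter d c (Suc j) = poisson_tail d (c * survival_iter d c j)"

lemma survival_iter_bounds: "0 < c \<Longrightarrow> 1 \<le> d \<Longrightarrow> 0 \<le> survival_iter d c j \<and> survival_iter d c j \<le> 1"
proof (induction j)
  case (Suc j)
  then have "poisson_tail d 0 \<le> poisson_tail d (c * survival_iter d c j)" by (intro poisson_tail_mono) auto
  with Suc show ?case by (auto simp: poisson_tail_0 intro!: poisson_tail_le_1)
qed auto

lemma survival_iter_decreasing: "0 < c \<Longrightarrow> 1 \<le> d \<Longrightarrow> survival_iter d c (Suc j) \<le> survival_iter d c j"
proof (induction j)
  case 0
  then show ?case by (auto intro!: poisson_tail_le_1)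
next
  case (Suc j)
  have "poisson_tail d (c * survival_iter d c (Suc j)) \<le> poisson_tail d (c * survival_iter d c j)"
    using Suc survival_iter_bounds[of c d "Suc j"] by (intro poisson_tail_mono mult_left_mono) auto
  then show ?case by simp
qed

text \<open>The iterates decrease to a fixed point \<open>L\<close>. By monotonicity every fixed
  point in the unit interval lies below all iterates, hence below \<open>L\<close>; so the greatest
  fixed point in \<open>core_beta\<close> exists and equals \<open>L\<close>. If it were positive,
  \<open>c\<close> would belong to the set whose infimum is the threshold.\<close>

lemma survival_iter_tendsto_0:
  assumes "0 < c" "1 \<le> d" "c < core_threshold (d + 1)"
  shows "survival_iter d c \<longlonglongrightarrow> 0"
proof -
  have "decseq (survival_iter d c)" using survival_iter_decreasing[OF assms(1,2)] by (rule decseq_SucI)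
  then obtain L where L: "survival_iter d c \<longlonglongrightarrow> L"
    using decseq_convergent[of "survival_iter d c" 0] survival_iter_bounds[OF assms(1,2)] by blast
  have L01: "0 \<le> L" "L \<le> 1"
    using LIMSEQ_le_const[OF L] LIMSEQ_le_const2[OF L] survival_iter_bounds[OF assms(1,2)] by blast+
  have "(\<lambda>j. poisson_tail d (c * survival_iter d c j)) \<longlonglongrightarrow> poisson_tail d (c * L)"
    by (intro isCont_tendsto_compose[OF continuous_poisson_tail] tendsto_intros L)
  moreover have "(\<lambda>j. survival_iter d c (Suc j)) \<longlonglongrightarrow> L" using L by (rule LIMSEQ_Suc)
  ultimately have fix_L: "L = poisson_tail d (c * L)" using LIMSEQ_unique by simp blast
  have eq: "pr (poisson0_pmf (c * x)) {j. j \<ge> (d + 1) - 1} = poisson_tail d (c * x)" if "0 \<le> x" for x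
    using that assms prob_poisson0_ge[of "c * x" d] by simp
  have upper: "x \<le> L" if x: "0 \<le> x" "x \<le> 1" "x = poisson_tail d (c * x)" for x
  proof -
    have "x \<le> survival_iter d c j" for j
    proof (induction j)
      case (Suc j)
      have "poisson_tail d (c * x) \<le> poisson_tail d (c * survival_iter d c j)"
        using Suc x assms by (intro poisson_tail_mono mult_left_mono) auto
      then show ?case using x by simp
    qed (use x in simp)
    then show ?thesis using LIMSEQ_le_const[OF L] by blast
  qed
  have "core_beta (d + 1) c = L"
    unfolding core_beta_def
  proof (rule Greatest_equality)
    show "L \<in> {0..1} \<and> L = pr (poisson0_pmf (c * L)) {j. j \<ge> (d + 1) - 1}"
      using L01 fix_L eq by simp
    fix x assume "x \<in> {0..1} \<and> x = pr (poisson0_pmf (c * x)) {j. j \<ge> (d + 1) - 1}"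
    then have "0 \<le> x" "x \<le> 1" "x = poisson_tail d (c * x)" using eq[of x] by simp_all
    then show "x \<le> L" by (rule upper)
  qed
  have "L = 0"
  proof (rule ccontr)
    assume "L \<noteq> 0"
    then have "c \<in> {c. c > 0 \<and> core_beta (d + 1) c > 0}"
      using L01 assms \<open>core_beta (d + 1) c = L\<close> by simp
    then have "core_threshold (d + 1) \<le> c"
      unfolding core_threshold_def by (intro cInf_lower bdd_belowI[where m = 0]) auto
    then show False using assms by simp
  qed
  with L show ?thesis by simp
qed

section \<open>Poisson limit of binomial tails\<close>

lemma one_minus_power_tendsto:
  fixes a :: "nat \<Rightarrow> nat" and c l :: real
  assumes "0 < c" "(\<lambda>n. real (a n) / real n) \<longlonglongrightarrow> l"
  shows "(\<lambda>n. (1 - c / real n) ^ a n) \<longlonglongrightarrow> exp (- (c * l))"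
proof -
  have "(\<lambda>n. real n * ln (1 - c / real n)) \<longlonglongrightarrow> - c" using assms(1) by real_asymp
  from tendsto_exp[OF tendsto_mult[OF assms(2) this]]
  have "(\<lambda>n. exp (real (a n) / real n * (real n * ln (1 - c / real n)))) \<longlonglongrightarrow> exp (l * - c)" .
  moreover have "\<forall>\<^sub>F n in sequentially. exp (real (a n) / real n * (real n * ln (1 - c / real n))) = (1 - c / real n) ^ a n"
    using eventually_gt_at_top[of "nat \<lceil>c\<rceil>"]
  proof eventually_elim
    case (elim n)
    then have n: "c < real n" by linarith
    then have pos: "0 < 1 - c / real n" using assms(1) by (simp add: field_simps)
    have "exp (real (a n) / real n * (real n * ln (1 - c / real n))) = exp (real (a n) * ln (1 - c / real n))"
      using n assms(1) by simp
    also have "\<dots> = (1 - c / real n) ^ a n" using pos by (simp add: exp_of_nat_mult)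
    finally show ?case .
  qed
  ultimately show ?thesis by (simp add: tendsto_cong mult.commute)
qed

text \<open>The number of trials is only asymptotic to l n: the candidate neighbours will be the
  rooted survivors, a fraction of all vertices.\<close>

lemma binomial_tail_tendsto:
  fixes N :: "nat \<Rightarrow> nat" and c l :: real
  assumes "0 < c" "(\<lambda>n. real (N n) / real n) \<longlonglongrightarrow> l"
  shows "(\<lambda>n. pr (binomial_pmf (N n) (c / real n)) {d..}) \<longlonglongrightarrow> poisson_tail d (c * l)"
proof -
  have term_lim: "(\<lambda>n. real (N n choose i) * (c / real n) ^ i * (1 - c / real n) ^ (N n - i))
      \<longlonglongrightarrow> (c * l) ^ i / fact i * exp (- (c * l))" for i
  proof (intro tendsto_mult one_minus_power_tendsto assms(1))
    have inv: "(\<lambda>n. r / real n) \<longlonglongrightarrow> 0" for r :: real by real_asymp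
    \<comment> \<open>The falling factorial supplies \<open>i\<close> factors, each tending to
      \<open>l\<close> after division by \<open>n\<close>.\<close>
    have "real (N n choose i) * (c / real n) ^ i = (\<Prod>m=0..<i. (real (N n) / real n - real m / real n) * c) / fact i" for n
    proof -
      have "real (N n choose i) * (c / real n) ^ i = (\<Prod>m=0..<i. real (N n) - real m) * (\<Prod>m=0..<i. c / real n) / fact i"
        by (simp add: binomial_gbinomial gbinomial_prod_rev)
      also have "\<dots> = (\<Prod>m=0..<i. (real (N n) / real n - real m / real n) * c) / fact i"
        unfolding prod.distrib[symmetric] by (simp add: diff_divide_distrib algebra_simps)
      finally show ?thesis .
    qed
    moreover have "(\<lambda>n. (\<Prod>m=0..<i. (real (N n) / real n - real m / real n) * c) / fact i)
        \<longlonglongrightarrow> (\<Prod>m=0..<i. (l - 0) * c) / fact i"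
      by (intro tendsto_intros assms(2) inv) auto
    ultimately show "(\<lambda>n. real (N n choose i) * (c / real n) ^ i) \<longlonglongrightarrow> (c * l) ^ i / fact i"
      by (simp add: mult.commute)
    show "(\<lambda>n. real (N n - i) / real n) \<longlonglongrightarrow> l"
    proof (rule tendsto_sandwich[OF _ _ _ assms(2)])
      show "(\<lambda>n. real (N n) / real n - real i / real n) \<longlonglongrightarrow> l"
        using tendsto_diff[OF assms(2) inv[of "real i"]] by simp
      show "\<forall>\<^sub>F n in sequentially. real (N n) / real n - real i / real n \<le> real (N n - i) / real n"
        by (intro always_eventually allI) (simp add: diff_divide_distrib[symmetric] divide_right_mono)
      show "\<forall>\<^sub>F n in sequentially. real (N n - i) / real n \<le> real (N n) / real n"
        by (intro always_eventually allI) (simp add: divide_right_mono)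
    qed
  qed
  have "(\<lambda>n. 1 - (\<Sum>i<d. real (N n choose i) * (c / real n) ^ i * (1 - c / real n) ^ (N n - i)))
     \<longlonglongrightarrow> 1 - (\<Sum>i<d. (c * l) ^ i / fact i * exp (- (c * l)))"
    by (intro tendsto_intros term_lim)
  moreover have "\<forall>\<^sub>F n in sequentially. 1 - (\<Sum>i<d. real (N n choose i) * (c / real n) ^ i * (1 - c / real n) ^ (N n - i))
      = pr (binomial_pmf (N n) (c / real n)) {d..}"
    using eventually_gt_at_top[of "nat \<lceil>c\<rceil>"]
  proof eventually_elim
    case (elim n)
    then have "c < real n" by linarith
    then have "0 \<le> c / real n" "c / real n \<le> 1" using assms(1) by (simp_all add: field_simps)
    then show ?case by (simp add: prob_ge_eq_1_minus_sum)
  qed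
  ultimately show ?thesis
    by (simp add: tendsto_cong poisson_tail_def sum_distrib_left mult.commute)
qed

section \<open>Connected sets and peeling\<close>

definition nbrs :: "'a set set \<Rightarrow> 'a \<Rightarrow> 'a set" where
  "nbrs E v = {w. {v, w} \<in> E}"

definition graph :: "'a set set \<Rightarrow> bool" where
  "graph E \<longleftrightarrow> finite E \<and> (\<forall>e\<in>E. card e = 2)"

text \<open>Connectedness in terms of cuts, which lets connected sets be grown vertex by vertex.\<close>

definition conn :: "'a set set \<Rightarrow> 'a set \<Rightarrow> bool" where
  "conn E Q \<longleftrightarrow> (\<forall>A. A \<noteq> {} \<and> A \<subset> Q \<longrightarrow> (\<exists>a\<in>A. \<exists>b\<in>Q - A. {a, b} \<in> E))"

lemma graph_subset: "graph E \<Longrightarrow> E' \<subseteq> E \<Longrightarrow> graph E'"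
  unfolding graph_def by (auto intro: finite_subset)

lemma graph_all_edges: "finite V \<Longrightarrow> graph (all_edges V)"
  unfolding graph_def all_edges_def by (auto intro: finite_subset[of _ "Pow V"])

lemma graph_irrefl: "graph E \<Longrightarrow> {v, w} \<in> E \<Longrightarrow> v \<noteq> w"
  unfolding graph_def by fastforce

lemma graph_edgeE:
  assumes "graph E" "e \<in> E"
  obtains v w where "e = {v, w}" "v \<noteq> w"
  using assms unfolding graph_def by (meson card_2_iff)

lemma finite_Union_graph: "graph E \<Longrightarrow> finite (\<Union>E)"
  unfolding graph_def by (intro finite_Union) (auto intro: card_ge_0_finite)

lemma finite_nbrs: "graph E \<Longrightarrow> finite (nbrs E v)"
  by (rule finite_subset[OF _ finite_Union_graph[of E]]) (auto simp: nbrs_def)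

lemma nbrs_mono: "E \<subseteq> E' \<Longrightarrow> nbrs E v \<subseteq> nbrs E' v"
  by (auto simp: nbrs_def)

lemma conn_singleton: "conn E {x}"
  unfolding conn_def by (metis psubset_imp_subset subset_singleton_iff psubset_eq)

lemma conn_insert:
  assumes "conn E Q" "a \<in> Q" "{a, b} \<in> E"
  shows "conn E (insert b Q)"
proof (cases "b \<in> Q")
  case True
  then show ?thesis using assms by (simp add: insert_absorb)
next
  case b: False
  show ?thesis unfolding conn_def
  proof (intro allI impI)
    fix A assume A: "A \<noteq> {} \<and> A \<subset> insert b Q"
    show "\<exists>x\<in>A. \<exists>y\<in>insert b Q - A. {x, y} \<in> E"
    proof (cases "b \<in> A")
      case False
      then consider "A = Q" | "A \<subset> Q" using A by blast
      then show ?thesis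
      proof cases
        case 1
        then show ?thesis using assms b by blast
      next
        case 2
        then obtain x y where "x \<in> A" "y \<in> Q - A" "{x, y} \<in> E"
          using assms(1) A unfolding conn_def by meson
        then show ?thesis by blast
      qed
    next
      case True
      let ?A = "A - {b}"
      have sub: "?A \<subset> Q" using A True b by blast
      show ?thesis
      proof (cases "?A = {}")
        case True
        then have "A = {b}" using \<open>b \<in> A\<close> by blast
        moreover have "a \<noteq> b" using assms(2) b by blast
        ultimately show ?thesis using assms(2,3) by (auto simp: insert_commute)
      next
        case False
        then obtain x y where "x \<in> ?A" "y \<in> Q - ?A" "{x, y} \<in> E"
          using assms(1) sub unfolding conn_def by meson
        moreover from this have "y \<noteq> b" using b by blast
        ultimately show ?thesis by blast
      qed
    qed
  qed
qed

text \<open>Grow \<open>A\<close> to \<open>Q\<close> vertex by vertex along cut edges. Each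
  absorbed vertex is paid for by the edge that absorbs it; afterwards this edge has both ends in the
  grown set and is not counted again.\<close>

lemma conn_edges_ge:
  assumes "graph E" "conn E Q" "finite Q" "A \<subseteq> Q" "A \<noteq> {}"
  shows "card (Q - A) \<le> card {e \<in> E. e \<subseteq> Q \<and> e \<inter> (Q - A) \<noteq> {}}"
  using assms(4,5)
proof (induction "card (Q - A)" arbitrary: A)
  case 0
  then show ?case by simp
next
  case (Suc n)
  then have "A \<subset> Q" by (metis Diff_cancel card.empty nat.distinct(1) psubsetI)
  then obtain a b where ab: "a \<in> A" "b \<in> Q - A" "{a, b} \<in> E"
    using assms(2) Suc.prems unfolding conn_def by meson
  have "n = card (Q - insert b A)"
    using Suc.hyps(2) ab assms(3) by (metis Diff_insert card_Diff_singleton diff_Suc_1)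
  then have IH: "card (Q - insert b A) \<le> card {e \<in> E. e \<subseteq> Q \<and> e \<inter> (Q - insert b A) \<noteq> {}}"
    using Suc.hyps(1)[of "insert b A"] Suc.prems ab by blast
  have fin: "finite E" using assms(1) by (simp add: graph_def)
  have "{a, b} \<notin> {e \<in> E. e \<subseteq> Q \<and> e \<inter> (Q - insert b A) \<noteq> {}}" using ab by blast
  then have "Suc (card {e \<in> E. e \<subseteq> Q \<and> e \<inter> (Q - insert b A) \<noteq> {}}) =
    card (insert {a, b} {e \<in> E. e \<subseteq> Q \<and> e \<inter> (Q - insert b A) \<noteq> {}})"
    using fin by simp
  also have "\<dots> \<le> card {e \<in> E. e \<subseteq> Q \<and> e \<inter> (Q - A) \<noteq> {}}"
    using fin ab Suc.prems by (intro card_mono) auto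
  finally show ?case using IH Suc.hyps(2) \<open>n = card (Q - insert b A)\<close> by linarith
qed

lemma conn_card_le_edges:
  assumes "graph E" "conn E Q" "finite Q"
  shows "card Q \<le> card {e \<in> E. e \<subseteq> Q} + 1"
proof (cases "Q = {}")
  case False
  then obtain x where x: "x \<in> Q" by blast
  have "card (Q - {x}) \<le> card {e \<in> E. e \<subseteq> Q \<and> e \<inter> (Q - {x}) \<noteq> {}}"
    using x by (intro conn_edges_ge assms) auto
  also have "\<dots> \<le> card {e \<in> E. e \<subseteq> Q}"
    using assms(1) by (intro card_mono) (auto simp: graph_def)
  finally show ?thesis using x assms(3) by simp
qed simp

text \<open>Hits the size \<open>s\<close> exactly, which matters because the probabilistic bounds
  are applied to sets of one prescribed size.\<close>

lemma conn_enlarge: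
  assumes "conn E Q" "finite Q"
    and "conn E K" "K \<subseteq> Q" "K \<noteq> {}" "card K \<le> s" "s \<le> card Q"
  shows "\<exists>U. K \<subseteq> U \<and> U \<subseteq> Q \<and> conn E U \<and> card U = s"
  using assms(3-6)
proof (induction "s - card K" arbitrary: K)
  case 0
  then show ?case by (intro exI[of _ K]) auto
next
  case (Suc n)
  then have "K \<noteq> Q" using assms(7) by auto
  then obtain a b where ab: "a \<in> K" "b \<in> Q - K" "{a, b} \<in> E"
    using assms(1) Suc.prems unfolding conn_def by (metis psubsetI)
  have "finite K" using Suc.prems assms(2) finite_subset by blast
  then have "card (insert b K) = Suc (card K)" using ab by simp
  then have "\<exists>U. insert b K \<subseteq> U \<and> U \<subseteq> Q \<and> conn E U \<and> card U = s"
    using Suc.prems Suc.hyps(2) ab by (intro Suc.hyps(1) conn_insert[of E K a b]) auto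
  then show ?case by blast
qed

section \<open>Components of induced subgraphs\<close>

definition comp_in :: "'a set set \<Rightarrow> 'a set \<Rightarrow> 'a \<Rightarrow> 'a set" where
  "comp_in E A x = {y. (x, y) \<in> {(a, b). a \<in> A \<and> b \<in> A \<and> {a, b} \<in> E}\<^sup>*}"

lemma comp_in_self: "x \<in> comp_in E A x"
  by (simp add: comp_in_def)

lemma comp_in_subset: "x \<in> A \<Longrightarrow> comp_in E A x \<subseteq> A"
proof
  fix y assume "x \<in> A" "y \<in> comp_in E A x"
  from this(2) have "(x, y) \<in> {(a, b). a \<in> A \<and> b \<in> A \<and> {a, b} \<in> E}\<^sup>*" by (simp add: comp_in_def)
  then show "y \<in> A" by (induction rule: rtrancl_induct) (use \<open>x \<in> A\<close> in auto)
qed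

lemma comp_in_closed: "y \<in> comp_in E A x \<Longrightarrow> y \<in> A \<Longrightarrow> z \<in> A \<Longrightarrow> {y, z} \<in> E \<Longrightarrow> z \<in> comp_in E A x"
  unfolding comp_in_def mem_Collect_eq by (erule rtrancl_into_rtrancl) simp

lemma conn_comp_in: "conn E (comp_in E A x)"
  unfolding conn_def
proof (intro allI impI)
  let ?r = "{(a, b). a \<in> A \<and> b \<in> A \<and> {a, b} \<in> E}"
  fix B assume B: "B \<noteq> {} \<and> B \<subset> comp_in E A x"
  have symr: "sym (?r\<^sup>*)" by (intro sym_rtrancl) (auto simp: sym_def insert_commute)
  obtain a c where ac: "a \<in> B" "c \<in> comp_in E A x - B" using B by blast
  then have "(a, x) \<in> ?r\<^sup>*" "(x, c) \<in> ?r\<^sup>*" using B symr by (auto simp: comp_in_def sym_def)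
  then have "(a, c) \<in> ?r\<^sup>*" by simp
  then have "c \<in> B \<or> (\<exists>a\<in>B. \<exists>b\<in>comp_in E A x - B. {a, b} \<in> E)"
  proof (induction rule: rtrancl_induct)
    case base
    then show ?case using ac by blast
  next
    case (step y z)
    show ?case
    proof (cases "y \<in> B \<and> z \<notin> B")
      case True
      then have "y \<in> comp_in E A x" using B by blast
      then have "z \<in> comp_in E A x"
        by (rule comp_in_closed) (use step.hyps(2) in auto)
      then show ?thesis using True step.hyps(2) by blast
    qed (use step.IH in blast)
  qed
  then show "\<exists>a\<in>B. \<exists>b\<in>comp_in E A x - B. {a, b} \<in> E" using ac by blast
qed

text \<open>\<open>j\<close> rounds of peeling towards the \<open>k\<close>-core, where the vertices of \<open>X\<close> are never deleted.\<close>

fun surv :: "nat \<Rightarrow> 'a set set \<Rightarrow> 'a set \<Rightarrow> nat \<Rightarrow> 'a set" where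
  "surv k E X 0 = UNIV"
| "surv k E X (Suc j) = {u. u \<in> X \<or> k \<le> card (nbrs E u \<inter> surv k E X j)}"

text \<open>The vertices that survive if they are granted one additional neighbour: a vertex next to a removed
  set \<open>U\<close> loses its neighbour in \<open>U\<close>, which lowers the requirement at this vertex from \<open>k\<close> to \<open>k - 1\<close>.\<close>

fun rsurv :: "nat \<Rightarrow> 'a set set \<Rightarrow> nat \<Rightarrow> 'a set" where
  "rsurv k E 0 = UNIV"
| "rsurv k E (Suc j) = {y. k - 1 \<le> card (nbrs E y \<inter> surv k E {y} j)}"

abbreviation avoiding :: "'a set set \<Rightarrow> 'a set \<Rightarrow> 'a set set" where
  "avoiding E U \<equiv> {e \<in> E. e \<inter> U = {}}"

abbreviation attached :: "nat \<Rightarrow> 'a set set \<Rightarrow> 'a set \<Rightarrow> nat \<Rightarrow> 'a set" where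
  "attached k E U j \<equiv> {x \<in> U. \<exists>y. {x, y} \<in> E \<and> y \<notin> U \<and> y \<in> rsurv k (avoiding E U) j}"

lemma surv_mono:
  assumes "graph E'" "E \<subseteq> E'" "X \<subseteq> X'"
  shows "surv k E X j \<subseteq> surv k E' X' j"
proof (induction j)
  case (Suc j)
  have "card (nbrs E u \<inter> surv k E X j) \<le> card (nbrs E' u \<inter> surv k E' X' j)" for u
    using nbrs_mono[OF assms(2), of u] Suc finite_nbrs[OF assms(1)] by (intro card_mono) auto
  then show ?case using assms(3) by (auto intro: order_trans)
qed simp

lemma surv_Suc_subset:
  assumes "graph E"
  shows "surv k E X (Suc j) \<subseteq> surv k E X j"
proof (induction j)
  case (Suc j)
  have "card (nbrs E u \<inter> surv k E X (Suc j)) \<le> card (nbrs E u \<inter> surv k E X j)" for u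
    using Suc finite_nbrs[OF assms] by (intro card_mono) auto
  then show ?case by (auto intro: order_trans)
qed simp

lemma rsurv_mono:
  assumes "graph E'" "E \<subseteq> E'"
  shows "rsurv k E j \<subseteq> rsurv k E' j"
proof (cases j)
  case (Suc i)
  have "card (nbrs E u \<inter> surv k E {u} i) \<le> card (nbrs E' u \<inter> surv k E' {u} i)" for u
    using nbrs_mono[OF assms(2), of u] surv_mono[OF assms, of "{u}" "{u}" k i] finite_nbrs[OF assms(1)]
    by (intro card_mono) auto
  then show ?thesis using Suc by (auto intro: order_trans)
qed simp

definition cross :: "'a set set \<Rightarrow> 'a set \<Rightarrow> 'a set \<Rightarrow> 'a set set" where
  "cross E Q U = {e \<in> E. e \<inter> Q \<noteq> {} \<and> e \<inter> U \<noteq> {}}"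

text \<open>An ear closes a cycle through \<open>U\<close>; it is the only obstruction to passing from survival in \<open>E\<close> to
  rooted survival in \<open>E - U\<close>.\<close>

definition ear :: "'a set set \<Rightarrow> 'a set \<Rightarrow> nat \<Rightarrow> 'a set \<Rightarrow> bool" where
  "ear E U m Q \<longleftrightarrow> finite Q \<and> card Q \<le> m \<and> Q \<inter> U = {} \<and> conn E Q \<and> 2 \<le> card (cross E Q U)"

text \<open>Explore the vertices that witness the survival of \<open>y\<close>, starting at
  \<open>y\<close>. If one of them has an edge to \<open>U\<close> other than {x, y}, the explored
  path to it is an ear. Otherwise the witnesses live in the graph without \<open>U\<close>, and only
  \<open>y\<close> loses a neighbour, namely \<open>x\<close>.\<close>

lemma surv_imp_rsurv_or_ear:
  assumes E: "graph E" and x: "x \<in> U" "{x, y} \<in> E" and y: "y \<notin> U" "y \<in> surv k E U j"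
    and no_ear: "\<And>Q. y \<in> Q \<Longrightarrow> \<not> ear E U (j + 1) Q"
  shows "y \<in> rsurv k (avoiding E U) j"
proof (cases j)
  case (Suc i)
  let ?B = "(avoiding E U)"
  have finE: "finite E" using E by (simp add: graph_def)
  have cross2: "2 \<le> card (cross E Q U)" if "y \<in> Q" "u \<in> Q" "z \<in> U" "{u, z} \<in> E" "{u, z} \<noteq> {x, y}" for Q u z
  proof -
    have "{{x, y}, {u, z}} \<subseteq> cross E Q U" using that x by (auto simp: cross_def)
    then have "card {{x, y}, {u, z}} \<le> card (cross E Q U)"
      using finE by (intro card_mono) (auto simp: cross_def)
    then show ?thesis using that by simp
  qed
  \<comment> \<open>\<open>Q\<close> is the explored part containing \<open>y\<close> and
    \<open>u\<close>. Each step outwards adds at most one vertex and uses up one round, so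
    \<open>card Q + l\<close> never exceeds j + 1; this is the size allowed for an ear.\<close>
  have main: "u \<in> surv k ?B {y} l"
    if "conn E Q" "finite Q" "y \<in> Q" "u \<in> Q" "Q \<inter> U = {}" "card Q + l \<le> j + 1" "u \<in> surv k E U l" for Q u l
    using that
  proof (induction l arbitrary: Q u)
    case (Suc l)
    show ?case
    proof (cases "u = y")
      case False
      have "u \<notin> U" using Suc.prems by blast
      have noU: "z \<notin> U" if "z \<in> nbrs E u" for z
      proof
        assume "z \<in> U"
        then have "{u, z} \<noteq> {x, y}" using False x y Suc.prems by (auto simp: doubleton_eq_iff)
        then have "ear E U (j + 1) Q"
          using cross2[of Q u z] that \<open>z \<in> U\<close> Suc.prems by (auto simp: ear_def nbrs_def)
        then show False using no_ear Suc.prems by blast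
      qed
      have "nbrs E u \<inter> surv k E U l \<subseteq> nbrs ?B u \<inter> surv k ?B {y} l"
      proof
        fix w assume w: "w \<in> nbrs E u \<inter> surv k E U l"
        then have wE: "{u, w} \<in> E" "w \<notin> U" using noU by (auto simp: nbrs_def)
        have "card (insert w Q) \<le> Suc (card Q)" using Suc.prems(2) by (simp add: card_insert_if)
        then have "w \<in> surv k ?B {y} l"
          using w wE Suc.prems conn_insert[of E Q u w]
          by (intro Suc.IH[of "insert w Q" w]) auto
        then show "w \<in> nbrs ?B u \<inter> surv k ?B {y} l"
          using wE \<open>u \<notin> U\<close> by (auto simp: nbrs_def)
      qed
      then have "card (nbrs E u \<inter> surv k E U l) \<le> card (nbrs ?B u \<inter> surv k ?B {y} l)"
        using finite_nbrs[OF graph_subset[OF E, of ?B]] by (intro card_mono) auto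
      then show ?thesis using Suc.prems \<open>u \<notin> U\<close> by auto
    qed simp
  qed simp
  have "k \<le> card (nbrs E y \<inter> surv k E U i)" using y Suc by simp
  \<comment> \<open>A further neighbour of \<open>y\<close> in \<open>U\<close> would already make
    {y} an ear, so \<open>x\<close> is the only neighbour lost and k - 1 remain.\<close>
  have "nbrs E y \<inter> surv k E U i - {x} \<subseteq> nbrs ?B y \<inter> surv k ?B {y} i"
  proof
    fix u assume u: "u \<in> nbrs E y \<inter> surv k E U i - {x}"
    then have yu: "{y, u} \<in> E" "u \<noteq> y" using graph_irrefl[OF E] by (auto simp: nbrs_def)
    have "u \<notin> U"
    proof
      assume "u \<in> U"
      then have "ear E U (j + 1) {y}"
        using cross2[of "{y}" y u] u yu y by (auto simp: ear_def conn_singleton doubleton_eq_iff)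
      then show False using no_ear by blast
    qed
    moreover have "u \<in> surv k ?B {y} i"
      using u yu y \<open>u \<notin> U\<close> Suc conn_insert[OF conn_singleton, of y y u E]
      by (intro main[of "{y, u}"]) (auto simp: insert_commute)
    ultimately show "u \<in> nbrs ?B y \<inter> surv k ?B {y} i"
      using yu y by (auto simp: nbrs_def)
  qed
  then have "card (nbrs E y \<inter> surv k E U i - {x}) \<le> card (nbrs ?B y \<inter> surv k ?B {y} i)"
    using finite_nbrs[OF graph_subset[OF E, of ?B]] by (intro card_mono) auto
  moreover have "card (nbrs E y \<inter> surv k E U i) - 1 \<le> card (nbrs E y \<inter> surv k E U i - {x})"
    by (metis card_Diff_singleton_if diff_le_self order_refl)
  ultimately show ?thesis using \<open>k \<le> card (nbrs E y \<inter> surv k E U i)\<close> Suc by simp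
qed simp

section \<open>Counting ears\<close>

definition edges_in :: "'a set set \<Rightarrow> 'a set \<Rightarrow> 'a set set" where
  "edges_in E W = {e \<in> E. e \<subseteq> W}"

lemma finite_edges_in: "graph E \<Longrightarrow> finite (edges_in E W)"
  by (simp add: edges_in_def graph_def)

lemma cross_subset_Un:
  assumes "graph E" "e \<in> cross E Q U" "Q \<inter> U = {}"
  shows "e \<subseteq> Q \<union> U"
proof -
  have "e \<in> E" using assms(2) by (simp add: cross_def)
  then obtain v w where vw: "e = {v, w}" by (rule graph_edgeE[OF assms(1)])
  obtain a b where "a \<in> e" "a \<in> Q" "b \<in> e" "b \<in> U" using assms by (auto simp: cross_def)
  moreover from this have "a \<noteq> b" using assms(3) by blast
  ultimately show ?thesis using vw by auto
qed

text \<open>Each counted \<open>x\<close> selects one edge into \<open>Q\<close>; as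
  \<open>Q\<close> avoids \<open>U\<close>, the edge determines \<open>x\<close>.\<close>

lemma card_attached_le_cross:
  assumes "graph E" "Q \<inter> U = {}"
  shows "card {x \<in> U. nbrs E x \<inter> Q \<noteq> {}} \<le> card (cross E Q U)"
proof -
  let ?X = "{x \<in> U. nbrs E x \<inter> Q \<noteq> {}}"
  define f where "f x = {x, SOME q. q \<in> nbrs E x \<inter> Q}" for x
  have some: "(SOME q. q \<in> nbrs E x \<inter> Q) \<in> nbrs E x \<inter> Q" if "x \<in> ?X" for x
    by (rule someI_ex) (use that in blast)
  have "inj_on f ?X"
  proof (rule inj_onI)
    fix x y assume xy: "x \<in> ?X" "y \<in> ?X" "f x = f y"
    have "f z \<inter> U = {z}" if "z \<in> ?X" for z
    proof -
      have "(SOME q. q \<in> nbrs E z \<inter> Q) \<notin> U" using some[OF that] assms(2) by blast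
      then show ?thesis using that by (simp add: f_def)
    qed
    then have "{x} = {y}" using xy by metis
    then show "x = y" by simp
  qed
  moreover have "f ` ?X \<subseteq> cross E Q U"
  proof
    fix e assume "e \<in> f ` ?X"
    then obtain x where x: "x \<in> ?X" "e = f x" by blast
    define z where "z = (SOME q. q \<in> nbrs E x \<inter> Q)"
    have "z \<in> nbrs E x \<inter> Q" unfolding z_def by (rule some[OF x(1)])
    moreover have "e = {x, z}" unfolding x(2) f_def z_def ..
    ultimately show "e \<in> cross E Q U" using x(1) by (simp add: cross_def nbrs_def)
  qed
  moreover have "finite (cross E Q U)" using assms(1) by (simp add: cross_def graph_def)
  ultimately show ?thesis by (rule card_inj_on_le)
qed

text \<open>Every vertex on an ear costs half an edge in excess of a tree, so sparsity bounds the number of such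
  vertices.\<close>

lemma ears_potential:
  assumes E: "graph E" and U: "finite U" and fin: "finite \<Q>" and ears: "\<And>Q. Q \<in> \<Q> \<Longrightarrow> ear E U m Q"
  shows "finite (\<Union>\<Q>) \<and> \<Union>\<Q> \<inter> U = {} \<and> card (\<Union>\<Q>) \<le> m * card \<Q> \<and>
    2 * card (\<Union>\<Q>) + card {x \<in> U. nbrs E x \<inter> \<Union>\<Q> \<noteq> {}}
      \<le> 2 * card {e \<in> E. e \<subseteq> U \<union> \<Union>\<Q> \<and> e \<inter> \<Union>\<Q> \<noteq> {}}"
  using fin ears
proof (induction \<Q> rule: finite_induct)
  case empty
  then show ?case by simp
next
  case (insert Q \<Q>)
  let ?W = "\<Union>\<Q>"
  let ?Q' = "Q - ?W"
  let ?X = "\<lambda>W. {x \<in> U. nbrs E x \<inter> W \<noteq> {}}"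
  let ?inc = "\<lambda>W. {e \<in> E. e \<subseteq> U \<union> W \<and> e \<inter> W \<noteq> {}}"
  \<comment> \<open>The edges gained by adding the ear \<open>Q\<close>: \<open>N1\<close> lies
    inside \<open>Q\<close> and meets a new vertex, \<open>N2\<close> joins new vertices to
    \<open>U\<close>. Both are disjoint from the edges counted before.\<close>
  define N1 where "N1 = {e \<in> E. e \<subseteq> Q \<and> e \<inter> ?Q' \<noteq> {}}"
  define N2 where "N2 = cross E ?Q' U"
  have finE: "finite E" using E by (simp add: graph_def)
  have IH: "finite ?W" "?W \<inter> U = {}" "card ?W \<le> m * card \<Q>" "2 * card ?W + card (?X ?W) \<le> 2 * card (?inc ?W)"
    using insert.IH insert.prems by simp_all
  have Q: "finite Q" "card Q \<le> m" "Q \<inter> U = {}" "conn E Q" "2 \<le> card (cross E Q U)"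
    using insert.prems[of Q] by (auto simp: ear_def)
  have "Q \<noteq> {}" using Q(5) by (auto simp: cross_def)
  have Un: "?W \<union> Q = ?W \<union> ?Q'" "?W \<inter> ?Q' = {}" by auto
  have cW: "card (?W \<union> Q) = card ?W + card ?Q'"
    unfolding Un(1) using IH(1) Q(1) by (intro card_Un_disjoint) auto
  have "card ?Q' \<le> card Q" using Q(1) by (intro card_mono) auto
  have "?X (?W \<union> Q) \<subseteq> ?X ?W \<union> ?X ?Q'" by blast
  then have "card (?X (?W \<union> Q)) \<le> card (?X ?W \<union> ?X ?Q')" using U by (intro card_mono) auto
  also have "\<dots> \<le> card (?X ?W) + card (?X ?Q')" by (rule card_Un_le)
  also have "card (?X ?Q') \<le> card N2"
    unfolding N2_def by (rule card_attached_le_cross[OF E]) (use Q(3) in blast)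
  finally have cX: "card (?X (?W \<union> Q)) \<le> card (?X ?W) + card N2" by simp
  have d1: "?inc ?W \<inter> (N1 \<union> N2) = {}"
    unfolding N1_def N2_def cross_def using Q(3) by blast
  have d2: "N1 \<inter> N2 = {}"
    unfolding N1_def N2_def cross_def using Q(3) by blast
  have "N2 \<subseteq> ?inc (?W \<union> Q)"
  proof
    fix e assume e: "e \<in> N2"
    have "?Q' \<inter> U = {}" using Q(3) by blast
    from cross_subset_Un[OF E e[unfolded N2_def] this] e show "e \<in> ?inc (?W \<union> Q)"
      by (auto simp: N2_def cross_def)
  qed
  moreover have "N1 \<subseteq> ?inc (?W \<union> Q)" "?inc ?W \<subseteq> ?inc (?W \<union> Q)" by (auto simp: N1_def)
  ultimately have "card (?inc ?W \<union> (N1 \<union> N2)) \<le> card (?inc (?W \<union> Q))"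
    using finE by (intro card_mono) auto
  moreover have "finite N1" "finite N2" using finE by (auto simp: N1_def N2_def cross_def)
  ultimately have cinc: "card (?inc ?W) + (card N1 + card N2) \<le> card (?inc (?W \<union> Q))"
    using d1 d2 finE by (simp add: card_Un_disjoint)
  \<comment> \<open>An ear disjoint from the earlier ones has at least card Q - 1 inner edges and
    two edges to \<open>U\<close>. An ear meeting them has at least one inner edge per new vertex,
    as the old part can be taken as the starting set of \<open>conn_edges_ge\<close>.\<close>
  have "2 * card ?Q' + card N2 \<le> 2 * card N1 + 2 * card N2"
  proof (cases "Q \<inter> ?W = {}")
    case True
    then have Q': "?Q' = Q" by blast
    have "card Q \<le> card {e \<in> E. e \<subseteq> Q} + 1" by (rule conn_card_le_edges[OF E Q(4,1)])
    moreover have "{e \<in> E. e \<subseteq> Q} = N1"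
    proof -
      have "e \<noteq> {}" if "e \<in> E" for e using that E unfolding graph_def by fastforce
      then show ?thesis unfolding N1_def Q' by blast
    qed
    ultimately have "card Q \<le> card N1 + 1" by simp
    moreover have "2 \<le> card N2" using Q(5) by (simp add: N2_def Q')
    ultimately show ?thesis unfolding Q' by linarith
  next
    case False
    have "Q - (Q \<inter> ?W) = ?Q'" by blast
    with conn_edges_ge[OF E Q(4,1), of "Q \<inter> ?W"] False have "card ?Q' \<le> card N1"
      by (simp add: N1_def)
    then show ?thesis by linarith
  qed
  then have "2 * card (?W \<union> Q) + card (?X (?W \<union> Q)) \<le> 2 * card (?inc (?W \<union> Q))"
    using cW cX cinc IH(4) by linarith
  moreover have "card (?W \<union> Q) \<le> m * card (insert Q \<Q>)"
    using cW IH(3) \<open>card ?Q' \<le> card Q\<close> Q(2) insert.hyps by simp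
  moreover have "\<Union>(insert Q \<Q>) = ?W \<union> Q" by blast
  moreover have "finite (?W \<union> Q)" "(?W \<union> Q) \<inter> U = {}" using IH Q by auto
  ultimately show ?case by simp
qed

section \<open>Low inner degrees force attachment to survivors outside\<close>

lemma sum_degrees_le:
  assumes "graph E" "finite U"
  shows "(\<Sum>x\<in>U. card (nbrs E x \<inter> U)) \<le> 2 * card (edges_in E U)"
proof -
  have finE: "finite (edges_in E U)" using assms by (rule_tac finite_edges_in)
  have "card (nbrs E x \<inter> U) \<le> card {e \<in> edges_in E U. x \<in> e}" if "x \<in> U" for x
  proof (rule card_inj_on_le[where f = "\<lambda>w. {x, w}"])
    show "inj_on (\<lambda>w. {x, w}) (nbrs E x \<inter> U)"
      using graph_irrefl[OF assms(1)] by (auto simp: inj_on_def nbrs_def doubleton_eq_iff)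
    show "(\<lambda>w. {x, w}) ` (nbrs E x \<inter> U) \<subseteq> {e \<in> edges_in E U. x \<in> e}"
      using that by (auto simp: nbrs_def edges_in_def)
    show "finite {e \<in> edges_in E U. x \<in> e}" using finE by simp
  qed
  then have "(\<Sum>x\<in>U. card (nbrs E x \<inter> U)) \<le> (\<Sum>x\<in>U. card {e \<in> edges_in E U. x \<in> e})"
    by (rule sum_mono)
  also have "\<dots> = (\<Sum>e\<in>edges_in E U. card {x \<in> U. x \<in> e})"
    using sum.swap_restrict[OF assms(2) finE, of "\<lambda>_ _. 1::nat" "\<lambda>x e. x \<in> e"] by simp
  also have "\<dots> \<le> (\<Sum>e\<in>edges_in E U. 2)"
  proof (rule sum_mono)
    fix e assume "e \<in> edges_in E U"
    then have "card e = 2" using assms by (auto simp: edges_in_def graph_def)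
    then have "finite e" by (metis card.infinite zero_neq_numeral)
    then have "card {x \<in> U. x \<in> e} \<le> card e" by (intro card_mono) auto
    then show "card {x \<in> U. x \<in> e} \<le> 2" using \<open>card e = 2\<close> by simp
  qed
  finally show ?thesis by simp
qed

lemma ex_low_degree:
  assumes "graph E" "finite A" "A \<noteq> {}" "2 * real (card (edges_in E A)) < 3 * real (card A)"
  shows "\<exists>x\<in>A. card (nbrs E x \<inter> A) \<le> 2"
proof (rule ccontr)
  assume "\<not> ?thesis"
  then have "(\<Sum>x\<in>A. 3) \<le> (\<Sum>x\<in>A. card (nbrs E x \<inter> A))" by (intro sum_mono) (auto simp: not_le)
  with sum_degrees_le[OF assms(1,2)] have "3 * card A \<le> 2 * card (edges_in E A)" by simp
  then have "3 * real (card A) \<le> 2 * real (card (edges_in E A))" by linarith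
  with assms(4) show False by simp
qed

lemma conn_degree_pos:
  assumes "conn E U" "x \<in> U" "finite U" "2 \<le> card U" "graph E"
  shows "1 \<le> card (nbrs E x \<inter> U)"
proof -
  have "{x} \<noteq> U" using assms(4) by auto
  then have "{x} \<subset> U" using assms(2) by blast
  then obtain b where "b \<in> U" "{x, b} \<in> E" using assms(1) unfolding conn_def by blast
  then have "nbrs E x \<inter> U \<noteq> {}" by (auto simp: nbrs_def)
  then show ?thesis using assms(3) by (simp add: Suc_le_eq card_gt_0_iff)
qed

text \<open>By sparsity nearly half of \<open>U\<close> has inner degree at most 2. Such a vertex
  has a surviving neighbour outside \<open>U\<close> because k \<ge> 3, and this neighbour is a
  rooted survivor unless it lies on an ear. The vertices next to ears are few by
  \<open>ears_potential\<close> and sparsity of \<open>U\<close> together with the ears.\<close>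

lemma many_attached_to_rsurv:
  assumes E: "graph E" and k: "3 \<le> k" and U: "finite U" "conn E U" "20 \<le> card U"
    and sub: "U \<subseteq> surv k E {} (Suc j)"
    and sparse: "\<And>W. finite W \<Longrightarrow> W \<noteq> {} \<Longrightarrow> card W \<le> (j + 3) * card U \<Longrightarrow>
        real (card (edges_in E W)) \<le> (1 + 1 / (16 * real (j + 3))) * real (card W)"
  shows "card U \<le> 4 * card (attached k E U j)"
proof -
  let ?B = "(avoiding E U)"
  define Gd where "Gd = {x \<in> U. \<exists>y. {x, y} \<in> E \<and> y \<notin> U \<and> y \<in> rsurv k ?B j}"
  define D where "D = {x \<in> U. card (nbrs E x \<inter> U) \<le> 2}"
  \<comment> \<open>\<open>U\<close> together with the ears has at most (j + 2) s vertices, so this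
    \<delta> keeps its excess over a tree at most s / 16 plus a constant.\<close>
  define \<delta> where "\<delta> = 1 / (16 * real (j + 3))"
  define s where "s = card U"
  have "s \<ge> 20" using U s_def by simp
  then have "U \<noteq> {}" using s_def by auto
  have finD: "finite D" "finite Gd" "D \<subseteq> U" using U by (auto simp: D_def Gd_def)
  have ex: "\<exists>Q. ear E U (j + 1) Q \<and> nbrs E x \<inter> Q \<noteq> {}" if x: "x \<in> D - Gd" for x
  proof -
    have xU: "x \<in> U" "card (nbrs E x \<inter> U) \<le> 2" "x \<notin> Gd" using x by (auto simp: D_def)
    have "k \<le> card (nbrs E x \<inter> surv k E {} j)" using sub xU by auto
    have "\<not> nbrs E x \<inter> surv k E {} j \<subseteq> nbrs E x \<inter> U"
    proof
      assume "nbrs E x \<inter> surv k E {} j \<subseteq> nbrs E x \<inter> U"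
      then have "card (nbrs E x \<inter> surv k E {} j) \<le> card (nbrs E x \<inter> U)" using U by (intro card_mono) auto
      then show False using xU \<open>k \<le> card (nbrs E x \<inter> surv k E {} j)\<close> k by linarith
    qed
    then obtain y where y: "{x, y} \<in> E" "y \<in> surv k E {} j" "y \<notin> U" by (auto simp: nbrs_def)
    have "y \<in> surv k E U j" using y surv_mono[OF E order_refl, of "{}" U k j] by blast
    moreover have "y \<notin> rsurv k ?B j" using xU y by (auto simp: Gd_def)
    ultimately obtain Q where "y \<in> Q" "ear E U (j + 1) Q"
      using surv_imp_rsurv_or_ear[OF E xU(1) y(1) y(3)] by blast
    then show ?thesis using y by (auto simp: nbrs_def)
  qed
  then obtain q where q: "\<And>x. x \<in> D - Gd \<Longrightarrow> ear E U (j + 1) (q x) \<and> nbrs E x \<inter> q x \<noteq> {}"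
    by metis
  define W where "W = \<Union>(q ` (D - Gd))"
  have pot: "finite W \<and> W \<inter> U = {} \<and> card W \<le> (j + 1) * card (q ` (D - Gd)) \<and>
    2 * card W + card {x \<in> U. nbrs E x \<inter> W \<noteq> {}}
      \<le> 2 * card {e \<in> E. e \<subseteq> U \<union> W \<and> e \<inter> W \<noteq> {}}"
    unfolding W_def using q finD U(1) by (intro ears_potential[OF E]) auto
  have "card (q ` (D - Gd)) \<le> card (D - Gd)" using finD by (intro card_image_le) auto
  also have "\<dots> \<le> s" unfolding s_def using finD U(1) by (intro card_mono) auto
  finally have "(j + 1) * card (q ` (D - Gd)) \<le> (j + 1) * s" by (rule mult_le_mono2)
  then have cW: "card W \<le> (j + 1) * s" using pot by linarith
  have "D - Gd \<subseteq> {x \<in> U. nbrs E x \<inter> W \<noteq> {}}" 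
  proof
    fix x assume x: "x \<in> D - Gd"
    then have "q x \<subseteq> W" by (auto simp: W_def)
    with q[OF x] x finD(3) show "x \<in> {x \<in> U. nbrs E x \<inter> W \<noteq> {}}" by blast
  qed
  then have cX: "card (D - Gd) \<le> card {x \<in> U. nbrs E x \<inter> W \<noteq> {}}" using U by (intro card_mono) auto
  have "card (U \<union> W) = s + card W" unfolding s_def using pot U by (intro card_Un_disjoint) auto
  then have eUW: "real (card (edges_in E (U \<union> W))) \<le> (1 + \<delta>) * (s + card W)"
    unfolding \<delta>_def using sparse[of "U \<union> W"] cW pot U(1) \<open>U \<noteq> {}\<close> by (simp add: s_def algebra_simps)
  have "edges_in E (U \<union> W) = edges_in E U \<union> {e \<in> E. e \<subseteq> U \<union> W \<and> e \<inter> W \<noteq> {}}"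
    by (auto simp: edges_in_def)
  moreover have "edges_in E U \<inter> {e \<in> E. e \<subseteq> U \<union> W \<and> e \<inter> W \<noteq> {}} = {}"
    using pot by (auto simp: edges_in_def)
  ultimately have "card (edges_in E (U \<union> W)) = card (edges_in E U) + card {e \<in> E. e \<subseteq> U \<union> W \<and> e \<inter> W \<noteq> {}}"
    using E by (simp add: card_Un_disjoint finite_edges_in) (simp add: graph_def card_Un_disjoint finite_edges_in E)
  moreover have "s \<le> card (edges_in E U) + 1"
    using conn_card_le_edges[OF E U(2,1)] by (simp add: s_def edges_in_def)
  \<comment> \<open>Adds the tree edges of \<open>U\<close> to the edges counted by the potential;
    what exceeds twice the number of vertices bounds \<open>D - Gd\<close>.\<close>
  ultimately have "2 * card W + card (D - Gd) + 2 * s \<le> 2 * card (edges_in E (U \<union> W)) + 2"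
    using pot[THEN conjunct2, THEN conjunct2, THEN conjunct2] cX by linarith
  from of_nat_mono[OF this, where 'a = real]
  have "2 * real (card W) + real (card (D - Gd)) \<le> 2 * (real (card (edges_in E (U \<union> W))) - (real s - 1))"
    by (simp add: algebra_simps)
  also have "\<dots> \<le> 2 * ((1 + \<delta>) * (s + card W) - (real s - 1))" using eUW by simp
  finally have "real (card (D - Gd)) \<le> 2 + 2 * (\<delta> * (s + card W))" by (simp add: algebra_simps)
  also have "\<delta> * (s + card W) \<le> \<delta> * (real (j + 3) * s)"
    using cW by (intro mult_left_mono) (auto simp: \<delta>_def algebra_simps simp flip: of_nat_mult of_nat_add)
  also have "\<dots> = s / 16" by (simp add: \<delta>_def field_simps)
  finally have bad: "real (card (D - Gd)) \<le> 2 + s / 8" by simp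
  \<comment> \<open>Connectedness gives inner degree at least 1 in \<open>D\<close>, and outside
    \<open>D\<close> it is at least 3, so the degree sum forces \<open>D\<close> to contain at least
    23 s / 48 vertices.\<close>
  have "(\<Sum>x\<in>U. (if x \<in> D then 1 else 3)) \<le> (\<Sum>x\<in>U. card (nbrs E x \<inter> U))"
    using conn_degree_pos[OF U(2) _ U(1) _ E] U(3) by (intro sum_mono) (auto simp: D_def)
  also have "\<dots> \<le> 2 * card (edges_in E U)" by (rule sum_degrees_le[OF E U(1)])
  also have "(\<Sum>x\<in>U. (if x \<in> D then 1 else 3::nat)) = card D + 3 * card (U - D)"
    using U(1) finD(3) by (simp add: sum.If_cases inf.absorb1 inf.absorb2 Diff_eq)
  finally have "real (card D) + 3 * real (card (U - D)) \<le> 2 * real (card (edges_in E U))" by linarith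
  also have "real (card (edges_in E U)) \<le> (1 + \<delta>) * s"
    using sparse[OF U(1) \<open>U \<noteq> {}\<close>] by (simp add: s_def \<delta>_def)
  also have "\<delta> \<le> 1 / 48" by (simp add: \<delta>_def field_simps)
  finally have "real (card D) + 3 * real (card (U - D)) \<le> 2 * ((1 + 1 / 48) * s)"
    by (simp add: mult_right_mono)
  moreover have "card (U - D) = s - card D" "card D \<le> s"
    using finD U by (simp_all add: card_Diff_subset s_def card_mono)
  ultimately have D: "real s * 23 / 24 \<le> 2 * real (card D)" by (simp add: of_nat_diff field_simps)
  have "real (card D) \<le> real (card (D - Gd)) + real (card Gd)"
  proof -
    have "card D \<le> card ((D - Gd) \<union> Gd)" using finD(1,2) by (intro card_mono) auto
    also have "\<dots> \<le> card (D - Gd) + card Gd" by (rule card_Un_le)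
    finally show ?thesis by linarith
  qed
  moreover have "8 * real (card (D - Gd)) \<le> 16 + real s" using bad by simp
  moreover have "23 * real s \<le> 48 * real (card D)" using D by simp
  moreover have "20 \<le> real s" using \<open>s \<ge> 20\<close> by simp
  \<comment> \<open>23 s / 48 - s / 8 - 2 \<ge> s / 4 holds from s = 20 on, whence the lower bound
    on \<open>card U\<close>.\<close>
  ultimately have "real s \<le> 4 * real (card Gd)" by linarith
  then have "s \<le> 4 * card Gd" by linarith
  then show ?thesis by (simp add: s_def Gd_def)
qed

text \<open>The hypothesis \<open>few\<close> rules out edges inside \<open>M\<close> (take
  \<open>Q\<close> empty) and ears on \<open>M\<close>, since an ear would have at least card Q - 1
  inner edges and two more to \<open>M\<close>. So the surviving neighbours of \<open>v\<close> are
  rooted survivors of the graph without \<open>M\<close>, which is independent of the edges at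
  \<open>M\<close>.\<close>

lemma rsurv_Suc_neighbours:
  assumes E: "E \<subseteq> all_edges V" and V: "finite V" and M: "M \<subseteq> V" "v \<in> M" "v \<in> rsurv k E (Suc j)"
    and few: "\<And>Q. Q \<subseteq> V - M \<Longrightarrow> card Q \<le> j + 1 \<Longrightarrow> card (edges_in E (Q \<union> M)) \<le> card Q"
  shows "k - 1 \<le> card (nbrs E v \<inter> (rsurv k (avoiding E M) j \<inter> (V - M)))"
proof -
  have gE: "graph E" using graph_subset[OF graph_all_edges[OF V] E] .
  have inV: "a \<in> V \<and> b \<in> V" if "{a, b} \<in> E" for a b using that E by (auto simp: all_edges_def)
  have "nbrs E v \<inter> surv k E {v} j \<subseteq> nbrs E v \<inter> (rsurv k (avoiding E M) j \<inter> (V - M))"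
  proof
    fix y assume y: "y \<in> nbrs E v \<inter> surv k E {v} j"
    then have vy: "{v, y} \<in> E" by (simp add: nbrs_def)
    have "card (edges_in E ({} \<union> M)) \<le> card ({} :: 'a set)" by (rule few) auto
    then have "edges_in E M = {}" using finite_edges_in[OF gE] by simp
    then have "y \<notin> M" using vy M(2) by (auto simp: edges_in_def)
    have noear: "\<not> ear E M (j + 1) Q" if "y \<in> Q" for Q
    proof
      assume ear: "ear E M (j + 1) Q"
      \<comment> \<open>The notion \<open>ear\<close> does not confine \<open>Q\<close> to
        \<open>V\<close>; connectedness does, as \<open>y\<close> is in \<open>V\<close> and all
        edges lie in \<open>V\<close>.\<close>
      have "Q \<subseteq> V"
      proof (rule ccontr)
        assume "\<not> Q \<subseteq> V"
        moreover have "y \<in> Q \<inter> V" using that inV vy by blast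
        ultimately have "Q \<inter> V \<noteq> {} \<and> Q \<inter> V \<subset> Q" by blast
        then obtain a b where "a \<in> Q \<inter> V" "b \<in> Q - (Q \<inter> V)" "{a, b} \<in> E"
          using ear unfolding ear_def conn_def by meson
        then show False using inV by blast
      qed
      then have "card (edges_in E (Q \<union> M)) \<le> card Q" using ear by (intro few) (auto simp: ear_def)
      moreover have "edges_in E Q \<union> cross E Q M \<subseteq> edges_in E (Q \<union> M)"
        using cross_subset_Un[OF gE, of _ Q M] ear by (auto simp: edges_in_def ear_def cross_def)
      then have "card (edges_in E Q \<union> cross E Q M) \<le> card (edges_in E (Q \<union> M))"
        using finite_edges_in[OF gE] by (intro card_mono)
      moreover have "card (edges_in E Q \<union> cross E Q M) = card (edges_in E Q) + card (cross E Q M)"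
        using ear gE by (intro card_Un_disjoint) (auto simp: edges_in_def cross_def ear_def graph_def)
      moreover have "card Q \<le> card (edges_in E Q) + 1"
        using conn_card_le_edges[OF gE, of Q] ear by (simp add: ear_def edges_in_def)
      ultimately show False using ear by (simp add: ear_def)
    qed
    have "y \<in> surv k E M j"
      using y surv_mono[OF gE order_refl, of "{v}" M k j] M(2) by blast
    then have "y \<in> rsurv k (avoiding E M) j"
      using surv_imp_rsurv_or_ear[OF gE M(2) vy \<open>y \<notin> M\<close>] noear by blast
    then show "y \<in> nbrs E v \<inter> (rsurv k (avoiding E M) j \<inter> (V - M))"
      using y inV[OF vy] \<open>y \<notin> M\<close> by blast
  qed
  then have "card (nbrs E v \<inter> surv k E {v} j) \<le> card (nbrs E v \<inter> (rsurv k (avoiding E M) j \<inter> (V - M)))"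
    using finite_nbrs[OF gE] by (intro card_mono) auto
  then show ?thesis using M(3) by simp
qed

section \<open>The game\<close>

lemma mover_flip: "mover first (Suc i) \<noteq> mover first i"
  by (cases first) (auto simp: mover_def)

lemma player_neq: "p \<noteq> Maker \<longleftrightarrow> p = Breaker"
  by (cases p) auto

lemma unclaimed_append: "unclaimed E (g @ [m]) = unclaimed E g - m"
  by (auto simp: unclaimed_def)

lemma maker_graph_append:
  "maker_graph first (g @ [m]) = maker_graph first g \<union> (if mover first (length g) = Maker then m else {})"
proof -
  have "{(g @ [m]) ! i | i. i < length (g @ [m]) \<and> mover first i = Maker} =
    {g ! i | i. i < length g \<and> mover first i = Maker} \<union> (if mover first (length g) = Maker then {m} else {})"
    (is "?A = ?B")
  proof
    show "?A \<subseteq> ?B"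
    proof
      fix x assume "x \<in> ?A"
      then obtain i where "x = (g @ [m]) ! i" "i < Suc (length g)" "mover first i = Maker" by auto
      then show "x \<in> ?B" by (cases "i = length g") (auto simp: nth_append)
    qed
    show "?B \<subseteq> ?A"
    proof
      fix x assume "x \<in> ?B"
      then consider i where "x = g ! i" "i < length g" "mover first i = Maker"
        | "mover first (length g) = Maker" "x = m" by (auto split: if_splits)
      then show "x \<in> ?A"
      proof cases
        case 1
        then show ?thesis by (auto simp: nth_append intro!: exI[of _ i])
      next
        case 2
        then show ?thesis by (auto simp: nth_append intro!: exI[of _ "length g"])
      qed
    qed
  qed
  then show ?thesis by (auto simp: maker_graph_def)
qed

lemma is_play_append:
  "is_play b E first (g @ [m]) \<longleftrightarrow> is_play b E first g \<and> legal_move b E (mover first (length g)) g m"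
  by (auto simp: is_play_def less_Suc_eq nth_append)

lemma follows_append:
  "follows first p \<sigma> (g @ [m]) \<longleftrightarrow> follows first p \<sigma> g \<and> (mover first (length g) = p \<longrightarrow> m = \<sigma> g)"
  by (auto simp: follows_def less_Suc_eq nth_append)

lemma can_ensure_mono:
  assumes "can_ensure b E first p Q" "\<And>M. Q M \<Longrightarrow> Q' M"
  shows "can_ensure b E first p Q'"
  using assms unfolding can_ensure_def by meson

lemma ex_legal_move:
  assumes "finite E" "unclaimed E h \<noteq> {}"
  shows "\<exists>m. legal_move b E p h m"
proof -
  have "finite (unclaimed E h)" using assms(1) by (simp add: unclaimed_def)
  then have "1 \<le> card (unclaimed E h)" using assms(2) by (simp add: Suc_le_eq card_gt_0_iff)
  then have "(case p of Maker \<Rightarrow> 1 | Breaker \<Rightarrow> min b (card (unclaimed E h))) \<le> card (unclaimed E h)"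
    by (cases p) auto
  then obtain m where "m \<subseteq> unclaimed E h" "card m = (case p of Maker \<Rightarrow> 1 | Breaker \<Rightarrow> min b (card (unclaimed E h)))"
    by (meson obtain_subset_with_card_n)
  then show ?thesis using assms(2) by (auto simp: legal_move_def)
qed

text \<open>Two strategies are played against each other. As b \<ge> 1, every move claims an edge,
  so the number of unclaimed edges decreases.\<close>

lemma ex_full_play:
  assumes "finite E" "b \<ge> 1" "strategy b E first Maker \<sigma>" "strategy b E first Breaker \<tau>"
    and "is_play b E first h" "follows first Maker \<sigma> h" "follows first Breaker \<tau> h"
  shows "\<exists>h. is_play b E first h \<and> follows first Maker \<sigma> h \<and> follows first Breaker \<tau> h \<and> unclaimed E h = {}"
  using assms(5-7)
proof (induction "card (unclaimed E h)" arbitrary: h rule: less_induct)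
  case less
  show ?case
  proof (cases "unclaimed E h = {}")
    case False
    define p where "p = mover first (length h)"
    define m where "m = (if p = Maker then \<sigma> h else \<tau> h)"
    have leg: "legal_move b E p h m"
      using assms(3,4) less.prems False unfolding strategy_def m_def p_def
      by (cases "mover first (length h)") auto
    have fin: "finite (unclaimed E h)" using assms(1) by (simp add: unclaimed_def)
    then have "1 \<le> card (unclaimed E h)" using False by (simp add: Suc_le_eq card_gt_0_iff)
    then have "1 \<le> card m" using leg assms(2) by (cases p) (auto simp: legal_move_def)
    then have "m \<noteq> {}" by auto
    moreover have "m \<subseteq> unclaimed E h" using leg by (simp add: legal_move_def)
    ultimately have "unclaimed E (h @ [m]) \<subset> unclaimed E h" by (auto simp: unclaimed_append)
    then have "card (unclaimed E (h @ [m])) < card (unclaimed E h)" using fin by (simp add: psubset_card_mono)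
    moreover have "is_play b E first (h @ [m])" using less.prems leg by (simp add: is_play_append p_def)
    moreover have "follows first Maker \<sigma> (h @ [m])" "follows first Breaker \<tau> (h @ [m])"
      using less.prems by (auto simp: follows_append m_def p_def)
    ultimately show ?thesis by (rule less.hyps)
  qed (use less.prems in blast)
qed

text \<open>If Maker could ensure a component larger than \<open>g\<close>, playing her strategy
  against Breaker's would give a contradictory final position.\<close>

lemma s_star_le:
  assumes "finite E" "b \<ge> 1" "V \<noteq> {}"
    and "can_ensure b E first Breaker (\<lambda>M. \<forall>C \<in> graph_components V M. real (card C) \<le> g)"
  shows "real (s_star b first V E) \<le> g"
proof -
  let ?P = "\<lambda>s. can_ensure b E first Maker (\<lambda>M. \<exists>C \<in> graph_components V M. s \<le> card C)"
  obtain \<tau> where \<tau>: "strategy b E first Breaker \<tau>"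
    "\<And>h. is_play b E first h \<and> unclaimed E h = {} \<and> follows first Breaker \<tau> h \<Longrightarrow>
      \<forall>C \<in> graph_components V (maker_graph first h). real (card C) \<le> g"
    using assms(4) unfolding can_ensure_def by blast
  have le: "real s \<le> g" if "?P s" for s
  proof -
    obtain \<sigma> where \<sigma>: "strategy b E first Maker \<sigma>"
      "\<And>h. is_play b E first h \<and> unclaimed E h = {} \<and> follows first Maker \<sigma> h \<Longrightarrow>
        \<exists>C \<in> graph_components V (maker_graph first h). s \<le> card C"
      using \<open>?P s\<close> unfolding can_ensure_def by blast
    have "is_play b E first []" "follows first Maker \<sigma> []" "follows first Breaker \<tau> []"
      by (simp_all add: is_play_def follows_def)
    from ex_full_play[OF assms(1,2) \<sigma>(1) \<tau>(1) this] obtain h where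
      h: "is_play b E first h" "follows first Maker \<sigma> h" "follows first Breaker \<tau> h" "unclaimed E h = {}" by blast
    have "\<exists>C \<in> graph_components V (maker_graph first h). s \<le> card C"
      using h by (intro \<sigma>(2)) simp
    then obtain C where C: "C \<in> graph_components V (maker_graph first h)" "s \<le> card C"
      by blast
    have "\<forall>C \<in> graph_components V (maker_graph first h). real (card C) \<le> g"
      using h by (intro \<tau>(2)) simp
    then have "real (card C) \<le> g" using C(1) by (rule bspec)
    then show ?thesis using C(2) by linarith
  qed
  \<comment> \<open>\<open>GREATEST\<close> describes an attained value only if some
    \<open>s\<close> qualifies and the \<open>s\<close> are bounded; 0 is ensured by any legal play
    on a nonempty vertex set.\<close>
  have "?P 0"
  proof -
    define \<sigma> where "\<sigma> h = (SOME m. legal_move b E Maker h m)" for h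
    have "strategy b E first Maker \<sigma>" unfolding strategy_def
    proof (intro allI impI)
      fix h assume "is_play b E first h \<and> unclaimed E h \<noteq> {} \<and> mover first (length h) = Maker"
      then show "legal_move b E Maker h (\<sigma> h)"
        unfolding \<sigma>_def by (metis ex_legal_move[OF assms(1)] someI_ex)
    qed
    moreover have "\<exists>C \<in> graph_components V M. 0 \<le> card C" for M :: "'a set set"
      using assms(3) by (auto simp: graph_components_def)
    ultimately show ?thesis unfolding can_ensure_def by (intro exI[of _ \<sigma>] conjI allI impI)
  qed
  moreover have "s \<le> nat \<lfloor>g\<rfloor>" if "?P s" for s using le[OF that] by linarith
  ultimately have "?P (GREATEST s. ?P s)" by (intro GreatestI_nat[of ?P 0 "nat \<lfloor>g\<rfloor>"]) auto
  then show ?thesis unfolding s_star_def by (rule le)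
qed

definition upedges :: "('a \<Rightarrow> nat) \<Rightarrow> 'a set set \<Rightarrow> 'a \<Rightarrow> 'a set set" where
  "upedges r E v = {e \<in> E. \<exists>w. e = {v, w} \<and> r v < r w}"

lemma upedges_unique: "e \<in> upedges r E v \<Longrightarrow> e \<in> upedges r E v' \<Longrightarrow> v = v'"
  by (auto simp: upedges_def doubleton_eq_iff)

text \<open>After each of Breaker's moves, a vertex with an upward edge of Maker has no unclaimed upward edge.\<close>

lemma breaker_keeps_outdegree_le_1:
  assumes E: "graph E"
    and distinct: "\<And>v w. {v, w} \<in> E \<Longrightarrow> r v \<noteq> r w"
    and deg: "\<And>v. card (upedges r E v) \<le> b + 1"
  shows "can_ensure b E first Breaker (\<lambda>M. M \<subseteq> E \<and>
    (\<forall>v. \<forall>e \<in> M \<inter> upedges r E v. \<forall>e' \<in> M \<inter> upedges r E v. e = e'))"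
proof -
  let ?out = "upedges r E"
  have finE: "finite E" using E by (simp add: graph_def)
  have fin_out: "finite (?out v)" for v using finE by (simp add: upedges_def)
  \<comment> \<open>When Breaker replies, \<open>last h\<close> is Maker's single edge and
    \<open>T h\<close> consists of the unclaimed upward edges at its lower end. The test for the
    empty history covers Breaker moving first.\<close>
  define T where "T h = {e' \<in> unclaimed E h. h \<noteq> [] \<and> (\<exists>v. last h \<inter> ?out v \<noteq> {} \<and> e' \<in> ?out v)}" for h
  \<comment> \<open>A strategy must be legal on every history, hence the proviso on
    \<open>card (T h)\<close>; in plays that follow it the proviso always holds on Breaker's
    turn.\<close>
  define good where "good h m \<longleftrightarrow> legal_move b E Breaker h m \<and> (card (T h) \<le> b \<longrightarrow> T h \<subseteq> m)" for h m
  define \<tau> where "\<tau> h = (SOME m. good h m)" for h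
  have ex_good: "\<exists>m. good h m" if "unclaimed E h \<noteq> {}" for h
  proof (cases "card (T h) \<le> b")
    case True
    have fin: "finite (unclaimed E h)" using finE by (simp add: unclaimed_def)
    have sub: "T h \<subseteq> unclaimed E h" by (auto simp: T_def)
    then have "card (T h) \<le> card (unclaimed E h)" using fin by (simp add: card_mono)
    with True have "card (T h) \<le> min b (card (unclaimed E h))" by simp
    from exists_subset_between[OF this _ sub fin] obtain m where
      "T h \<subseteq> m" "m \<subseteq> unclaimed E h" "card m = min b (card (unclaimed E h))" by auto
    then show ?thesis using that by (auto simp: good_def legal_move_def)
  next
    case False
    then show ?thesis using ex_legal_move[OF finE that] by (auto simp: good_def)
  qed
  have \<tau>: "good h (\<tau> h)" if "unclaimed E h \<noteq> {}" for h
    unfolding \<tau>_def by (rule someI_ex) (rule ex_good[OF that])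
  have strat: "strategy b E first Breaker \<tau>"
    using \<tau> by (auto simp: strategy_def good_def)
  define answered where "answered g v \<longleftrightarrow> unclaimed E g \<inter> ?out v = {}" for g v
  \<comment> \<open>The state between Maker's move at \<open>v\<close> and Breaker's reply: of at
    most b + 1 upward edges one has just been taken, so \<open>b\<close> edges suffice for the
    reply.\<close>
  define pending where "pending g v \<longleftrightarrow> g \<noteq> [] \<and> mover first (length g - 1) = Maker \<and>
    (\<exists>e. last g = {e} \<and> e \<in> ?out v) \<and> card (unclaimed E g \<inter> ?out v) \<le> b" for g v
  have inv: "maker_graph first g \<subseteq> E \<and>
      (\<forall>v. \<forall>e \<in> maker_graph first g \<inter> ?out v. \<forall>e' \<in> maker_graph first g \<inter> ?out v. e = e') \<and>
      (\<forall>v. maker_graph first g \<inter> ?out v \<noteq> {} \<longrightarrow> answered g v \<or> pending g v)"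
    if "is_play b E first g" "follows first Breaker \<tau> g" for g
    using that
  proof (induction g rule: rev_induct)
    case Nil
    then show ?case by (simp add: maker_graph_def)
  next
    case (snoc m g)
    have g: "is_play b E first g" "follows first Breaker \<tau> g"
      and leg: "legal_move b E (mover first (length g)) g m"
      and fol: "mover first (length g) = Breaker \<longrightarrow> m = \<tau> g"
      using snoc.prems by (auto simp: is_play_append follows_append)
    have IH: "maker_graph first g \<subseteq> E"
      "\<And>v e e'. e \<in> maker_graph first g \<inter> ?out v \<Longrightarrow> e' \<in> maker_graph first g \<inter> ?out v \<Longrightarrow> e = e'"
      "\<And>v. maker_graph first g \<inter> ?out v \<noteq> {} \<Longrightarrow> answered g v \<or> pending g v"
    proof -
      show "maker_graph first g \<subseteq> E" by (rule conjunct1[OF snoc.IH[OF g]])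
      show "e = e'" if "e \<in> maker_graph first g \<inter> ?out v" "e' \<in> maker_graph first g \<inter> ?out v" for v e e'
        using conjunct1[OF conjunct2[OF snoc.IH[OF g]]] that by meson
      show "answered g v \<or> pending g v" if "maker_graph first g \<inter> ?out v \<noteq> {}" for v
        using conjunct2[OF conjunct2[OF snoc.IH[OF g]]] that by meson
    qed
    have un: "unclaimed E (g @ [m]) = unclaimed E g - m" by (rule unclaimed_append)
    have ne: "unclaimed E g \<noteq> {}" and msub: "m \<subseteq> unclaimed E g" using leg by (auto simp: legal_move_def)
    have ans: "answered (g @ [m]) v" if "answered g v" for v
      using that by (auto simp: answered_def un)
    show ?case
    proof (cases "mover first (length g) = Maker")
      case True
      have mg: "maker_graph first (g @ [m]) = maker_graph first g \<union> m"
        using True by (simp add: maker_graph_append)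
      have no_pending: "\<not> pending g v" for v
      proof
        assume "pending g v"
        then have "g \<noteq> []" "mover first (length g - 1) = Maker" by (auto simp: pending_def)
        then show False using mover_flip[of first "length g - 1"] True by simp
      qed
      have "card m = 1" using leg True by (simp add: legal_move_def)
      then obtain e where e: "m = {e}" by (rule card_1_singletonE)
      then have eE: "e \<in> E" "e \<in> unclaimed E g" using msub by (auto simp: unclaimed_def)
      obtain v where v: "e \<in> ?out v"
      proof -
        obtain x y where xy: "e = {x, y}" using graph_edgeE[OF E eE(1)] by blast
        then have "r x < r y \<or> r y < r x" using distinct eE(1) by (metis linorder_neqE_nat)
        then have "e \<in> ?out x \<or> e \<in> ?out y"
          using eE(1) xy insert_commute[of x y "{}"] unfolding upedges_def by blast
        then show ?thesis using that by blast
      qed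
      have v_uniq: "v' = v" if "e \<in> ?out v'" for v' using upedges_unique[OF that v] .
      \<comment> \<open>On Maker's turn nothing is pending, so an earlier upward edge of Maker at
        \<open>v\<close> would mean that \<open>v\<close> is answered, yet \<open>e\<close> was
        still unclaimed.\<close>
      have none: "maker_graph first g \<inter> ?out v = {}"
      proof (rule ccontr)
        assume "maker_graph first g \<inter> ?out v \<noteq> {}"
        then have "answered g v" using IH(3) no_pending by blast
        then show False using v eE by (auto simp: answered_def)
      qed
      have "card (unclaimed E (g @ [m]) \<inter> ?out v) \<le> card (?out v - {e})"
        using fin_out by (intro card_mono) (auto simp: un[unfolded e] e)
      also have "\<dots> \<le> b" using deg[of v] v fin_out by simp
      finally have "pending (g @ [m]) v" using e v True by (auto simp: pending_def)
      show ?thesis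
      proof (intro conjI allI ballI impI)
        show "maker_graph first (g @ [m]) \<subseteq> E" using mg IH(1) e eE by auto
        show "x = y" if "x \<in> maker_graph first (g @ [m]) \<inter> ?out v'" "y \<in> maker_graph first (g @ [m]) \<inter> ?out v'" for v' x y
        proof (cases "v' = v")
          case True
          then show ?thesis using that none unfolding mg unfolding e by blast
        next
          case False
          then have "e \<notin> ?out v'" using v_uniq by blast
          then have "x \<in> maker_graph first g \<inter> ?out v'" "y \<in> maker_graph first g \<inter> ?out v'"
            using that unfolding mg unfolding e by blast+
          then show ?thesis by (rule IH(2))
        qed
        show "answered (g @ [m]) v' \<or> pending (g @ [m]) v'"
          if "maker_graph first (g @ [m]) \<inter> ?out v' \<noteq> {}" for v'
        proof (cases "v' = v")
          case True
          then show ?thesis using \<open>pending (g @ [m]) v\<close> by simp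
        next
          case False
          then have "e \<notin> ?out v'" using v_uniq by blast
          then have "maker_graph first g \<inter> ?out v' \<noteq> {}" using that unfolding mg unfolding e by blast
          then show ?thesis using IH(3) no_pending ans by blast
        qed
      qed
    next
      case False
      have mg: "maker_graph first (g @ [m]) = maker_graph first g"
        using False by (simp add: maker_graph_append)
      have "m = \<tau> g" using fol False by (simp add: player_neq)
      then have gm: "good g m" using \<tau>[OF ne] by simp
      have "answered (g @ [m]) v" if pend: "pending g v" for v
      proof -
        obtain e where e: "last g = {e}" "e \<in> ?out v" and card: "card (unclaimed E g \<inter> ?out v) \<le> b" "g \<noteq> []"
          using pend by (auto simp: pending_def)
        have "T g = unclaimed E g \<inter> ?out v"
        proof -
          have "last g \<inter> ?out v' \<noteq> {} \<longleftrightarrow> v' = v" for v'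
            using e upedges_unique[of e r E v' v] by (cases "v' = v") auto
          then show ?thesis using card(2) by (auto simp: T_def)
        qed
        then have "unclaimed E g \<inter> ?out v \<subseteq> m" using gm card by (auto simp: good_def)
        then show ?thesis by (auto simp: answered_def un)
      qed
      then have "\<forall>v. maker_graph first g \<inter> ?out v \<noteq> {} \<longrightarrow> answered (g @ [m]) v"
        using IH(3) ans by meson
      then show ?thesis
        unfolding mg using conjunct1[OF snoc.IH[OF g]] conjunct1[OF conjunct2[OF snoc.IH[OF g]]]
        by (intro conjI) (assumption | meson)+
    qed
  qed
  show ?thesis unfolding can_ensure_def
  proof (intro exI[of _ \<tau>] conjI strat allI impI)
    fix h assume h: "is_play b E first h \<and> unclaimed E h = {} \<and> follows first Breaker \<tau> h"
    note inv_h = inv[OF conjunct1[OF h] conjunct2[OF conjunct2[OF h]]]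
    show "maker_graph first h \<subseteq> E" by (rule conjunct1[OF inv_h])
    show "\<forall>e \<in> maker_graph first h \<inter> ?out v. \<forall>e' \<in> maker_graph first h \<inter> ?out v. e = e'" for v
      by (rule spec[OF conjunct1[OF conjunct2[OF inv_h]]])
  qed
qed

section \<open>Rankings and the components of a graph of out-degree one\<close>

text \<open>An acyclic orientation of the graph induced on \<open>W\<close>, towards higher rank,
  with out-degree at most \<open>d\<close>. Nonadjacent vertices may share a rank, which allows few
  ranks.\<close>

definition good_rank :: "'a set set \<Rightarrow> 'a set \<Rightarrow> nat \<Rightarrow> ('a \<Rightarrow> nat) \<Rightarrow> bool" where
  "good_rank E W d r \<longleftrightarrow> (\<forall>x\<in>W. \<forall>y\<in>W. {x, y} \<in> E \<longrightarrow> r x \<noteq> r y) \<and>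
     (\<forall>x\<in>W. card {y \<in> nbrs E x \<inter> W. r x < r y} \<le> d)"

text \<open>\<open>S\<close> is lifted above all colours, so its vertices gain no higher neighbours,
  while vertices outside \<open>S\<close> have at most \<open>d\<close> neighbours in
  \<open>W\<close> altogether.\<close>

lemma good_rank_extend:
  assumes E: "graph E" and sub: "S \<subseteq> W" and r0: "good_rank E S d r0"
    and low: "\<And>x. x \<in> W - S \<Longrightarrow> card (nbrs E x \<inter> W) \<le> d"
    and col: "\<And>x. x \<in> W - S \<Longrightarrow> col x < h" "\<And>x y. x \<in> W - S \<Longrightarrow> y \<in> W - S \<Longrightarrow> {x, y} \<in> E \<Longrightarrow> col x \<noteq> col y"
  shows "good_rank E W d (\<lambda>x. if x \<in> S then r0 x + h else col x)" (is "good_rank E W d ?r")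
  unfolding good_rank_def
proof (intro conjI ballI impI)
  fix x y assume xy: "x \<in> W" "y \<in> W" "{x, y} \<in> E"
  consider "x \<in> S" "y \<in> S" | "x \<in> S" "y \<notin> S" | "x \<notin> S" "y \<in> S" | "x \<notin> S" "y \<notin> S" by blast
  then show "?r x \<noteq> ?r y"
  proof cases
    case 1
    then have "r0 x \<noteq> r0 y" using r0 xy unfolding good_rank_def by meson
    then show ?thesis using 1 by simp
  next
    case 2
    then have "col y < h" using col(1) xy by blast
    then show ?thesis using 2 by simp
  next
    case 3
    then have "col x < h" using col(1) xy by blast
    then show ?thesis using 3 by simp
  next
    case 4
    then show ?thesis using col(2) xy by simp
  qed
next
  fix x assume x: "x \<in> W"
  show "card {y \<in> nbrs E x \<inter> W. ?r x < ?r y} \<le> d"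
  proof (cases "x \<in> S")
    case True
    have "{y \<in> nbrs E x \<inter> W. ?r x < ?r y} \<subseteq> {y \<in> nbrs E x \<inter> S. r0 x < r0 y}"
    proof
      fix y assume y: "y \<in> {y \<in> nbrs E x \<inter> W. ?r x < ?r y}"
      show "y \<in> {y \<in> nbrs E x \<inter> S. r0 x < r0 y}"
      proof (cases "y \<in> S")
        case False
        then have "col y < h" using col(1) y by blast
        then show ?thesis using y True False by simp
      qed (use y True in simp)
    qed
    then have "card {y \<in> nbrs E x \<inter> W. ?r x < ?r y} \<le> card {y \<in> nbrs E x \<inter> S. r0 x < r0 y}"
      using finite_nbrs[OF E] by (intro card_mono) auto
    also have "\<dots> \<le> d" using r0 True unfolding good_rank_def by blast
    finally show ?thesis .
  next
    case False
    have "card {y \<in> nbrs E x \<inter> W. ?r x < ?r y} \<le> card (nbrs E x \<inter> W)"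
      using finite_nbrs[OF E] by (intro card_mono) auto
    also have "\<dots> \<le> d" using low x False by blast
    finally show ?thesis .
  qed
qed

text \<open>A vertex of low degree in the whole set is put at the bottom, and the rest is ranked
  recursively.\<close>

lemma degenerate_good_rank:
  assumes E: "graph E" and "finite A"
    and "\<And>B. B \<subseteq> A \<Longrightarrow> B \<noteq> {} \<Longrightarrow> \<exists>x\<in>B. card (nbrs E x \<inter> B) \<le> d"
  shows "\<exists>r. good_rank E A d r"
  using assms(2,3)
proof (induction "card A" arbitrary: A)
  case 0
  then show ?case by (simp add: good_rank_def)
next
  case (Suc n)
  then have "A \<noteq> {}" by auto
  then obtain x where x: "x \<in> A" "card (nbrs E x \<inter> A) \<le> d" using Suc.prems(2)[of A] by blast
  have "n = card (A - {x})" using Suc.hyps(2) x Suc.prems(1) by simp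
  then have "\<exists>r. good_rank E (A - {x}) d r"
    using Suc.prems by (intro Suc.hyps(1)) auto
  then obtain r0 where "good_rank E (A - {x}) d r0" ..
  moreover have "{x} \<notin> E" using graph_irrefl[OF E, of x x] by auto
  ultimately have "good_rank E A d (\<lambda>y. if y \<in> A - {x} then r0 y + 1 else (\<lambda>_. 0) y)"
    using x by (intro good_rank_extend[OF E]) auto
  then show ?case by blast
qed

lemma ex_proper_colouring:
  assumes E: "graph E" and "finite L" and "\<And>x. x \<in> L \<Longrightarrow> card (nbrs E x \<inter> L) \<le> d"
  shows "\<exists>col. (\<forall>x\<in>L. col x < Suc d) \<and> (\<forall>x\<in>L. \<forall>y\<in>L. {x, y} \<in> E \<longrightarrow> col x \<noteq> col y)"
  using assms(2,3)
proof (induction L rule: finite_induct)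
  case empty
  then show ?case by simp
next
  case (insert x L)
  have "card (nbrs E y \<inter> L) \<le> d" if "y \<in> insert x L" for y
  proof -
    have "card (nbrs E y \<inter> L) \<le> card (nbrs E y \<inter> insert x L)"
      using finite_nbrs[OF E] by (intro card_mono) auto
    also have "\<dots> \<le> d" using insert.prems that by blast
    finally show ?thesis .
  qed
  note low = this
  obtain col where col: "\<And>y. y \<in> L \<Longrightarrow> col y < Suc d"
    "\<And>y z. y \<in> L \<Longrightarrow> z \<in> L \<Longrightarrow> {y, z} \<in> E \<Longrightarrow> col y \<noteq> col z"
  proof -
    have "\<exists>col. (\<forall>x\<in>L. col x < Suc d) \<and> (\<forall>x\<in>L. \<forall>y\<in>L. {x, y} \<in> E \<longrightarrow> col x \<noteq> col y)"
      by (rule insert.IH) (use low in blast)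
    then obtain col where "\<forall>x\<in>L. col x < Suc d" "\<forall>x\<in>L. \<forall>y\<in>L. {x, y} \<in> E \<longrightarrow> col x \<noteq> col y" by blast
    then show ?thesis by (intro that[of col]) simp_all
  qed
  have "card (col ` (nbrs E x \<inter> L)) \<le> card (nbrs E x \<inter> L)"
    using finite_nbrs[OF E] by (intro card_image_le) auto
  also have "\<dots> < card {..<Suc d}" using low[of x] by simp
  finally have lt: "card (col ` (nbrs E x \<inter> L)) < card {..<Suc d}" .
  obtain i where i: "i < Suc d" "i \<notin> col ` (nbrs E x \<inter> L)"
  proof (rule ccontr)
    assume "\<not> thesis"
    then have "{..<Suc d} \<subseteq> col ` (nbrs E x \<inter> L)" using that by blast
    then have "card {..<Suc d} \<le> card (col ` (nbrs E x \<inter> L))"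
      using finite_nbrs[OF E] by (intro card_mono) auto
    then show False using lt by simp
  qed
  show ?case
  proof (intro exI[of _ "col(x := i)"] conjI ballI impI)
    fix y assume "y \<in> insert x L"
    then show "(col(x := i)) y < Suc d" using i(1) col(1) by auto
  next
    fix y z assume yz: "y \<in> insert x L" "z \<in> insert x L" "{y, z} \<in> E"
    have "y \<noteq> z" using graph_irrefl[OF E yz(3)] .
    consider "y = x" "z \<in> L" "z \<noteq> x" | "z = x" "y \<in> L" "y \<noteq> x" | "y \<noteq> x" "z \<noteq> x" "y \<in> L" "z \<in> L"
      using yz \<open>y \<noteq> z\<close> by blast
    then show "(col(x := i)) y \<noteq> (col(x := i)) z"
    proof cases
      case 1
      then have "z \<in> nbrs E x \<inter> L" using yz(3) by (simp add: nbrs_def)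
      then have "i \<noteq> col z" using i(2) by blast
      then show ?thesis using 1 by simp
    next
      case 2
      then have "y \<in> nbrs E x \<inter> L" using yz(3) by (simp add: nbrs_def insert_commute)
      then have "i \<noteq> col y" using i(2) by blast
      then show ?thesis using 2 by simp
    next
      case 3
      then show ?thesis using col(2) yz(3) by simp
    qed
  qed
qed

text \<open>Each peeled layer occupies a band of \<open>Suc d\<close> ranks: its vertices have at
  most \<open>d\<close> neighbours among those not yet peeled, so that many colours suffice within
  the layer. Everything below the remaining set thus uses a number of ranks independent of the
  graph.\<close>

lemma peeling_good_rank:
  assumes E: "E \<subseteq> all_edges V" "finite V"
    and "good_rank E (V \<inter> surv (Suc d) E {} t) d r0"
  shows "\<exists>r. good_rank E V d r \<and> (\<forall>x\<in>V \<inter> surv (Suc d) E {} t. r x = r0 x + t * Suc d) \<and>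
    (\<forall>x\<in>V - surv (Suc d) E {} t. r x < t * Suc d)"
  using assms(3)
proof (induction t arbitrary: r0)
  case 0
  then show ?case by auto
next
  case (Suc t)
  let ?W = "V \<inter> surv (Suc d) E {} t"
  let ?S = "V \<inter> surv (Suc d) E {} (Suc t)"
  have gE: "graph E" using graph_subset[OF graph_all_edges[OF E(2)] E(1)] .
  have sub: "?S \<subseteq> ?W" using surv_Suc_subset[OF gE, of "Suc d" "{}" t] by blast
  have low: "card (nbrs E x \<inter> ?W) \<le> d" if "x \<in> ?W - ?S" for x
  proof -
    have "card (nbrs E x \<inter> ?W) \<le> card (nbrs E x \<inter> surv (Suc d) E {} t)"
      using finite_nbrs[OF gE] by (intro card_mono) auto
    moreover have "\<not> Suc d \<le> card (nbrs E x \<inter> surv (Suc d) E {} t)" using that by simp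
    ultimately show ?thesis by linarith
  qed
  have "card (nbrs E x \<inter> (?W - ?S)) \<le> d" if "x \<in> ?W - ?S" for x
  proof -
    have "card (nbrs E x \<inter> (?W - ?S)) \<le> card (nbrs E x \<inter> ?W)"
      using finite_nbrs[OF gE] by (intro card_mono) auto
    then show ?thesis using low[OF that] by simp
  qed
  from ex_proper_colouring[OF gE _ this] obtain col where col:
    "\<And>x. x \<in> ?W - ?S \<Longrightarrow> col x < Suc d" "\<And>x y. x \<in> ?W - ?S \<Longrightarrow> y \<in> ?W - ?S \<Longrightarrow> {x, y} \<in> E \<Longrightarrow> col x \<noteq> col y"
    using E(2) by (metis finite_Diff finite_Int)
  define r1 where "r1 x = (if x \<in> ?S then r0 x + Suc d else col x)" for x
  have "good_rank E ?W d r1"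
    unfolding r1_def by (rule good_rank_extend[OF gE sub Suc.prems low col])
  from Suc.IH[OF this] obtain r where r: "good_rank E V d r"
    "\<And>x. x \<in> ?W \<Longrightarrow> r x = r1 x + t * Suc d" "\<And>x. x \<in> V - surv (Suc d) E {} t \<Longrightarrow> r x < t * Suc d" by blast
  show ?case
  proof (intro exI[of _ r] conjI ballI)
    show "good_rank E V d r" by (rule r(1))
    show "r x = r0 x + Suc t * Suc d" if "x \<in> ?S" for x
    proof -
      have "r x = r1 x + t * Suc d" using that sub by (intro r(2)) blast
      then show ?thesis using that by (simp add: r1_def)
    qed
    show "r x < Suc t * Suc d" if x: "x \<in> V - surv (Suc d) E {} (Suc t)" for x
    proof (cases "x \<in> surv (Suc d) E {} t")
      case True
      then have "x \<in> ?W - ?S" using x by blast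
      then have "r x = r1 x + t * Suc d" "r1 x < Suc d" using r(2) col(1) by (auto simp: r1_def)
      then show ?thesis by simp
    next
      case False
      then have "r x < t * Suc d" using x r(3) by blast
      then show ?thesis by simp
    qed
  qed
qed

section \<open>Growth of balls around connected sets\<close>

definition closed_nbhd :: "'a set set \<Rightarrow> 'a set \<Rightarrow> 'a set" where
  "closed_nbhd E K = K \<union> (\<Union>x\<in>K. nbrs E x)"

lemma closed_nbhd_mono: "K \<subseteq> K' \<Longrightarrow> closed_nbhd E K \<subseteq> closed_nbhd E K'"
  by (auto simp: closed_nbhd_def)

lemma closed_nbhd_pow_mono: "K \<subseteq> K' \<Longrightarrow> (closed_nbhd E ^^ i) K \<subseteq> (closed_nbhd E ^^ i) K'"
  by (induction i) (simp_all add: closed_nbhd_mono)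

lemma conn_Un_attached:
  assumes "conn E K" "finite Y" "\<And>y. y \<in> Y \<Longrightarrow> \<exists>a\<in>K. {a, y} \<in> E"
  shows "conn E (K \<union> Y)"
  using assms(2,3)
proof (induction Y rule: finite_induct)
  case (insert y Y)
  then obtain a where "a \<in> K" "{a, y} \<in> E" by blast
  then have "conn E (insert y (K \<union> Y))" using insert by (intro conn_insert[of E "K \<union> Y" a y]) auto
  then show ?case by simp
qed (use assms in simp)

lemma conn_closed_nbhd: "graph E \<Longrightarrow> conn E K \<Longrightarrow> finite K \<Longrightarrow> conn E (closed_nbhd E K)"
  unfolding closed_nbhd_def by (rule conn_Un_attached) (simp_all add: finite_nbrs, auto simp: nbrs_def)

lemma conn_subset_comp_in:
  assumes "conn E K" "K \<subseteq> V" "x \<in> K"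
  shows "K \<subseteq> comp_in E V x"
proof (rule ccontr)
  assume "\<not> ?thesis"
  then have "K \<inter> comp_in E V x \<noteq> {} \<and> K \<inter> comp_in E V x \<subset> K" using assms(3) comp_in_self by fastforce
  then obtain a b where "a \<in> K \<inter> comp_in E V x" "b \<in> K - K \<inter> comp_in E V x" "{a, b} \<in> E"
    using assms(1) unfolding conn_def by meson
  then show False using comp_in_closed[of a E V x b] assms(2) by blast
qed

text \<open>The volume hypothesis concerns size exactly \<open>s\<close>. Either the component of
  \<open>K\<close> has at most \<open>s\<close> vertices and contains the neighbourhood, or
  \<open>K\<close> extends within it to a connected set of size \<open>s\<close>.\<close>

lemma card_closed_nbhd_le:
  assumes E: "E \<subseteq> all_edges V" "finite V"
    and K: "conn E K" "K \<subseteq> V" "K \<noteq> {}" "card K \<le> s"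
    and vol: "\<And>U. U \<subseteq> V \<Longrightarrow> conn E U \<Longrightarrow> card U = s \<Longrightarrow> card ((\<Union>x\<in>U. nbrs E x) - U) \<le> C * s"
  shows "card (closed_nbhd E K) \<le> (C + 1) * s"
proof -
  have gE: "graph E" using graph_subset[OF graph_all_edges[OF E(2)] E(1)] .
  have inV: "a \<in> V \<and> b \<in> V" if "{a, b} \<in> E" for a b using that E(1) by (auto simp: all_edges_def)
  obtain x where x: "x \<in> K" using K(3) by blast
  let ?Q = "comp_in E V x"
  have QV: "?Q \<subseteq> V" using x K(2) by (intro comp_in_subset) blast
  then have finQ: "finite ?Q" using E(2) finite_subset by blast
  have KQ: "K \<subseteq> ?Q" by (rule conn_subset_comp_in[OF K(1,2) x])
  show ?thesis
  proof (cases "card ?Q \<le> s")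
    case True
    have "closed_nbhd E K \<subseteq> ?Q"
    proof
      fix y assume "y \<in> closed_nbhd E K"
      then consider "y \<in> K" | a where "a \<in> K" "{a, y} \<in> E" by (auto simp: closed_nbhd_def nbrs_def)
      then show "y \<in> ?Q"
      proof cases
        case 2
        then show ?thesis using KQ inV[of a y] comp_in_closed[of a E V x y] by blast
      qed (use KQ in blast)
    qed
    then have "card (closed_nbhd E K) \<le> card ?Q" using finQ by (rule card_mono[rotated])
    then show ?thesis using True by simp
  next
    case False
    then obtain U where U: "K \<subseteq> U" "U \<subseteq> ?Q" "conn E U" "card U = s"
      using conn_enlarge[OF conn_comp_in finQ K(1) KQ K(3,4)] by auto
    have "finite U" using U finQ finite_subset by blast
    have "closed_nbhd E K \<subseteq> U \<union> ((\<Union>x\<in>U. nbrs E x) - U)" using U(1) by (auto simp: closed_nbhd_def)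
    then have "card (closed_nbhd E K) \<le> card (U \<union> ((\<Union>x\<in>U. nbrs E x) - U))"
      using \<open>finite U\<close> finite_nbrs[OF gE] by (intro card_mono) auto
    also have "\<dots> \<le> card U + card ((\<Union>x\<in>U. nbrs E x) - U)" by (rule card_Un_le)
    also have "\<dots> \<le> s + C * s" using U QV vol[of U] by simp
    finally show ?thesis by simp
  qed
qed

text \<open>The size bound grows by the factor C + 1 per step, so volume bounds at only
  \<open>L\<close> different sizes are required.\<close>

lemma card_closed_nbhd_pow_le:
  assumes E: "E \<subseteq> all_edges V" "finite V"
    and K: "conn E K" "K \<subseteq> V" "K \<noteq> {}" "card K \<le> s"
    and vol: "\<And>i U. i < L \<Longrightarrow> U \<subseteq> V \<Longrightarrow> conn E U \<Longrightarrow> card U = (C + 1) ^ i * s \<Longrightarrow>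
      card ((\<Union>x\<in>U. nbrs E x) - U) \<le> C * ((C + 1) ^ i * s)"
  shows "i \<le> L \<Longrightarrow> conn E ((closed_nbhd E ^^ i) K) \<and> (closed_nbhd E ^^ i) K \<subseteq> V \<and> (closed_nbhd E ^^ i) K \<noteq> {} \<and>
    card ((closed_nbhd E ^^ i) K) \<le> (C + 1) ^ i * s"
proof (induction i)
  case 0
  then show ?case using K by simp
next
  case (Suc i)
  let ?N = "(closed_nbhd E ^^ i) K"
  have gE: "graph E" using graph_subset[OF graph_all_edges[OF E(2)] E(1)] .
  have IH: "conn E ?N" "?N \<subseteq> V" "?N \<noteq> {}" "card ?N \<le> (C + 1) ^ i * s" using Suc by simp_all
  have "card (closed_nbhd E ?N) \<le> (C + 1) * ((C + 1) ^ i * s)"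
    using Suc.prems by (intro card_closed_nbhd_le[OF E IH] vol) auto
  moreover have "conn E (closed_nbhd E ?N)" using IH E(2) by (intro conn_closed_nbhd gE) (auto intro: finite_subset)
  moreover have "closed_nbhd E ?N \<subseteq> V" using IH(2) E(1) by (auto simp: closed_nbhd_def nbrs_def all_edges_def)
  moreover have "closed_nbhd E ?N \<noteq> {}" using IH(3) by (auto simp: closed_nbhd_def)
  ultimately show ?case by (simp add: add_mult_distrib)
qed

text \<open>Following Maker's upward edges leads all vertices of \<open>C\<close> to one root. Each
  proper step raises the rank, so after \<open>L\<close> steps a path has stopped at the root or has
  entered \<open>S\<close>, which it then never leaves. Hence \<open>C\<close> is within distance
  \<open>L\<close> of the root, or of the component of the root inside \<open>S\<close>.\<close>

lemma outdegree_le_1_component: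
  assumes E: "E \<subseteq> all_edges V" "finite V" and r: "\<And>x y. {x, y} \<in> E \<Longrightarrow> r x \<noteq> (r y :: nat)"
    and M: "M \<subseteq> E" "\<And>v e e'. e \<in> M \<inter> upedges r E v \<Longrightarrow> e' \<in> M \<inter> upedges r E v \<Longrightarrow> e = e'"
    and S: "S \<subseteq> V" "\<And>x. x \<in> V \<Longrightarrow> L \<le> r x \<Longrightarrow> x \<in> S"
    and C: "C \<in> graph_components V M"
  shows "\<exists>K. conn E K \<and> K \<subseteq> V \<and> K \<noteq> {} \<and> (K \<subseteq> S \<or> card K = 1) \<and> C \<subseteq> (closed_nbhd E ^^ L) K"
proof -
  have gE: "graph E" using graph_subset[OF graph_all_edges[OF E(2)] E(1)] .
  have inV: "a \<in> V \<and> b \<in> V" if "{a, b} \<in> E" for a b using that E(1) by (auto simp: all_edges_def)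
  \<comment> \<open>Roots, where Maker has no upward edge, are the fixed points of
    \<open>up\<close>.\<close>
  define up where "up v = (if \<exists>w. {v, w} \<in> M \<and> r v < r w then SOME w. {v, w} \<in> M \<and> r v < r w else v)" for v
  have up: "up v = v \<or> ({v, up v} \<in> M \<and> r v < r (up v))" for v
  proof (cases "\<exists>w. {v, w} \<in> M \<and> r v < r w")
    case True
    then have "{v, up v} \<in> M \<and> r v < r (up v)" unfolding up_def by simp (rule someI_ex)
    then show ?thesis ..
  next
    case False
    then show ?thesis unfolding up_def by (simp only: if_False simp_thms)
  qed
  have up_eq: "up v = w" if vw: "{v, w} \<in> M" "r v < r w" for v w
  proof -
    have ex: "\<exists>w. {v, w} \<in> M \<and> r v < r w" using vw by blast
    then have "{v, up v} \<in> M \<and> r v < r (up v)" unfolding up_def by simp (rule someI_ex)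
    then have "{v, up v} \<in> M \<inter> upedges r E v" "{v, w} \<in> M \<inter> upedges r E v"
      using vw M(1) unfolding upedges_def by blast+
    then have "{v, up v} = {v, w}" by (rule M(2))
    then show ?thesis by (auto simp: doubleton_eq_iff)
  qed
  have upV: "up v \<in> V" if "v \<in> V" for v using up[of v] that inV[of v "up v"] M(1) by auto
  have powV: "(up ^^ i) v \<in> V" if "v \<in> V" for i v using that by (induction i) (auto intro: upV)
  have rmono: "r v \<le> r (up v)" for v using up[of v] by auto
  have rpow: "r ((up ^^ i) v) \<le> r ((up ^^ (i + l)) v)" for i l v
    by (induction l) (auto intro: order_trans[OF _ rmono])
  have grow: "up ((up ^^ i) v) = (up ^^ i) v \<or> i \<le> r ((up ^^ i) v)" for i v
  proof (induction i)
    case (Suc i)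
    show ?case
    proof (cases "up ((up ^^ i) v) = (up ^^ i) v")
      case False
      then have "i \<le> r ((up ^^ i) v)" "r ((up ^^ i) v) < r (up ((up ^^ i) v))" using Suc up[of "(up ^^ i) v"] by auto
      then show ?thesis by simp
    qed simp
  qed simp
  \<comment> \<open>More steps than the largest rank, so that iterating \<open>up\<close> always
    ends in a fixed point; the summand \<open>L\<close> lets the first \<open>L\<close> steps be
    split off.\<close>
  define N where "N = L + Suc (Max (insert 0 (r ` V)))"
  define root where "root v = (up ^^ N) v" for v
  have root_split: "root v = (up ^^ (N - L)) ((up ^^ L) v)" for v
  proof -
    have "N = (N - L) + L" by (simp add: N_def)
    then show ?thesis unfolding root_def by (metis comp_apply funpow_add)
  qed
  have fixed: "up (root v) = root v" if "v \<in> V" for v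
  proof (rule ccontr)
    assume "up (root v) \<noteq> root v"
    then have "N \<le> r (root v)" using grow[of N v] by (simp add: root_def)
    moreover have "r (root v) \<le> Max (insert 0 (r ` V))"
      using powV[OF that, of N] E(2) by (intro Max_ge) (auto simp: root_def)
    ultimately show False by (simp add: N_def)
  qed
  have stay: "(up ^^ l) w = w" if "up w = w" for l w using that by (induction l) auto
  have root_step: "root x = root y" if xy: "{x, y} \<in> M" for x y
  proof -
    have *: "root x = root y" if "{x, y} \<in> M" "r x < r y" for x y
    proof -
      have "x \<in> V" using that(1) M(1) inV by blast
      have "root y = (up ^^ N) (up x)" using up_eq[OF that] by (simp add: root_def)
      also have "\<dots> = up (root x)" unfolding root_def by (metis funpow_swap1)
      also have "\<dots> = root x" by (rule fixed[OF \<open>x \<in> V\<close>])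
      finally show ?thesis by simp
    qed
    have "r x < r y \<or> r y < r x" using r[of x y] xy M(1) by fastforce
    then show ?thesis using *[of x y] *[of y x] xy by (auto simp: insert_commute)
  qed
  obtain v0 where v0: "v0 \<in> V" "C = {w \<in> V. (v0, w) \<in> {(x, y). {x, y} \<in> M}\<^sup>*}"
    using C by (auto simp: graph_components_def)
  define \<rho> where "\<rho> = root v0"
  have rootC: "root v = \<rho>" if "v \<in> C" for v
  proof -
    have "(v0, v) \<in> {(x, y). {x, y} \<in> M}\<^sup>*" using that v0 by simp
    then show ?thesis by (induction rule: rtrancl_induct) (auto simp: \<rho>_def dest: root_step)
  qed
  have \<rho>V: "\<rho> \<in> V" unfolding \<rho>_def root_def by (rule powV[OF v0(1)])
  have reach: "v \<in> (closed_nbhd E ^^ i) {(up ^^ i) v}" for v i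
  proof (induction i arbitrary: v)
    case (Suc i)
    have "up v \<in> (closed_nbhd E ^^ i) {(up ^^ Suc i) v}" using Suc[of "up v"] by (simp add: funpow_swap1)
    then have "up v \<in> (closed_nbhd E ^^ i) {(up ^^ Suc i) v}" .
    moreover have "v = up v \<or> {up v, v} \<in> E" using up[of v] M(1) by (auto simp: insert_commute)
    ultimately have "v \<in> closed_nbhd E ((closed_nbhd E ^^ i) {(up ^^ Suc i) v})" by (auto simp: closed_nbhd_def nbrs_def)
    then show ?case by simp
  qed simp
  show ?thesis
  proof (cases "\<rho> \<in> S")
    case False
    have "v \<in> (closed_nbhd E ^^ L) {\<rho>}" if "v \<in> C" for v
    proof -
      have vV: "v \<in> V" using that v0 by simp
      have "\<rho> = (up ^^ (L + (N - L))) v" using rootC[OF that] by (simp add: root_def N_def)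
      then have "\<not> L \<le> r ((up ^^ L) v)"
        using rpow[of L v "N - L"] S(2)[OF \<rho>V] False by fastforce
      then have fixd: "up ((up ^^ L) v) = (up ^^ L) v" using grow[of L v] by blast
      have "\<rho> = (up ^^ (N - L)) ((up ^^ L) v)" using rootC[OF that] root_split[of v] by simp
      also have "\<dots> = (up ^^ L) v" by (rule stay[OF fixd])
      finally show ?thesis using reach[of v L] by simp
    qed
    then show ?thesis using \<rho>V by (intro exI[of _ "{\<rho>}"]) (auto simp: conn_singleton)
  next
    case True
    let ?K = "comp_in E S \<rho>"
    have "v \<in> (closed_nbhd E ^^ L) ?K" if "v \<in> C" for v
    proof -
      have vV: "v \<in> V" using that v0 by simp
      have rt: "\<rho> = (up ^^ (N - L)) ((up ^^ L) v)" using rootC[OF that] root_split[of v] by simp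
      have "(up ^^ L) v \<in> ?K"
      proof (cases "L \<le> r ((up ^^ L) v)")
        case False
        then have "up ((up ^^ L) v) = (up ^^ L) v" using grow[of L v] by blast
        then have "\<rho> = (up ^^ L) v" using stay rt by simp
        then show ?thesis using comp_in_self[of \<rho> E S] by simp
      next
        case high: True
        let ?R = "{(a, b). a \<in> S \<and> b \<in> S \<and> {a, b} \<in> E}"
        have inS: "(up ^^ (L + l)) v \<in> S" for l
          using high rpow[of L v l] by (intro S(2) powV[OF vV]) linarith
        have "((up ^^ L) v, (up ^^ (L + l)) v) \<in> ?R\<^sup>*" for l
        proof (induction l)
          case (Suc l)
          let ?x = "(up ^^ (L + l)) v"
          have "up ?x = ?x \<or> (?x, up ?x) \<in> ?R"
            using up[of ?x] M(1) inS[of l] inS[of "Suc l"] by auto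
          moreover have "(up ^^ (L + Suc l)) v = up ?x" by simp
          ultimately show ?case using Suc rtrancl_into_rtrancl[of "(up ^^ L) v" ?x ?R "up ?x"] by auto
        qed simp
        from this[of "N - L"] have "((up ^^ L) v, \<rho>) \<in> ?R\<^sup>*"
          using rootC[OF that] by (simp add: root_def N_def)
        moreover have "sym (?R\<^sup>*)" by (intro sym_rtrancl) (auto simp: sym_def insert_commute)
        ultimately have "(\<rho>, (up ^^ L) v) \<in> ?R\<^sup>*" by (meson symD)
        then show ?thesis by (simp add: comp_in_def)
      qed
      then have "(closed_nbhd E ^^ L) {(up ^^ L) v} \<subseteq> (closed_nbhd E ^^ L) ?K" by (intro closed_nbhd_pow_mono) simp
      then show ?thesis using reach[of v L] by blast
    qed
    moreover have "?K \<subseteq> S" by (rule comp_in_subset[OF True])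
    moreover have "?K \<noteq> {}" using comp_in_self[of \<rho> E S] by (rule_tac notI) simp
    ultimately show ?thesis
      using S(1) conn_comp_in[of E S \<rho>] by (intro exI[of _ ?K] conjI subsetI) auto
  qed
qed

section \<open>Concentration of the number of rooted survivors\<close>

lemma choose_mult_fact_le: "real (n choose m) * fact m \<le> real n ^ m"
  using of_nat_mono[OF binomial_fact_pow[of n m], where 'a = real] by simp

lemma choose_mult_fact_ge:
  assumes "m \<le> a" shows "(real a - real m) ^ m \<le> real (a choose m) * fact m"
proof -
  have "(\<Prod>i=0..<m. real a - real m) \<le> (\<Prod>i=0..<m. real a - real i)"
    by (rule prod_mono) (use assms in auto)
  then show ?thesis by (simp add: binomial_gbinomial gbinomial_prod_rev)
qed

lemma choose_le_power: "real (n choose m) \<le> real n ^ m"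
proof -
  have "real (n choose m) * 1 \<le> real (n choose m) * fact m" by (intro mult_left_mono) auto
  then show ?thesis using choose_mult_fact_le[of n m] by linarith
qed

lemma card_all_edges_le: "finite W \<Longrightarrow> card (all_edges W) \<le> card W ^ 2"
proof -
  assume "finite W"
  then have "card (all_edges W) = card W choose 2" unfolding all_edges_def by (rule n_subsets)
  then have "real (card (all_edges W)) \<le> real (card W) ^ 2" using choose_le_power[of "card W" 2] by simp
  then show ?thesis by (simp flip: of_nat_power)
qed

lemma finite_all_edges: "finite V \<Longrightarrow> finite (all_edges V)"
  using graph_all_edges[of V] by (simp add: graph_def)

text \<open>Only upper bounds for joint probabilities are available, so a high binomial moment takes the place of
  Chebyshev's inequality in the proof of concentration.\<close>

lemma binomial_moment_Markov:
  assumes "finite V"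
  shows "pr P {x. a \<le> card (R x \<inter> V) \<and> H x} * real (a choose m)
    \<le> (\<Sum>M\<in>{M. M \<subseteq> V \<and> card M = m}. pr P {x. M \<subseteq> R x \<and> H x})"
proof -
  let ?F = "{M. M \<subseteq> V \<and> card M = m}"
  have finF: "finite ?F" using assms by simp
  let ?Q = "{x. a \<le> card (R x \<inter> V) \<and> H x}"
  have "pr P ?Q * real (a choose m) = measure_pmf.expectation P (\<lambda>x. indicator ?Q x * real (a choose m))"
    by simp
  also have "\<dots> \<le> measure_pmf.expectation P (\<lambda>x. \<Sum>M\<in>?F. indicator {x. M \<subseteq> R x \<and> H x} x)"
  proof (rule integral_mono)
    show "integrable P (\<lambda>x. indicator ?Q x * real (a choose m))"
      by (intro measure_pmf.integrable_const_bound[where B = "real (a choose m)"]) (auto simp: indicator_def)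
    show "integrable P (\<lambda>x. \<Sum>M\<in>?F. indicator {x. M \<subseteq> R x \<and> H x} x :: real)"
      by (intro Bochner_Integration.integrable_sum measure_pmf.integrable_const_bound[where B = 1]) (auto simp: indicator_def)
    fix x
    show "indicator ?Q x * real (a choose m) \<le> (\<Sum>M\<in>?F. indicator {x. M \<subseteq> R x \<and> H x} x :: real)"
    proof (cases "x \<in> ?Q")
      case True
      have "{M. M \<subseteq> R x \<inter> V \<and> card M = m} \<subseteq> {M \<in> ?F. M \<subseteq> R x}" by auto
      then have "card {M. M \<subseteq> R x \<inter> V \<and> card M = m} \<le> card {M \<in> ?F. M \<subseteq> R x}"
        by (rule card_mono[rotated]) (rule finite_subset[OF _ finF], blast)
      then have "card (R x \<inter> V) choose m \<le> card {M \<in> ?F. M \<subseteq> R x}"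
        by (subst (asm) n_subsets) (use assms in auto)
      moreover have "a choose m \<le> card (R x \<inter> V) choose m" using True by (intro binomial_right_mono) simp
      ultimately have "real (a choose m) \<le> real (card {M \<in> ?F. M \<subseteq> R x})" by linarith
      also have "\<dots> = (\<Sum>M\<in>?F. indicator {x. M \<subseteq> R x \<and> H x} x)"
      proof -
        have "(\<Sum>M\<in>?F. indicator {x. M \<subseteq> R x \<and> H x} x :: real) = (\<Sum>M\<in>?F. if M \<subseteq> R x then 1 else 0)"
          using True by (intro sum.cong) (auto simp: indicator_def)
        also have "\<dots> = real (card (?F \<inter> {M. M \<subseteq> R x}))" by (subst sum.If_cases[OF finF]) simp
        also have "?F \<inter> {M. M \<subseteq> R x} = {M \<in> ?F. M \<subseteq> R x}" by blast
        finally show ?thesis by simp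
      qed
      finally show ?thesis using True by simp
    qed (auto intro: sum_nonneg)
  qed
  also have "\<dots> = (\<Sum>M\<in>?F. pr P {x. M \<subseteq> R x \<and> H x})"
    by (subst Bochner_Integration.integral_sum)
       (auto intro!: measure_pmf.integrable_const_bound[where B = 1] simp: indicator_def)
  finally show ?thesis .
qed

text \<open>A union bound over \<open>Q\<close> and q + 1 edges spanned by Q \<union> M. There is
  one more edge than free vertices, so for p = c / n every summand is of order 1 / n.\<close>

lemma prob_dense_near_le:
  fixes p :: real
  assumes V: "finite V" and M: "M \<subseteq> V" "card M = m" and p: "0 \<le> p" "p \<le> 1"
  shows "pr (random_subset (all_edges V) p) {G. \<exists>Q\<subseteq>V - M. card Q \<le> J \<and> card Q < card (edges_in G (Q \<union> M))}
    \<le> (\<Sum>q\<le>J. real (card V) ^ q * 2 ^ (q + m)\<^sup>2 * p ^ (q + 1))"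
proof -
  let ?P = "random_subset (all_edges V) p"
  define \<Q> where "\<Q> q = {Q. Q \<subseteq> V - M \<and> card Q = q}" for q
  define \<F> where "\<F> q = (\<Union>Q\<in>\<Q> q. {F. F \<subseteq> all_edges (Q \<union> M) \<and> card F = q + 1})" for q
  have finQ: "finite (\<Q> q)" for q using V by (simp add: \<Q>_def)
  have fin1: "finite (Q \<union> M)" if "Q \<in> \<Q> q" for Q q
    using that V M(1) finite_subset[of _ V] by (auto simp: \<Q>_def)
  have finF: "finite (\<F> q)" for q
  proof -
    have "finite {F. F \<subseteq> all_edges (Q \<union> M) \<and> card F = q + 1}" if "Q \<in> \<Q> q" for Q
      using finite_all_edges[OF fin1[OF that]] by simp
    then show ?thesis unfolding \<F>_def using finQ by (intro finite_UN_I)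
  qed
  have "card (\<Q> q) \<le> card {Q. Q \<subseteq> V \<and> card Q = q}" for q
    using V by (intro card_mono) (auto simp: \<Q>_def)
  then have cQ: "real (card (\<Q> q)) \<le> real (card V) ^ q" for q
    using order_trans[OF of_nat_mono choose_le_power, of "card (\<Q> q)" "card V" q] V by (simp add: n_subsets)
  have cF: "real (card (\<F> q)) \<le> real (card V) ^ q * 2 ^ (q + m)\<^sup>2" for q
  proof -
    have "card (\<F> q) \<le> (\<Sum>Q\<in>\<Q> q. card {F. F \<subseteq> all_edges (Q \<union> M) \<and> card F = q + 1})"
      unfolding \<F>_def by (rule card_UN_le[OF finQ])
    also have "\<dots> \<le> (\<Sum>Q\<in>\<Q> q. 2 ^ (q + m)\<^sup>2)"
    proof (rule sum_mono)
      fix Q assume Q: "Q \<in> \<Q> q"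
      have "card {F. F \<subseteq> all_edges (Q \<union> M) \<and> card F = q + 1} \<le> card (Pow (all_edges (Q \<union> M)))"
        using finite_all_edges[OF fin1[OF Q]] by (intro card_mono) auto
      also have "\<dots> = 2 ^ card (all_edges (Q \<union> M))" using finite_all_edges[OF fin1[OF Q]] by (rule card_Pow)
      also have "\<dots> \<le> 2 ^ (q + m)\<^sup>2"
      proof (rule power_increasing)
        have "card (Q \<union> M) \<le> q + m" using Q M(2) card_Un_le[of Q M] by (simp add: \<Q>_def)
        then have "(card (Q \<union> M))\<^sup>2 \<le> (q + m)\<^sup>2" by (rule power_mono) simp
        then show "card (all_edges (Q \<union> M)) \<le> (q + m)\<^sup>2"
          using card_all_edges_le[OF fin1[OF Q]] by linarith
      qed simp
      finally show "card {F. F \<subseteq> all_edges (Q \<union> M) \<and> card F = q + 1} \<le> 2 ^ (q + m)\<^sup>2" .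
    qed
    finally have "card (\<F> q) \<le> card (\<Q> q) * 2 ^ (q + m)\<^sup>2" by simp
    from of_nat_mono[OF this, where 'a = real]
    have "real (card (\<F> q)) \<le> real (card (\<Q> q)) * 2 ^ (q + m)\<^sup>2" by simp
    also have "\<dots> \<le> real (card V) ^ q * 2 ^ (q + m)\<^sup>2" using cQ by (intro mult_right_mono) auto
    finally show ?thesis .
  qed
  have "pr ?P {G. \<exists>Q\<subseteq>V - M. card Q \<le> J \<and> card Q < card (edges_in G (Q \<union> M))}
    \<le> pr ?P (\<Union>q\<in>{..J}. {G. \<exists>F\<in>\<F> q. F \<subseteq> G})"
  proof (rule prob_mono_support, clarsimp)
    fix G Q assume G: "G \<in> set_pmf ?P" and Q: "Q \<subseteq> V - M" "card Q \<le> J" "card Q < card (edges_in G (Q \<union> M))"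
    have "G \<subseteq> all_edges V" using G by (rule random_subset_subset)
    have "card Q + 1 \<le> card (edges_in G (Q \<union> M))" using Q(3) by simp
    then obtain F where F: "F \<subseteq> edges_in G (Q \<union> M)" "card F = card Q + 1"
      by (rule obtain_subset_with_card_n)
    have "F \<subseteq> all_edges (Q \<union> M)" "F \<subseteq> G"
      using F(1) \<open>G \<subseteq> all_edges V\<close> by (auto simp: edges_in_def all_edges_def)
    then show "\<exists>q\<in>{..J}. \<exists>F\<in>\<F> q. F \<subseteq> G"
      using Q F(2) by (intro bexI[of _ "card Q"] bexI[of _ F]) (auto simp: \<F>_def \<Q>_def)
  qed
  also have "\<dots> \<le> (\<Sum>q\<le>J. pr ?P {G. \<exists>F\<in>\<F> q. F \<subseteq> G})"
    by (rule measure_pmf.finite_measure_subadditive_finite) auto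
  also have "\<dots> \<le> (\<Sum>q\<le>J. real (card V) ^ q * 2 ^ (q + m)\<^sup>2 * p ^ (q + 1))"
  proof (rule sum_mono)
    fix q
    have "pr ?P {G. \<exists>F\<in>\<F> q. F \<subseteq> G} \<le> card (\<F> q) * p ^ (q + 1)"
    proof (rule prob_random_subset_Bex_superset_le[OF finite_all_edges[OF V] finF _ p])
      fix F assume "F \<in> \<F> q"
      then show "F \<subseteq> all_edges V \<and> card F = q + 1"
        using M(1) unfolding \<F>_def \<Q>_def all_edges_def by blast
    qed
    also have "\<dots> \<le> real (card V) ^ q * 2 ^ (q + m)\<^sup>2 * p ^ (q + 1)"
      using cF p by (intro mult_right_mono) auto
    finally show "pr ?P {G. \<exists>F\<in>\<F> q. F \<subseteq> G} \<le> real (card V) ^ q * 2 ^ (q + m)\<^sup>2 * p ^ (q + 1)" .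
  qed
  finally show ?thesis .
qed

text \<open>The edges avoiding \<open>M\<close> are exposed first; they fix the rooted survivors
  outside \<open>M\<close>, at most \<open>N\<close> of them. The edge bundles from the vertices of
  \<open>M\<close> to these are disjoint, hence independent.\<close>

lemma prob_all_attached_le:
  fixes p :: real
  assumes V: "finite V" and M: "M \<subseteq> V" and p: "0 \<le> p" "p \<le> 1" and k: "k = Suc d"
  shows "pr (random_subset (all_edges V) p)
    {G. (\<forall>v\<in>M. d \<le> card (nbrs G v \<inter> (rsurv k (avoiding G M) j \<inter> (V - M)))) \<and>
        card (rsurv k (avoiding G M) j \<inter> V) \<le> N}
    \<le> pr (binomial_pmf N p) {d..} ^ card M"
proof -
  define B where "B = {e \<in> all_edges V. e \<inter> M = {}}"
  define A where "A = all_edges V - B"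
  have finM: "finite M" using M V finite_subset by blast
  have AB: "all_edges V = A \<union> B" "A \<inter> B = {}" "finite A" "finite B"
    using finite_all_edges[OF V] by (auto simp: A_def B_def)
  define \<phi> where "\<phi> X Y \<longleftrightarrow> (\<forall>v\<in>M. d \<le> card (nbrs X v \<inter> (rsurv k Y j \<inter> (V - M)))) \<and>
        card (rsurv k Y j \<inter> V) \<le> N" for X Y
  have "pr (random_subset (all_edges V) p)
    {G. (\<forall>v\<in>M. d \<le> card (nbrs G v \<inter> (rsurv k (avoiding G M) j \<inter> (V - M)))) \<and>
        card (rsurv k (avoiding G M) j \<inter> V) \<le> N}
    \<le> pr (random_subset (all_edges V) p) {G. \<phi> (G \<inter> A) (G \<inter> B)}"
  proof (rule prob_mono_support, clarsimp)
    fix G assume G: "G \<in> set_pmf (random_subset (all_edges V) p)"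
      and h: "\<forall>v\<in>M. d \<le> card (nbrs G v \<inter> (rsurv k (avoiding G M) j \<inter> (V - M)))"
        "card (rsurv k (avoiding G M) j \<inter> V) \<le> N"
    have sub: "G \<subseteq> all_edges V" using G by (rule random_subset_subset)
    then have 1: "(avoiding G M) = G \<inter> B" by (auto simp: B_def)
    have 2: "nbrs (G \<inter> A) v = nbrs G v" if "v \<in> M" for v
      using sub that by (auto simp: nbrs_def A_def B_def)
    show "\<phi> (G \<inter> A) (G \<inter> B)" using h unfolding \<phi>_def 1 by (simp add: 2)
  qed
  also have "\<dots> \<le> pr (binomial_pmf N p) {d..} ^ card M"
    unfolding AB(1)
  proof (rule prob_random_subset_split_le[OF AB(3,4,2)])
    fix Y assume "Y \<subseteq> B"
    define T where "T = rsurv k Y j \<inter> (V - M)"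
    define S where "S v = (\<lambda>y. {v, y}) ` T" for v
    have finT: "finite T" using V by (simp add: T_def)
    show "pr (random_subset A p) {X. \<phi> X Y} \<le> pr (binomial_pmf N p) {d..} ^ card M"
    proof (cases "card (rsurv k Y j \<inter> V) \<le> N")
      case False
      then show ?thesis by (simp add: \<phi>_def)
    next
      case True
      have cT: "card T \<le> N"
      proof -
        have "card T \<le> card (rsurv k Y j \<inter> V)" unfolding T_def using V by (intro card_mono) auto
        then show ?thesis using True by simp
      qed
      have injS: "inj_on (\<lambda>y. {v, y}) T" if "v \<in> M" for v
        using that by (auto simp: inj_on_def doubleton_eq_iff T_def)
      have eq: "card (nbrs X v \<inter> T) = card (X \<inter> S v)" if "v \<in> M" for X v
      proof -
        have "X \<inter> S v = (\<lambda>y. {v, y}) ` (nbrs X v \<inter> T)" by (auto simp: S_def nbrs_def)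
        moreover have "inj_on (\<lambda>y. {v, y}) (nbrs X v \<inter> T)" using injS[OF that] by (rule inj_on_subset) auto
        ultimately show ?thesis by (simp add: card_image)
      qed
      have "pr (random_subset A p) {X. \<phi> X Y} \<le> pr (random_subset A p) {X. \<forall>v\<in>M. d \<le> card (X \<inter> S v)}"
        by (rule measure_pmf.finite_measure_mono) (auto simp: \<phi>_def T_def[symmetric] eq)
      also have "\<dots> \<le> pr (binomial_pmf N p) {d..} ^ card M"
      proof (rule prob_random_subset_family_le[OF finM AB(3), where \<phi> = "\<lambda>v X. d \<le> card X"])
        show "S v \<subseteq> A" if "v \<in> M" for v
        proof
          fix e assume "e \<in> S v"
          then obtain y where y: "y \<in> T" "e = {v, y}" by (auto simp: S_def)
          then have "v \<noteq> y" "v \<in> V" "y \<in> V" using that M by (auto simp: T_def)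
          then show "e \<in> A" using y that by (auto simp: A_def B_def all_edges_def)
        qed
        show "S v \<inter> S w = {}" if "v \<in> M" "w \<in> M" "v \<noteq> w" for v w
          using that by (auto simp: S_def T_def doubleton_eq_iff)
        show "pr (random_subset (S v) p) {X. d \<le> card X} \<le> pr (binomial_pmf N p) {d..}"
          if "v \<in> M" for v
        proof -
          have "finite (S v)" "card (S v) = card T"
            using finT injS[OF that] by (simp_all add: S_def card_image)
          then have "pr (random_subset (S v) p) {X. d \<le> card X} = pr (binomial_pmf (card T) p) {d..}"
            using prob_random_subset_card_eq_binomial[of "S v" p d] p by simp
          also have "\<dots> \<le> pr (binomial_pmf N p) {d..}" by (rule prob_binomial_ge_mono[OF cT p])
          finally show ?thesis .
        qed
      qed simp
      finally show ?thesis .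
    qed
  qed
  finally show ?thesis .
qed

text \<open>Up to an error from dense spots near \<open>M\<close>, the vertices of \<open>M\<close>
  survive one more round like independent vertices, each with the binomial tail on \<open>N\<close>
  trials.\<close>

lemma prob_subset_rsurv_le:
  fixes p :: real
  assumes V: "finite V" and M: "M \<subseteq> V" "card M = m" and p: "0 \<le> p" "p \<le> 1" and k: "k = Suc d"
  shows "pr (random_subset (all_edges V) p) {G. M \<subseteq> rsurv k G (Suc j) \<and> card (rsurv k G j \<inter> V) \<le> N}
    \<le> (\<Sum>q\<le>j + 1. real (card V) ^ q * 2 ^ (q + m)\<^sup>2 * p ^ (q + 1)) + pr (binomial_pmf N p) {d..} ^ m"
proof -
  let ?P = "random_subset (all_edges V) p"
  let ?Bad = "{G. \<exists>Q\<subseteq>V - M. card Q \<le> j + 1 \<and> card Q < card (edges_in G (Q \<union> M))}"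
  let ?Good = "{G. (\<forall>v\<in>M. d \<le> card (nbrs G v \<inter> (rsurv k (avoiding G M) j \<inter> (V - M)))) \<and>
        card (rsurv k (avoiding G M) j \<inter> V) \<le> N}"
  have "pr ?P {G. M \<subseteq> rsurv k G (Suc j) \<and> card (rsurv k G j \<inter> V) \<le> N}
    \<le> pr ?P (?Bad \<union> ?Good)"
  proof (rule prob_mono_support)
    fix G assume G: "G \<in> set_pmf ?P" and h: "G \<in> {G. M \<subseteq> rsurv k G (Suc j) \<and> card (rsurv k G j \<inter> V) \<le> N}"
    have sub: "G \<subseteq> all_edges V" using G by (rule random_subset_subset)
    have gG: "graph G" using graph_subset[OF graph_all_edges[OF V] sub] .
    show "G \<in> ?Bad \<union> ?Good"
    proof (cases "G \<in> ?Bad")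
      case False
      have few: "card (edges_in G (Q \<union> M)) \<le> card Q" if "Q \<subseteq> V - M" "card Q \<le> j + 1" for Q
      proof (rule ccontr)
        assume "\<not> ?thesis"
        then have "G \<in> ?Bad" using that by (auto simp: not_le)
        then show False using False by simp
      qed
      have "d \<le> card (nbrs G v \<inter> (rsurv k (avoiding G M) j \<inter> (V - M)))" if "v \<in> M" for v
      proof -
        have "v \<in> rsurv k G (Suc j)" using that h by blast
        from rsurv_Suc_neighbours[OF sub V M(1) that this few] show ?thesis by (simp add: k)
      qed
      \<comment> \<open>Deleting \<open>M\<close> only shrinks the set of rooted survivors, so the
        bound \<open>N\<close> known for \<open>G\<close> carries over.\<close>
      moreover have "card (rsurv k (avoiding G M) j \<inter> V) \<le> card (rsurv k G j \<inter> V)"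
        using rsurv_mono[OF gG, of "(avoiding G M)" k j] V by (intro card_mono) auto
      ultimately have "G \<in> ?Good" using h by simp
      then show ?thesis by simp
    qed simp
  qed
  also have "\<dots> \<le> pr ?P ?Bad + pr ?P ?Good"
    by (rule measure_subadditive) (auto simp: measure_pmf.emeasure_eq_measure)
  also have "\<dots> \<le> (\<Sum>q\<le>j + 1. real (card V) ^ q * 2 ^ (q + m)\<^sup>2 * p ^ (q + 1)) + pr (binomial_pmf N p) {d..} ^ m"
    using prob_dense_near_le[OF V M p, of "j + 1"] prob_all_attached_le[OF V M(1) p k, of j N] M(2)
    by (intro add_mono) simp_all
  finally show ?thesis .
qed

lemma floor_linear_tendsto:
  fixes x :: real assumes "0 \<le> x"
  shows "(\<lambda>n. real (nat \<lfloor>x * real n\<rfloor>) / real n) \<longlonglongrightarrow> x"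
proof (rule tendsto_sandwich)
  show "(\<lambda>n. x - 1 / real n) \<longlonglongrightarrow> x" by real_asymp
  show "(\<lambda>n. x) \<longlonglongrightarrow> x" by simp
  show "\<forall>\<^sub>F n in sequentially. x - 1 / real n \<le> real (nat \<lfloor>x * real n\<rfloor>) / real n"
    using eventually_gt_at_top[of 0]
  proof eventually_elim
    case (elim n)
    have "x * real n - 1 \<le> real (nat \<lfloor>x * real n\<rfloor>)" using assms by linarith
    from divide_right_mono[OF this, of "real n"] show ?case using elim by (simp add: diff_divide_distrib)
  qed
  show "\<forall>\<^sub>F n in sequentially. real (nat \<lfloor>x * real n\<rfloor>) / real n \<le> x"
    using eventually_gt_at_top[of 0]
  proof eventually_elim
    case (elim n)
    have "0 \<le> x * real n" using assms by simp
    then have "real (nat \<lfloor>x * real n\<rfloor>) \<le> x * real n" by linarith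
    then show ?case using elim by (simp add: field_simps)
  qed
qed

lemma prob_rsurv_step:
  fixes c \<rho> \<epsilon> \<tau> :: real
  assumes c: "0 < c" "c < real n" and k: "k = Suc d" and \<epsilon>: "0 < \<epsilon>" "0 \<le> \<rho>"
    and m: "real m \<le> \<epsilon> / 2 * real n"
    and \<tau>: "pr (binomial_pmf N (c / real n)) {d..} \<le> \<tau>"
  shows "pr (Gnp n (c / real n))
      {G. nat \<lceil>(\<rho> + \<epsilon>) * real n\<rceil> \<le> card (rsurv k G (Suc j) \<inter> {..<n}) \<and> card (rsurv k G j \<inter> {..<n}) \<le> N}
    \<le> (1 / (\<rho> + \<epsilon> / 2)) ^ m * (\<Sum>q\<le>j + 1. 2 ^ (q + m)\<^sup>2 * c ^ (q + 1)) / real n + (\<tau> / (\<rho> + \<epsilon> / 2)) ^ m"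
proof -
  let ?P = "Gnp n (c / real n)"
  let ?V = "{..<n}"
  define B where "B = (\<Sum>q\<le>j + 1. 2 ^ (q + m)\<^sup>2 * c ^ (q + 1))"
  define a where "a = nat \<lceil>(\<rho> + \<epsilon>) * real n\<rceil>"
  define X where "X = pr ?P {G. a \<le> card (rsurv k G (Suc j) \<inter> ?V) \<and> card (rsurv k G j \<inter> ?V) \<le> N}"
  have n: "0 < real n" using c by linarith
  have p: "0 \<le> c / real n" "c / real n \<le> 1" using c n by (simp_all add: field_simps)
  have "(\<rho> + \<epsilon>) * real n \<le> real a" unfolding a_def by linarith
  \<comment> \<open>Half of \<epsilon> absorbs the subtraction of \<open>m\<close> in the falling
    factorial.\<close>
  then have am: "(\<rho> + \<epsilon> / 2) * real n \<le> real a - real m" using m by (simp add: field_simps)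
  moreover have pos: "0 < (\<rho> + \<epsilon> / 2) * real n" using n \<epsilon> by (intro mult_pos_pos) auto
  ultimately have "m \<le> a" by linarith
  have tail0: "0 \<le> pr (binomial_pmf N (c / real n)) {d..}" by simp
  have each: "pr ?P {G. M \<subseteq> rsurv k G (Suc j) \<and> card (rsurv k G j \<inter> ?V) \<le> N} \<le> B / real n + \<tau> ^ m"
    if "M \<subseteq> ?V" "card M = m" for M
  proof -
    have "pr ?P {G. M \<subseteq> rsurv k G (Suc j) \<and> card (rsurv k G j \<inter> ?V) \<le> N} \<le>
      (\<Sum>q\<le>j + 1. real (card ?V) ^ q * 2 ^ (q + m)\<^sup>2 * (c / real n) ^ (q + 1)) +
      pr (binomial_pmf N (c / real n)) {d..} ^ m"
      unfolding Gnp_eq_random_subset by (rule prob_subset_rsurv_le[OF _ that p k]) simp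
    also have "(\<Sum>q\<le>j + 1. real (card ?V) ^ q * 2 ^ (q + m)\<^sup>2 * (c / real n) ^ (q + 1)) = B / real n"
      unfolding B_def sum_divide_distrib using n by (intro sum.cong refl) (simp add: field_simps power_divide)
    also have "pr (binomial_pmf N (c / real n)) {d..} ^ m \<le> \<tau> ^ m"
      by (rule power_mono[OF \<tau> tail0])
    finally show ?thesis by simp
  qed
  have "0 \<le> \<tau>" using \<tau> tail0 by linarith
  have "0 \<le> B" unfolding B_def using c by (intro sum_nonneg mult_nonneg_nonneg) auto
  then have rhs0: "0 \<le> B / real n + \<tau> ^ m" using n \<open>0 \<le> \<tau>\<close> by simp
  have X0: "0 \<le> X" by (simp add: X_def)
  have "X * real (a choose m) \<le> (\<Sum>M\<in>{M. M \<subseteq> ?V \<and> card M = m}.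
      pr ?P {G. M \<subseteq> rsurv k G (Suc j) \<and> card (rsurv k G j \<inter> ?V) \<le> N})"
    unfolding X_def by (rule binomial_moment_Markov) simp
  also have "\<dots> \<le> (\<Sum>M\<in>{M. M \<subseteq> ?V \<and> card M = m}. B / real n + \<tau> ^ m)"
    by (rule sum_mono) (use each in auto)
  also have "\<dots> = real (n choose m) * (B / real n + \<tau> ^ m)" using n_subsets[of ?V m] by simp
  finally have main: "X * real (a choose m) \<le> real (n choose m) * (B / real n + \<tau> ^ m)" .
  have "X * ((\<rho> + \<epsilon> / 2) * real n) ^ m \<le> X * (real a - real m) ^ m"
    using am pos X0 by (intro mult_left_mono power_mono) auto
  also have "\<dots> \<le> X * (real (a choose m) * fact m)"
    by (intro mult_left_mono choose_mult_fact_ge[OF \<open>m \<le> a\<close>] X0)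
  also have "\<dots> \<le> real (n choose m) * (B / real n + \<tau> ^ m) * fact m"
    using mult_right_mono[OF main, of "fact m"] by (simp add: mult.assoc)
  also have "\<dots> = (real (n choose m) * fact m) * (B / real n + \<tau> ^ m)" by simp
  also have "\<dots> \<le> real n ^ m * (B / real n + \<tau> ^ m)"
    by (intro mult_right_mono choose_mult_fact_le rhs0)
  finally have "X * (\<rho> + \<epsilon> / 2) ^ m * real n ^ m \<le> (B / real n + \<tau> ^ m) * real n ^ m"
    by (simp add: power_mult_distrib mult_ac)
  then have "X * (\<rho> + \<epsilon> / 2) ^ m \<le> B / real n + \<tau> ^ m" using n by simp
  moreover have "0 < (\<rho> + \<epsilon> / 2) ^ m" using \<epsilon> by simp
  ultimately have "X \<le> (B / real n + \<tau> ^ m) / (\<rho> + \<epsilon> / 2) ^ m" by (simp add: pos_le_divide_eq)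
  also have "\<dots> = (1 / (\<rho> + \<epsilon> / 2)) ^ m * B / real n + (\<tau> / (\<rho> + \<epsilon> / 2)) ^ m"
    by (simp add: power_divide add_divide_distrib)
  finally show ?thesis unfolding X_def a_def B_def .
qed

text \<open>Induction over the rounds for all \<epsilon> at once: a slightly weaker count after
  \<open>j\<close> rounds changes the tail for the next round only slightly, by continuity.\<close>

lemma rsurv_concentrated:
  fixes c :: real
  assumes c: "0 < c" and d: "1 \<le> d" and "0 < \<epsilon>"
  shows "(\<lambda>n. pr (Gnp n (c / real n))
    {G. (survival_iter d c j + \<epsilon>) * real n < real (card (rsurv (Suc d) G j \<inter> {..<n}))}) \<longlonglongrightarrow> 0"
  using assms(3)
proof (induction j arbitrary: \<epsilon>)
  case 0
  have "{G :: nat set set. (survival_iter d c 0 + \<epsilon>) * real n < real (card (rsurv (Suc d) G 0 \<inter> {..<n}))} = {}" for n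
  proof -
    have "\<not> (survival_iter d c 0 + \<epsilon>) * real n < real n" using 0 by (simp add: not_less algebra_simps)
    then show ?thesis by simp
  qed
  then show ?case by simp
next
  case (Suc j)
  define \<rho> where "\<rho> = survival_iter d c (Suc j)"
  define \<rho>0 where "\<rho>0 = survival_iter d c j"
  have bnd: "0 \<le> \<rho>" "0 \<le> \<rho>0" unfolding \<rho>_def \<rho>0_def using survival_iter_bounds[OF c d] by blast+
  \<comment> \<open>Selects \<epsilon>' of the form 1 / (i + 1) for the induction hypothesis, such
    that the tail at \<rho>0 + \<epsilon>' stays below \<rho> + \<epsilon> / 4.\<close>
  have "(\<lambda>i. poisson_tail d (c * (\<rho>0 + inverse (real (Suc i))))) \<longlonglongrightarrow> poisson_tail d (c * (\<rho>0 + 0))"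
    by (intro isCont_tendsto_compose[OF continuous_poisson_tail] tendsto_intros LIMSEQ_inverse_real_of_nat)
  moreover have "poisson_tail d (c * (\<rho>0 + 0)) < \<rho> + \<epsilon> / 4" using Suc.prems by (simp add: \<rho>_def \<rho>0_def)
  ultimately have "\<forall>\<^sub>F i in sequentially. poisson_tail d (c * (\<rho>0 + inverse (real (Suc i)))) < \<rho> + \<epsilon> / 4"
    by (rule order_tendstoD)
  then obtain i where i: "poisson_tail d (c * (\<rho>0 + inverse (real (Suc i)))) < \<rho> + \<epsilon> / 4"
    by (auto simp: eventually_sequentially)
  define \<epsilon>' where "\<epsilon>' = inverse (real (Suc i))"
  have \<epsilon>': "0 < \<epsilon>'" by (simp add: \<epsilon>'_def)
  define N where "N n = nat \<lfloor>(\<rho>0 + \<epsilon>') * real n\<rfloor>" for n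
  have "(\<lambda>n. pr (binomial_pmf (N n) (c / real n)) {d..}) \<longlonglongrightarrow> poisson_tail d (c * (\<rho>0 + \<epsilon>'))"
    unfolding N_def using bnd \<epsilon>' by (intro binomial_tail_tendsto c floor_linear_tendsto) simp
  then have ev_tail: "\<forall>\<^sub>F n in sequentially. pr (binomial_pmf (N n) (c / real n)) {d..} < \<rho> + \<epsilon> / 4"
    by (rule order_tendstoD) (use i in \<open>simp add: \<epsilon>'_def\<close>)
  show ?case
  proof (rule order_tendstoI)
    fix \<eta> :: real assume \<eta>: "0 < \<eta>"
    \<comment> \<open>The gap between \<epsilon> / 4 and \<epsilon> / 2 makes q < 1. The order of
      the moment, \<open>m\<close>, is fixed by \<eta> before \<open>n\<close> grows.\<close>
    define q where "q = (\<rho> + \<epsilon> / 4) / (\<rho> + \<epsilon> / 2)"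
    have "q < 1" using bnd Suc.prems by (simp add: q_def)
    then obtain m where m: "q ^ m < \<eta> / 4" using real_arch_pow_inv[of "\<eta> / 4" q] \<eta> by auto
    define K where "K = (1 / (\<rho> + \<epsilon> / 2)) ^ m * (\<Sum>q\<le>j + 1. 2 ^ (q + m)\<^sup>2 * c ^ (q + 1))"
    have "(\<lambda>n. K / real n) \<longlonglongrightarrow> 0" by real_asymp
    then have ev_K: "\<forall>\<^sub>F n in sequentially. K / real n < \<eta> / 4" by (rule order_tendstoD) (use \<eta> in simp)
    have ev_IH: "\<forall>\<^sub>F n in sequentially. pr (Gnp n (c / real n))
      {G. (\<rho>0 + \<epsilon>') * real n < real (card (rsurv (Suc d) G j \<inter> {..<n}))} < \<eta> / 4"
      using Suc.IH[OF \<epsilon>'] unfolding \<rho>0_def by (rule order_tendstoD) (use \<eta> in simp)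
    show "\<forall>\<^sub>F n in sequentially. pr (Gnp n (c / real n))
      {G. (survival_iter d c (Suc j) + \<epsilon>) * real n < real (card (rsurv (Suc d) G (Suc j) \<inter> {..<n}))} < \<eta>"
      using ev_tail ev_K ev_IH eventually_gt_at_top[of "nat \<lceil>c\<rceil>"] eventually_ge_at_top[of "nat \<lceil>real m / (\<epsilon> / 2)\<rceil>"]
    proof eventually_elim
      case (elim n)
      let ?P = "Gnp n (c / real n)"
      have n: "c < real n" using elim(4) by linarith
      have "real m / (\<epsilon> / 2) \<le> real n" using elim(5) by linarith
      then have mn: "real m \<le> \<epsilon> / 2 * real n" using Suc.prems by (simp add: field_simps)
      let ?A = "{G. (\<rho>0 + \<epsilon>') * real n < real (card (rsurv (Suc d) G j \<inter> {..<n}))}"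
      let ?X = "{G. nat \<lceil>(\<rho> + \<epsilon>) * real n\<rceil> \<le> card (rsurv (Suc d) G (Suc j) \<inter> {..<n}) \<and>
        card (rsurv (Suc d) G j \<inter> {..<n}) \<le> N n}"
      have "{G. (survival_iter d c (Suc j) + \<epsilon>) * real n < real (card (rsurv (Suc d) G (Suc j) \<inter> {..<n}))} \<subseteq> ?A \<union> ?X"
      proof
        fix G assume "G \<in> {G. (survival_iter d c (Suc j) + \<epsilon>) * real n < real (card (rsurv (Suc d) G (Suc j) \<inter> {..<n}))}"
        then have "(\<rho> + \<epsilon>) * real n < real (card (rsurv (Suc d) G (Suc j) \<inter> {..<n}))"
          unfolding \<rho>_def by blast
        then have 1: "nat \<lceil>(\<rho> + \<epsilon>) * real n\<rceil> \<le> card (rsurv (Suc d) G (Suc j) \<inter> {..<n})" by linarith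
        show "G \<in> ?A \<union> ?X"
        proof (cases "G \<in> ?A")
          case False
          then have "real (card (rsurv (Suc d) G j \<inter> {..<n})) \<le> (\<rho>0 + \<epsilon>') * real n" by simp
          then have "card (rsurv (Suc d) G j \<inter> {..<n}) \<le> N n" unfolding N_def by (rule le_nat_floor)
          then show ?thesis using 1 by blast
        qed simp
      qed
      then have "pr ?P {G. (survival_iter d c (Suc j) + \<epsilon>) * real n < real (card (rsurv (Suc d) G (Suc j) \<inter> {..<n}))}
        \<le> pr ?P (?A \<union> ?X)" by (rule measure_pmf.finite_measure_mono) simp
      also have "\<dots> \<le> pr ?P ?A + pr ?P ?X"
        by (rule measure_subadditive) (simp_all add: measure_pmf.emeasure_eq_measure)
      also have "pr ?P ?X \<le> K / real n + q ^ m"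
        unfolding K_def q_def
        by (rule prob_rsurv_step[OF c n refl Suc.prems bnd(1) mn]) (use elim(1) in simp)
      also have "pr ?P ?A < \<eta> / 4" by (rule elim(3))
      finally show ?case using elim(2) m \<eta> by linarith
    qed
  next
    fix a :: real assume "a < 0"
    then show "\<forall>\<^sub>F n in sequentially. a < pr (Gnp n (c / real n))
      {G. (survival_iter d c (Suc j) + \<epsilon>) * real n < real (card (rsurv (Suc d) G (Suc j) \<inter> {..<n}))}"
      by (intro always_eventually allI) (rule less_le_trans, assumption, simp)
  qed
qed

section \<open>First moment bounds\<close>

text \<open>The left side divided by the factorial is a single term of the exponential series; this
  serves as a crude Stirling bound.\<close>

lemma power_self_le_exp_fact: "real s ^ s \<le> exp (real s) * fact s"
proof -
  have "(\<Sum>n\<in>{s}. real s ^ n /\<^sub>R fact n) \<le> (\<Sum>n. real s ^ n /\<^sub>R fact n)"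
    by (rule sum_le_suminf[OF summable_exp_generic]) auto
  then have "real s ^ s / fact s \<le> exp (real s)" by (simp add: exp_def divide_inverse mult.commute)
  then show ?thesis by (simp add: field_simps)
qed

lemma card_UN_le_mult:
  assumes "finite I" "\<And>i. i \<in> I \<Longrightarrow> card (A i) \<le> N"
  shows "card (\<Union>i\<in>I. A i) \<le> card I * N"
proof -
  have "card (\<Union>i\<in>I. A i) \<le> (\<Sum>i\<in>I. card (A i))" by (rule card_UN_le[OF assms(1)])
  also have "\<dots> \<le> (\<Sum>i\<in>I. N)" by (rule sum_mono) (rule assms(2))
  finally show ?thesis by simp
qed

lemma choose_le_div_fact: "real (n choose m) \<le> real n ^ m / fact m"
  using choose_mult_fact_le[of n m] by (simp add: field_simps)

lemma fact_add_ge: "fact u * real u ^ l \<le> fact (u + l)"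
proof (induction l)
  case (Suc l)
  have "fact u * real u ^ Suc l = real u * (fact u * real u ^ l)" by simp
  also have "\<dots> \<le> real (u + Suc l) * fact (u + l)" using Suc by (intro mult_mono) auto
  also have "\<dots> = fact (u + Suc l)" by simp
  finally show ?case .
qed simp

text \<open>The left-hand side bounds the expected number of pairs of a \<open>u\<close>-set of vertices and \<open>u + l\<close> edges inside it.\<close>

lemma dense_count_le:
  fixes c c1 :: real
  assumes "1 \<le> u" "0 < n" "0 \<le> c" "c \<le> c1" "1 \<le> c1"
  shows "real (n choose u) * real (u\<^sup>2 choose (u + l)) * (c / real n) ^ (u + l)
    \<le> (exp 2 * c1) ^ u * (c1 * real u / real n) ^ l"
proof -
  have u: "0 < real u" using assms by simp
  have fp: "0 < (fact u :: real)" "0 < (fact (u + l) :: real)" by simp_all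
  have "real (u\<^sup>2 choose (u + l)) \<le> real (u\<^sup>2) ^ (u + l) / fact (u + l)" by (rule choose_le_div_fact)
  also have "\<dots> \<le> real (u\<^sup>2) ^ (u + l) / (fact u * real u ^ l)"
    using fact_add_ge[of u l] u fp by (intro divide_left_mono mult_pos_pos) auto
  also have "\<dots> = real u ^ u * real u ^ u * real u ^ l / fact u"
  proof -
    have "real (u\<^sup>2) ^ (u + l) = real u ^ u * real u ^ u * real u ^ l * real u ^ l"
      by (simp add: power2_eq_square power_mult_distrib power_add)
    then show ?thesis using u by simp
  qed
  finally have e: "real (u\<^sup>2 choose (u + l)) \<le> real u ^ u * real u ^ u * real u ^ l / fact u" .
  have "real (n choose u) * real (u\<^sup>2 choose (u + l)) * (c / real n) ^ (u + l)
    \<le> (real n ^ u / fact u) * (real u ^ u * real u ^ u * real u ^ l / fact u) * (c1 / real n) ^ (u + l)"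
    using assms by (intro mult_mono choose_le_div_fact e power_mono divide_right_mono) auto
  also have "\<dots> = (real u ^ u / fact u) * (real u ^ u / fact u) * c1 ^ u * (c1 * real u / real n) ^ l"
    using assms by (simp add: power_add power_divide power_mult_distrib field_simps)
  also have "\<dots> \<le> exp (real u) * exp (real u) * c1 ^ u * (c1 * real u / real n) ^ l"
    using power_self_le_exp_fact[of u] assms by (intro mult_right_mono mult_mono) (auto simp: field_simps)
  also have "exp (real u) * exp (real u) = exp 2 ^ u"
    by (simp add: exp_of_nat_mult[symmetric] exp_add[symmetric])
  finally show ?thesis by (simp add: power_mult_distrib)
qed

text \<open>Connectedness of an \<open>s\<close>-set enters the union bounds only through its having at least \<open>s - 1\<close> edges.\<close>

lemma tree_count_le:
  fixes c c1 :: real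
  assumes "1 \<le> s" "0 < n" "0 \<le> c" "c \<le> c1" "1 \<le> c1"
  shows "real (n choose s) * real (s\<^sup>2 choose (s - 1)) * (c / real n) ^ (s - 1) \<le> real n * (exp 2 * c1) ^ s"
proof -
  have s: "0 < real s" "1 \<le> real s" using assms by simp_all
  have fs: "(fact s :: real) = real s * fact (s - 1)" using assms by (simp add: fact_reduce)
  have "real (s\<^sup>2) ^ (s - 1) = real s ^ (s - 1) * real s ^ (s - 1)"
    by (simp add: power2_eq_square power_mult_distrib)
  also have "\<dots> * real s \<le> real s ^ s * real s ^ s"
  proof -
    have "real s ^ s = real s ^ (s - 1) * real s" using assms(1) by (metis power_minus_mult Suc_le_D less_Suc_eq_0_disj Suc_le_eq One_nat_def)
    moreover have "real s ^ (s - 1) \<le> real s ^ (s - 1) * real s" using s by simp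
    ultimately show ?thesis using s by (simp add: mult_left_mono mult_right_mono mult_ac)
  qed
  finally have "real (s\<^sup>2) ^ (s - 1) * real s \<le> real s ^ s * real s ^ s" .
  then have "real (s\<^sup>2) ^ (s - 1) / fact (s - 1) \<le> real s ^ s * real s ^ s / fact s"
    unfolding fs using s by (simp add: field_simps)
  then have e: "real (s\<^sup>2 choose (s - 1)) \<le> real s ^ s * real s ^ s / fact s"
    using choose_le_div_fact[of "s\<^sup>2" "s - 1"] by linarith
  have "real (n choose s) * real (s\<^sup>2 choose (s - 1)) * (c / real n) ^ (s - 1)
    \<le> (real n ^ s / fact s) * (real s ^ s * real s ^ s / fact s) * (c1 / real n) ^ (s - 1)"
    using assms by (intro mult_mono choose_le_div_fact e power_mono divide_right_mono) auto
  also have "\<dots> = real n * ((real s ^ s / fact s) * (real s ^ s / fact s) * c1 ^ (s - 1))"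
  proof -
    have "real n ^ s = real n * real n ^ (s - 1)" using assms(1) by (simp add: power_eq_if)
    then show ?thesis using assms by (simp add: power_divide field_simps)
  qed
  also have "\<dots> \<le> real n * (exp (real s) * exp (real s) * c1 ^ s)"
    using power_self_le_exp_fact[of s] assms
    by (intro mult_left_mono mult_mono power_increasing) (auto simp: field_simps)
  also have "exp (real s) * exp (real s) = exp 2 ^ s"
    by (simp add: exp_of_nat_mult[symmetric] exp_add[symmetric])
  finally show ?thesis by (simp add: power_mult_distrib)
qed

lemma card_edge_subsets_le:
  assumes "finite U" "card U = s"
  shows "finite {F. F \<subseteq> all_edges U \<and> card F = r}" "card {F. F \<subseteq> all_edges U \<and> card F = r} \<le> s\<^sup>2 choose r"
proof -
  have fin: "finite (all_edges U)" by (rule finite_all_edges[OF assms(1)])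
  then show "finite {F. F \<subseteq> all_edges U \<and> card F = r}" by simp
  have "card {F. F \<subseteq> all_edges U \<and> card F = r} = card (all_edges U) choose r" by (rule n_subsets[OF fin])
  also have "\<dots> \<le> s\<^sup>2 choose r" using card_all_edges_le[OF assms(1)] assms(2) by (intro binomial_right_mono) simp
  finally show "card {F. F \<subseteq> all_edges U \<and> card F = r} \<le> s\<^sup>2 choose r" .
qed

lemma prob_dense_set_le:
  fixes p :: real
  assumes V: "finite V" and p: "0 \<le> p" "p \<le> 1"
  shows "pr (random_subset (all_edges V) p) {G. \<exists>W\<subseteq>V. card W = u \<and> r \<le> card (edges_in G W)}
    \<le> real (card V choose u) * real (u\<^sup>2 choose r) * p ^ r"
proof -
  define \<F> where "\<F> = (\<Union>W\<in>{W. W \<subseteq> V \<and> card W = u}. {F. F \<subseteq> all_edges W \<and> card F = r})"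
  have finW: "finite {W. W \<subseteq> V \<and> card W = u}" using V by simp
  have fin1: "finite W" if "W \<subseteq> V" for W using that V finite_subset by blast
  have finF: "finite \<F>" unfolding \<F>_def using finW card_edge_subsets_le(1)[OF fin1] by blast
  have "card \<F> \<le> card {W. W \<subseteq> V \<and> card W = u} * (u\<^sup>2 choose r)"
    unfolding \<F>_def using card_edge_subsets_le(2)[OF fin1] by (intro card_UN_le_mult finW) blast
  then have cF: "card \<F> \<le> (card V choose u) * (u\<^sup>2 choose r)" using n_subsets[OF V] by simp
  have "pr (random_subset (all_edges V) p) {G. \<exists>W\<subseteq>V. card W = u \<and> r \<le> card (edges_in G W)}
    \<le> pr (random_subset (all_edges V) p) {G. \<exists>F\<in>\<F>. F \<subseteq> G}"
  proof (rule prob_mono_support, clarsimp)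
    fix G W assume G: "G \<in> set_pmf (random_subset (all_edges V) p)" and W: "W \<subseteq> V" "r \<le> card (edges_in G W)" "u = card W"
    have "G \<subseteq> all_edges V" using G by (rule random_subset_subset)
    obtain F where F: "F \<subseteq> edges_in G W" "card F = r" using W(2) by (rule obtain_subset_with_card_n)
    have "F \<subseteq> all_edges W" "F \<subseteq> G"
      using F(1) \<open>G \<subseteq> all_edges V\<close> by (auto simp: edges_in_def all_edges_def)
    then have "F \<in> \<F>" unfolding \<F>_def using W F(2) by blast
    then show "\<exists>F\<in>\<F>. F \<subseteq> G" using \<open>F \<subseteq> G\<close> by blast
  qed
  also have "\<dots> \<le> real (card \<F>) * p ^ r"
  proof (rule prob_random_subset_Bex_superset_le[OF finite_all_edges[OF V] finF _ p])
    fix F assume "F \<in> \<F>"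
    then show "F \<subseteq> all_edges V \<and> card F = r" unfolding \<F>_def all_edges_def by blast
  qed
  also have "\<dots> \<le> real ((card V choose u) * (u\<^sup>2 choose r)) * p ^ r"
    using cF p by (intro mult_right_mono of_nat_mono) auto
  finally show ?thesis by simp
qed

text \<open>A set of \<open>u\<close> vertices with the required excess is expected at most
  \<open>\<theta> ^ u\<close> times, where \<theta> is of order (ln n / n) to the power \<delta>.
  Summing over the logarithmically many sizes still gives a null sequence.\<close>

lemma sparse_whp:
  fixes c \<delta> :: real
  assumes c: "0 < c" and \<delta>: "0 < \<delta>"
  shows "(\<lambda>n. pr (Gnp n (c / real n))
    {G. \<exists>W\<subseteq>{..<n}. W \<noteq> {} \<and> card W \<le> mm * nat \<lceil>ln (real n)\<rceil> \<and>
      (1 + \<delta>) * real (card W) < real (card (edges_in G W))}) \<longlonglongrightarrow> 0"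
proof -
  define c1 where "c1 = max 1 c"
  have c1: "1 \<le> c1" "c \<le> c1" by (auto simp: c1_def)
  define um where "um n = mm * nat \<lceil>ln (real n)\<rceil>" for n :: nat
  define L where "L n = real mm * (ln (real n) + 1)" for n :: nat
  define b where "b n = L n * (exp 2 * c1 * (c1 * L n / real n) powr \<delta>)" for n
  let ?p = "\<lambda>n. pr (Gnp n (c / real n))
    {G. \<exists>W\<subseteq>{..<n}. W \<noteq> {} \<and> card W \<le> um n \<and> (1 + \<delta>) * real (card W) < real (card (edges_in G W))}"
  have x0: "(\<lambda>n. c1 * L n / real n) \<longlonglongrightarrow> 0" unfolding L_def by real_asymp
  have "(\<lambda>n. ln (real n) * ((ln (real n) + 1) / real n) powr \<delta>) \<longlonglongrightarrow> 0" using \<delta> by real_asymp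
  moreover have "(\<lambda>n. ((ln (real n) + 1) / real n) powr \<delta>) \<longlonglongrightarrow> 0" using \<delta> by real_asymp
  ultimately have "(\<lambda>n. ln (real n) * ((ln (real n) + 1) / real n) powr \<delta> + ((ln (real n) + 1) / real n) powr \<delta>) \<longlonglongrightarrow> 0 + 0"
    by (rule tendsto_add)
  then have "(\<lambda>n. real mm * exp 2 * c1 * (c1 * real mm) powr \<delta> *
      (ln (real n) * ((ln (real n) + 1) / real n) powr \<delta> + ((ln (real n) + 1) / real n) powr \<delta>))
      \<longlonglongrightarrow> real mm * exp 2 * c1 * (c1 * real mm) powr \<delta> * (0 + 0)"
    by (intro tendsto_mult tendsto_const)
  moreover have "\<forall>\<^sub>F n in sequentially. real mm * exp 2 * c1 * (c1 * real mm) powr \<delta> *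
      (ln (real n) * ((ln (real n) + 1) / real n) powr \<delta> + ((ln (real n) + 1) / real n) powr \<delta>) = b n"
    using eventually_ge_at_top[of 1]
  proof eventually_elim
    case (elim n)
    have "(c1 * L n / real n) powr \<delta> = (c1 * real mm) powr \<delta> * ((ln (real n) + 1) / real n) powr \<delta>"
      using elim c1 by (subst powr_mult[symmetric]) (auto simp: L_def mult.assoc)
    then show ?case by (simp add: b_def L_def algebra_simps)
  qed
  ultimately have b0: "b \<longlonglongrightarrow> 0" by (simp add: tendsto_cong)
  have ev1: "\<forall>\<^sub>F n in sequentially. c1 * L n / real n < 1" using x0 by (rule order_tendstoD) simp
  have "(\<lambda>n. exp 2 * c1 * (c1 * L n / real n) powr \<delta>) \<longlonglongrightarrow> exp 2 * c1 * 0 powr \<delta>"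
    using x0 \<delta> c1 by (intro tendsto_mult tendsto_const tendsto_powr'[OF x0] ) (auto simp: L_def intro!: eventually_mono[OF eventually_ge_at_top[of 1]])
  then have "(\<lambda>n. exp 2 * c1 * (c1 * L n / real n) powr \<delta>) \<longlonglongrightarrow> 0" by simp
  then have ev2: "\<forall>\<^sub>F n in sequentially. exp 2 * c1 * (c1 * L n / real n) powr \<delta> < 1"
    by (rule order_tendstoD) simp
  have "\<forall>\<^sub>F n in sequentially. ?p n \<le> b n"
    using ev1 ev2 eventually_gt_at_top[of "nat \<lceil>c\<rceil>"] eventually_ge_at_top[of 2]
  proof eventually_elim
    case (elim n)
    let ?P = "Gnp n (c / real n)"
    define \<theta> where "\<theta> = exp 2 * c1 * (c1 * L n / real n) powr \<delta>"
    \<comment> \<open>Strictly more than (1 + \<delta>) u edges means, by integrality, at least u +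
      floor(\<delta> u) + 1.\<close>
    define l where "l u = nat \<lfloor>\<delta> * real u\<rfloor> + 1" for u :: nat
    have n: "c < real n" "0 < n" using elim(3) by linarith+
    have p: "0 \<le> c / real n" "c / real n \<le> 1" using c n by (simp_all add: field_simps)
    have umL: "real (um n) \<le> L n"
    proof -
      have "real (nat \<lceil>ln (real n)\<rceil>) \<le> ln (real n) + 1" using n by simp
      then show ?thesis unfolding um_def L_def by (simp add: mult_left_mono)
    qed
    have "?p n \<le> pr ?P (\<Union>u\<in>{1..um n}. {G. \<exists>W\<subseteq>{..<n}. card W = u \<and> u + l u \<le> card (edges_in G W)})"
    proof (rule measure_pmf.finite_measure_mono)
      show "{G. \<exists>W\<subseteq>{..<n}. W \<noteq> {} \<and> card W \<le> um n \<and> (1 + \<delta>) * real (card W) < real (card (edges_in G W))}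
        \<subseteq> (\<Union>u\<in>{1..um n}. {G. \<exists>W\<subseteq>{..<n}. card W = u \<and> u + l u \<le> card (edges_in G W)})"
      proof clarsimp
        fix G W assume W: "W \<subseteq> {..<n}" "W \<noteq> {}" "card W \<le> um n" "(1 + \<delta>) * real (card W) < real (card (edges_in G W))"
        have "finite W" using W(1) finite_subset by blast
        then have "1 \<le> card W" using W(2) by (simp add: Suc_le_eq card_gt_0_iff)
        have "real (card W) + \<delta> * real (card W) < real (card (edges_in G W))" using W(4) by (simp add: algebra_simps)
        moreover have "0 \<le> \<delta> * real (card W)" using \<delta> by simp
        ultimately have "card W + l (card W) \<le> card (edges_in G W)" unfolding l_def by linarith
        then show "\<exists>u\<in>{Suc 0..um n}. \<exists>W\<subseteq>{..<n}. card W = u \<and> u + l u \<le> card (edges_in G W)"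
          using W \<open>1 \<le> card W\<close> by (intro bexI[of _ "card W"]) auto
      qed
    qed simp
    also have "\<dots> \<le> (\<Sum>u\<in>{1..um n}. pr ?P {G. \<exists>W\<subseteq>{..<n}. card W = u \<and> u + l u \<le> card (edges_in G W)})"
      by (rule measure_pmf.finite_measure_subadditive_finite) auto
    also have "\<dots> \<le> (\<Sum>u\<in>{1..um n}. \<theta>)"
    proof (rule sum_mono)
      fix u assume u: "u \<in> {1..um n}"
      then have u1: "1 \<le> u" "real u \<le> L n" using umL by auto
      define x where "x = c1 * real u / real n"
      have x: "0 < x" "x \<le> c1 * L n / real n"
        using u1 n c1 by (auto simp: x_def intro!: divide_right_mono mult_left_mono)
      have "pr ?P {G. \<exists>W\<subseteq>{..<n}. card W = u \<and> u + l u \<le> card (edges_in G W)}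
        \<le> real (n choose u) * real (u\<^sup>2 choose (u + l u)) * (c / real n) ^ (u + l u)"
        using prob_dense_set_le[OF _ p, of "{..<n}" u "u + l u"] by (simp add: Gnp_eq_random_subset)
      also have "\<dots> \<le> (exp 2 * c1) ^ u * x ^ l u"
        unfolding x_def using u1 n c c1 by (intro dense_count_le) auto
      also have "x ^ l u = x powr real (l u)" using x by (simp add: powr_realpow)
      also have "\<dots> \<le> x powr (\<delta> * real u)"
      proof (rule powr_mono')
        have "0 \<le> \<delta> * real u" using \<delta> by simp
        then show "\<delta> * real u \<le> real (l u)" unfolding l_def by linarith
      qed (use x elim(1) in auto)
      also have "\<dots> \<le> (c1 * L n / real n) powr (\<delta> * real u)"
        using x \<delta> by (intro powr_mono2) auto
      also have "\<dots> = ((c1 * L n / real n) powr \<delta>) ^ u"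
      proof -
        have "0 < c1 * L n / real n" using x by linarith
        then have "0 < (c1 * L n / real n) powr \<delta>" by (simp only: powr_gt_zero)
        then show ?thesis unfolding powr_powr[symmetric] by (rule powr_realpow)
      qed
      finally have "pr ?P {G. \<exists>W\<subseteq>{..<n}. card W = u \<and> u + l u \<le> card (edges_in G W)} \<le> \<theta> ^ u"
        using c1 by (simp add: \<theta>_def power_mult_distrib mult_left_mono)
      also have "\<theta> ^ u \<le> \<theta> ^ 1"
        using u1 c1 elim(2) by (intro power_decreasing) (auto simp: \<theta>_def)
      finally show "pr ?P {G. \<exists>W\<subseteq>{..<n}. card W = u \<and> u + l u \<le> card (edges_in G W)} \<le> \<theta>" by simp
    qed
    also have "\<dots> = real (um n) * \<theta>" by simp
    also have "\<dots> \<le> L n * \<theta>" using umL c1 by (intro mult_right_mono) (auto simp: \<theta>_def)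
    finally show ?case by (simp add: b_def \<theta>_def)
  qed
  then have "?p \<longlonglongrightarrow> 0"
    by (intro tendsto_sandwich[OF _ _ tendsto_const b0]) auto
  then show ?thesis unfolding um_def .
qed

text \<open>Common end of the bounds for volumes and clusters: their constants are tuned to a factor
  exp(-2) per vertex, so sizes from ln n on overcome the factor \<open>n\<close> of
  \<open>tree_count_le\<close>.\<close>

lemma exp_minus_2_ln_le:
  assumes "0 < n" "ln (real n) \<le> real s"
  shows "real n * exp (- 2) ^ s \<le> 1 / real n"
proof -
  have "exp (- 2) ^ s = exp (real s * - 2)" by (rule exp_of_nat_mult[symmetric])
  also have "\<dots> \<le> exp (- 2 * ln (real n))" using assms by simp
  also have "\<dots> = exp (- ln (real n)) * exp (- ln (real n))" by (simp flip: exp_add)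
  also have "\<dots> = 1 / (real n * real n)" using assms by (simp add: exp_minus field_simps)
  finally show ?thesis using assms by (simp add: field_simps)
qed

text \<open>Union bound over s - 1 edges inside \<open>U\<close> and \<open>K\<close> further edges,
  one from each vertex of some \<open>Y\<close> into \<open>T\<close>. It serves twice: for volumes
  \<open>Y\<close> lies outside and T = U; for clusters \<open>Y\<close> lies in \<open>U\<close>
  and \<open>T\<close> consists of survivors outside.\<close>

lemma prob_tree_with_star_le:
  fixes p :: real
  assumes A: "finite A" "all_edges U \<subseteq> A" "\<And>e. e \<in> A \<Longrightarrow> card e = 2" and U: "finite U" "card U = s"
    and Y: "finite \<Y>" "\<And>Y. Y \<in> \<Y> \<Longrightarrow> finite Y \<and> card Y = K \<and> Y \<inter> T = {}"
    and T: "finite T" "card T \<le> N"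
    and edges: "\<And>Y y z. Y \<in> \<Y> \<Longrightarrow> y \<in> Y \<Longrightarrow> z \<in> T \<Longrightarrow> {y, z} \<in> A \<and> \<not> {y, z} \<subseteq> U"
    and p: "0 \<le> p" "p \<le> 1"
  shows "pr (random_subset A p)
      {X. s - 1 \<le> card (edges_in X U) \<and> (\<exists>Y\<in>\<Y>. \<forall>y\<in>Y. \<exists>z\<in>T. {y, z} \<in> X)}
    \<le> real (s\<^sup>2 choose (s - 1)) * real (card \<Y>) * real N ^ K * p ^ ((s - 1) + K)"
proof -
  define star where "star Y f = (\<lambda>y. {y, f y}) ` Y" for Y :: "'a set" and f :: "'a \<Rightarrow> 'a"
  define \<A> where "\<A> = {F. F \<subseteq> all_edges U \<and> card F = s - 1}"
  define \<F> where "\<F> = (\<Union>F\<in>\<A>. \<Union>Y\<in>\<Y>. (\<lambda>f. F \<union> star Y f) ` (Y \<rightarrow>\<^sub>E T))"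
  have finA: "finite \<A>" "card \<A> \<le> s\<^sup>2 choose (s - 1)"
    unfolding \<A>_def by (rule card_edge_subsets_le[OF U])+
  have finf: "finite (Y \<rightarrow>\<^sub>E T)" "card (Y \<rightarrow>\<^sub>E T) \<le> N ^ K" if "Y \<in> \<Y>" for Y
    using Y(2)[OF that] T by (auto simp: card_PiE intro: finite_PiE power_mono)
  have finF: "finite \<F>" unfolding \<F>_def
    by (intro finite_UN_I finA Y(1) finite_imageI finf)
  have "card \<F> \<le> card \<A> * (card \<Y> * N ^ K)"
    unfolding \<F>_def
  proof (rule card_UN_le_mult[OF finA(1)], rule card_UN_le_mult[OF Y(1)])
    fix F Y assume "Y \<in> \<Y>"
    then show "card ((\<lambda>f. F \<union> star Y f) ` (Y \<rightarrow>\<^sub>E T)) \<le> N ^ K"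
      using card_image_le[OF finf(1)] finf(2) order_trans by blast
  qed
  also have "\<dots> \<le> (s\<^sup>2 choose (s - 1)) * (card \<Y> * N ^ K)" using finA(2) by (rule mult_le_mono1)
  finally have cF: "real (card \<F>) \<le> real (s\<^sup>2 choose (s - 1)) * real (card \<Y>) * real N ^ K"
    using of_nat_mono[of "card \<F>" "(s\<^sup>2 choose (s - 1)) * (card \<Y> * N ^ K)", where 'a = real]
    by (simp add: mult.assoc)
  have shape: "F \<subseteq> A \<and> card F = (s - 1) + K" if FF: "F \<in> \<F>" for F
  proof -
    obtain F1 Y f where h: "F1 \<in> \<A>" "Y \<in> \<Y>" "f \<in> Y \<rightarrow>\<^sub>E T" "F = F1 \<union> star Y f"
      using FF unfolding \<F>_def by blast
    have fT: "f y \<in> T" if "y \<in> Y" for y using h(3) that by (auto simp: PiE_def)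
    have "inj_on (\<lambda>y. {y, f y}) Y"
    \<comment> \<open>Since \<open>Y\<close> and \<open>T\<close> are disjoint, an edge {y, f y}
      reveals which of its ends is \<open>y\<close>.\<close>
    proof (rule inj_onI)
      fix y z assume yz: "y \<in> Y" "z \<in> Y" "{y, f y} = {z, f z}"
      have "y \<noteq> f z" using yz fT[of z] Y(2)[OF h(2)] by blast
      then show "y = z" using yz(3) by blast
    qed
    then have "card (star Y f) = K" using Y(2)[OF h(2)] by (simp add: star_def card_image)
    moreover have "F1 \<inter> star Y f = {}"
    proof -
      have "e \<subseteq> U" if "e \<in> F1" for e using that h(1) by (auto simp: \<A>_def all_edges_def)
      moreover have "\<not> e \<subseteq> U" if "e \<in> star Y f" for e
        using that edges[OF h(2)] fT by (auto simp: star_def)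
      ultimately show ?thesis by blast
    qed
    moreover have "finite F1" using h(1) finite_subset[OF _ finite_all_edges[OF U(1)]] by (auto simp: \<A>_def)
    moreover have "finite (star Y f)" using Y(2)[OF h(2)] by (simp add: star_def)
    ultimately have "card F = (s - 1) + K" using h(1) by (simp add: h(4) card_Un_disjoint \<A>_def)
    moreover have "F1 \<subseteq> A" using h(1) A(2) by (auto simp: \<A>_def)
    moreover have "star Y f \<subseteq> A" using edges[OF h(2)] fT by (auto simp: star_def)
    ultimately show ?thesis using h(4) by blast
  qed
  have "pr (random_subset A p)
      {X. s - 1 \<le> card (edges_in X U) \<and> (\<exists>Y\<in>\<Y>. \<forall>y\<in>Y. \<exists>z\<in>T. {y, z} \<in> X)}
    \<le> pr (random_subset A p) {X. \<exists>F\<in>\<F>. F \<subseteq> X}"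
  proof (rule prob_mono_support)
    fix X assume X: "X \<in> set_pmf (random_subset A p)"
      and "X \<in> {X. s - 1 \<le> card (edges_in X U) \<and> (\<exists>Y\<in>\<Y>. \<forall>y\<in>Y. \<exists>z\<in>T. {y, z} \<in> X)}"
    then obtain Y where h: "s - 1 \<le> card (edges_in X U)" "Y \<in> \<Y>" "\<forall>y\<in>Y. \<exists>z\<in>T. {y, z} \<in> X" by blast
    obtain F1 where F1: "F1 \<subseteq> edges_in X U" "card F1 = s - 1" using h(1) by (rule obtain_subset_with_card_n)
    obtain f0 where f0: "\<And>y. y \<in> Y \<Longrightarrow> f0 y \<in> T \<and> {y, f0 y} \<in> X" using h(3) by metis
    define f where "f = restrict f0 Y"
    have "F1 \<in> \<A>" using F1 random_subset_subset[OF X] A(3) by (auto simp: \<A>_def edges_in_def all_edges_def)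
    moreover have "f \<in> Y \<rightarrow>\<^sub>E T" using f0 by (auto simp: f_def)
    ultimately have "F1 \<union> star Y f \<in> \<F>" using h(2) unfolding \<F>_def by blast
    moreover have "F1 \<union> star Y f \<subseteq> X" using F1(1) f0 by (auto simp: star_def f_def edges_in_def)
    ultimately show "X \<in> {X. \<exists>F\<in>\<F>. F \<subseteq> X}" by blast
  qed
  also have "\<dots> \<le> real (card \<F>) * p ^ ((s - 1) + K)"
    by (rule prob_random_subset_Bex_superset_le[OF A(1) finF shape p])
  also have "\<dots> \<le> real (s\<^sup>2 choose (s - 1)) * real (card \<Y>) * real N ^ K * p ^ ((s - 1) + K)"
    using cF p by (intro mult_right_mono) auto
  finally show ?thesis .
qed

text \<open>With K = C s outside neighbours the expected count gains a factor exp(- K), which for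
  large \<open>C\<close> outweighs the exponential growth in the number of trees.\<close>

lemma volume_bound:
  fixes c :: real
  assumes c: "0 < c"
  shows "\<exists>C. \<forall>n s. c < real n \<longrightarrow> 1 \<le> s \<longrightarrow> ln (real n) \<le> real s \<longrightarrow>
    pr (Gnp n (c / real n))
      {G. \<exists>U\<subseteq>{..<n}. card U = s \<and> s - 1 \<le> card (edges_in G U) \<and> C * s < card ((\<Union>x\<in>U. nbrs G x) - U)} \<le> 1 / real n"
proof -
  define c1 where "c1 = max 1 c"
  have c1: "1 \<le> c1" "c \<le> c1" by (auto simp: c1_def)
  \<comment> \<open>C \<ge> exp 2 * c1 yields the factor exp(- K) for the neighbours; C \<ge> 4 + ln
    c1 reduces exp 2 * c1 * exp(- C) to exp(-2).\<close>
  define C where "C = nat \<lceil>exp 2 * c1 + 4 + ln c1\<rceil>"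
  have C: "exp 2 * c1 \<le> real C" "4 + ln c1 \<le> real C"
  proof -
    have "exp 2 * c1 + 4 + ln c1 \<le> real C" unfolding C_def by linarith
    moreover have "0 \<le> ln c1" "0 \<le> exp 2 * c1" using c1 by simp_all
    ultimately show "exp 2 * c1 \<le> real C" "4 + ln c1 \<le> real C" by linarith+
  qed
  then have "0 < real C" using c1 by (smt (verit) ln_ge_zero)
  show ?thesis
  proof (intro exI[of _ C] allI impI)
    fix n s :: nat assume n: "c < real n" and s: "1 \<le> s" "ln (real n) \<le> real s"
    let ?V = "{..<n}"
    let ?p = "c / real n"
    have n0: "0 < n" using c n by (cases n) auto
    have p: "0 \<le> ?p" "?p \<le> 1" using c n by (simp_all add: field_simps)
    define K where "K = C * s"
    have K0: "0 < real K" using \<open>0 < real C\<close> s by (simp add: K_def)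
    define \<U> where "\<U> = {U. U \<subseteq> ?V \<and> card U = s}"
    define \<Y> where "\<Y> U = {Y. Y \<subseteq> ?V - U \<and> card Y = K}" for U
    define Ev where "Ev U = {G. s - 1 \<le> card (edges_in G U) \<and> (\<exists>Y\<in>\<Y> U. \<forall>y\<in>Y. \<exists>z\<in>U. {y, z} \<in> G)}" for U
    have cY: "card (\<Y> U) \<le> n choose K" for U
    proof -
      have "card (\<Y> U) \<le> card {Y. Y \<subseteq> ?V \<and> card Y = K}" by (intro card_mono) (auto simp: \<Y>_def)
      then show ?thesis using n_subsets[of ?V K] by simp
    qed
    have "pr (Gnp n ?p)
      {G. \<exists>U\<subseteq>?V. card U = s \<and> s - 1 \<le> card (edges_in G U) \<and> C * s < card ((\<Union>x\<in>U. nbrs G x) - U)}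
      \<le> pr (Gnp n ?p) (\<Union>U\<in>\<U>. Ev U)"
    proof (rule prob_mono_support)
      fix G assume G: "G \<in> set_pmf (Gnp n ?p)" and "G \<in> {G. \<exists>U\<subseteq>?V. card U = s \<and> s - 1 \<le> card (edges_in G U) \<and> C * s < card ((\<Union>x\<in>U. nbrs G x) - U)}"
      then obtain U where h: "U \<subseteq> ?V" "card U = s" "s - 1 \<le> card (edges_in G U)" "K < card ((\<Union>x\<in>U. nbrs G x) - U)"
        unfolding K_def by blast
      have sub: "G \<subseteq> all_edges ?V" using G unfolding Gnp_eq_random_subset by (rule random_subset_subset)
      obtain Y where Ys: "Y \<subseteq> (\<Union>x\<in>U. nbrs G x) - U" "card Y = K"
        using obtain_subset_with_card_n[OF less_imp_le[OF h(4)]] by blast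
      have YG: "\<exists>x\<in>U. {y, x} \<in> G" if yY: "y \<in> Y" for y
      proof -
        obtain x where "x \<in> U" "{x, y} \<in> G" using Ys(1) yY by (auto simp: nbrs_def)
        then show ?thesis by (auto simp: insert_commute)
      qed
      have "y \<in> ?V" if yY: "y \<in> Y" for y
      proof -
        obtain x where "{y, x} \<in> all_edges ?V" using YG[OF yY] sub by blast
        then show ?thesis by (auto simp: all_edges_def)
      qed
      then have "Y \<in> \<Y> U" using Ys by (auto simp: \<Y>_def)
      then have "G \<in> Ev U" using h(3) YG by (auto simp: Ev_def)
      then show "G \<in> (\<Union>U\<in>\<U>. Ev U)" using h(1,2) by (auto simp: \<U>_def)
    qed
    also have "\<dots> \<le> (\<Sum>U\<in>\<U>. pr (Gnp n ?p) (Ev U))"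
      by (rule measure_pmf.finite_measure_subadditive_finite) (auto simp: \<U>_def)
    also have "\<dots> \<le> (\<Sum>U\<in>\<U>. real (s\<^sup>2 choose (s - 1)) * real (n choose K) * real s ^ K * ?p ^ ((s - 1) + K))"
    proof (rule sum_mono)
      fix U assume "U \<in> \<U>"
      then have U: "U \<subseteq> ?V" "finite U" "card U = s" by (auto simp: \<U>_def intro: finite_subset)
      have "pr (Gnp n ?p) (Ev U) \<le>
        real (s\<^sup>2 choose (s - 1)) * real (card (\<Y> U)) * real s ^ K * ?p ^ ((s - 1) + K)"
        unfolding Ev_def Gnp_eq_random_subset
      proof (rule prob_tree_with_star_le[OF _ _ _ U(2,3) _ _ U(2) _ _ p])
        show "finite Y \<and> card Y = K \<and> Y \<inter> U = {}" if "Y \<in> \<Y> U" for Y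
          using that by (auto simp: \<Y>_def intro: finite_subset)
        show "{y, z} \<in> all_edges ?V \<and> \<not> {y, z} \<subseteq> U" if "Y \<in> \<Y> U" "y \<in> Y" "z \<in> U" for Y y z
        proof -
          have "y \<in> ?V" "y \<notin> U" "z \<in> ?V" using that U(1) by (auto simp: \<Y>_def)
          moreover from this have "y \<noteq> z" using that(3) by blast
          ultimately show ?thesis by (simp add: all_edges_def)
        qed
      qed (use U in \<open>auto simp: finite_all_edges \<Y>_def all_edges_def\<close>)
      also have "\<dots> \<le> real (s\<^sup>2 choose (s - 1)) * real (n choose K) * real s ^ K * ?p ^ ((s - 1) + K)"
        using cY[of U] p by (intro mult_right_mono mult_left_mono) auto
      finally show "pr (Gnp n ?p) (Ev U) \<le> real (s\<^sup>2 choose (s - 1)) * real (n choose K) * real s ^ K * ?p ^ ((s - 1) + K)" .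
    qed
    also have "\<dots> = real (n choose s) * (real (s\<^sup>2 choose (s - 1)) * real (n choose K) * real s ^ K * ?p ^ ((s - 1) + K))"
      unfolding \<U>_def using n_subsets[of ?V s] by simp
    also have "\<dots> = (real (n choose s) * real (s\<^sup>2 choose (s - 1)) * ?p ^ (s - 1)) * (real (n choose K) * real s ^ K * ?p ^ K)"
      by (simp only: power_add mult_ac)
    also have "\<dots> \<le> (real n * (exp 2 * c1) ^ s) * exp (- real K)"
    proof (rule mult_mono)
      show "real (n choose s) * real (s\<^sup>2 choose (s - 1)) * ?p ^ (s - 1) \<le> real n * (exp 2 * c1) ^ s"
        by (rule tree_count_le) (use s n0 c c1 in auto)
      have "real (n choose K) * real s ^ K * ?p ^ K \<le> (real n ^ K / fact K) * real s ^ K * ?p ^ K"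
        using p by (intro mult_right_mono choose_le_div_fact) auto
      also have "\<dots> = (real s * c) ^ K / fact K" using n0 by (simp add: power_divide power_mult_distrib)
      also have "\<dots> \<le> (real K / exp 2) ^ K / fact K"
      proof (intro divide_right_mono power_mono)
        have "real s * c * exp 2 = real s * (exp 2 * c)" by simp
        also have "\<dots> \<le> real s * (exp 2 * c1)" using c1 by (intro mult_left_mono) auto
        also have "\<dots> \<le> real s * real C" using C(1) by (intro mult_left_mono) auto
        finally have "real s * c * exp 2 \<le> real K" by (simp add: K_def mult.commute)
        then show "real s * c \<le> real K / exp 2" by (simp add: pos_le_divide_eq)
      qed (use c in auto)
      also have "\<dots> = (real K ^ K / fact K) * (1 / exp 2 ^ K)" by (simp add: power_divide)
      also have "\<dots> \<le> exp (real K) * (1 / exp 2 ^ K)"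
        using power_self_le_exp_fact[of K] by (intro mult_right_mono) (auto simp: field_simps)
      also have "\<dots> = exp (real K) * exp (- (real K * 2))" by (simp add: exp_of_nat_mult exp_minus divide_inverse)
      also have "\<dots> = exp (- real K)" by (simp flip: exp_add)
      finally show "real (n choose K) * real s ^ K * ?p ^ K \<le> exp (- real K)" .
    qed (use p c1 in auto)
    also have "exp (- real K) = exp (- real C) ^ s"
      by (simp add: K_def exp_of_nat_mult[symmetric] mult.commute)
    also have "(real n * (exp 2 * c1) ^ s) * exp (- real C) ^ s = real n * (exp 2 * c1 * exp (- real C)) ^ s"
      by (simp add: power_mult_distrib)
    also have "\<dots> \<le> real n * exp (- 2) ^ s"
    proof (intro mult_left_mono power_mono)
      have "exp 2 * c1 * exp (- real C) = exp (2 + ln c1 - real C)"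
        using c1 by (simp add: exp_diff exp_add exp_minus divide_inverse)
      also have "\<dots> \<le> exp (- 2)" using C(2) by simp
      finally show "exp 2 * c1 * exp (- real C) \<le> exp (- 2)" .
    qed (use c1 in auto)
    also have "\<dots> \<le> 1 / real n" by (rule exp_minus_2_ln_le[OF n0 s(2)])
    finally show "pr (Gnp n ?p)
      {G. \<exists>U\<subseteq>?V. card U = s \<and> s - 1 \<le> card (edges_in G U) \<and> C * s < card ((\<Union>x\<in>U. nbrs G x) - U)} \<le> 1 / real n" .
  qed
qed

text \<open>The edges avoiding \<open>U\<close> are exposed first and fix at most \<open>N\<close>
  possible targets; the tree edges and the attaching edges are still undecided. The power of 2 pays
  for the choice of the \<open>r\<close> attached vertices.\<close>

lemma prob_attached_cluster_le:
  fixes p :: real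
  assumes V: "finite V" and U: "U \<subseteq> V" "card U = s" and p: "0 \<le> p" "p \<le> 1"
  shows "pr (random_subset (all_edges V) p)
    {G. s - 1 \<le> card (edges_in G U) \<and> r \<le> card (attached k G U j) \<and>
        card (rsurv k (avoiding G U) j \<inter> V) \<le> N}
    \<le> real (s\<^sup>2 choose (s - 1)) * 2 ^ s * real N ^ r * p ^ ((s - 1) + r)"
proof -
  define B where "B = {e \<in> all_edges V. e \<inter> U = {}}"
  define A where "A = all_edges V - B"
  have finU: "finite U" using U V finite_subset by blast
  have AB: "all_edges V = A \<union> B" "A \<inter> B = {}" "finite A" "finite B"
    using finite_all_edges[OF V] by (auto simp: A_def B_def)
  define \<phi> where "\<phi> X Y \<longleftrightarrow> s - 1 \<le> card (edges_in X U) \<and>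
    r \<le> card {x \<in> U. \<exists>y \<in> rsurv k Y j \<inter> (V - U). {x, y} \<in> X} \<and> card (rsurv k Y j \<inter> V) \<le> N" for X Y
  have "pr (random_subset (all_edges V) p)
    {G. s - 1 \<le> card (edges_in G U) \<and> r \<le> card (attached k G U j) \<and>
        card (rsurv k (avoiding G U) j \<inter> V) \<le> N}
    \<le> pr (random_subset (all_edges V) p) {G. \<phi> (G \<inter> A) (G \<inter> B)}"
  proof (rule prob_mono_support)
    fix G assume G: "G \<in> set_pmf (random_subset (all_edges V) p)"
      and h: "G \<in> {G. s - 1 \<le> card (edges_in G U) \<and> r \<le> card (attached k G U j) \<and>
      card (rsurv k (avoiding G U) j \<inter> V) \<le> N}"
    have sub: "G \<subseteq> all_edges V" using G by (rule random_subset_subset)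
    then have 1: "(avoiding G U) = G \<inter> B" by (auto simp: B_def)
    have "e \<noteq> {}" if "e \<in> all_edges V" for e using that by (auto simp: all_edges_def)
    then have 2: "edges_in (G \<inter> A) U = edges_in G U"
      using sub unfolding edges_in_def A_def B_def by blast
    have 3: "{x \<in> U. \<exists>y. {x, y} \<in> G \<and> y \<notin> U \<and> y \<in> rsurv k (G \<inter> B) j} =
      {x \<in> U. \<exists>y \<in> rsurv k (G \<inter> B) j \<inter> (V - U). {x, y} \<in> G \<inter> A}"
      using sub by (auto simp: A_def B_def all_edges_def)
    show "G \<in> {G. \<phi> (G \<inter> A) (G \<inter> B)}" using h unfolding \<phi>_def mem_Collect_eq 1 2 3 .
  qed
  also have "\<dots> \<le> real (s\<^sup>2 choose (s - 1)) * 2 ^ s * real N ^ r * p ^ ((s - 1) + r)"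
    unfolding AB(1)
  proof (rule prob_random_subset_split_le[OF AB(3,4,2)])
    fix Y assume "Y \<subseteq> B"
    define T where "T = rsurv k Y j \<inter> (V - U)"
    have finT: "finite T" using V by (simp add: T_def)
    show "pr (random_subset A p) {X. \<phi> X Y} \<le> real (s\<^sup>2 choose (s - 1)) * 2 ^ s * real N ^ r * p ^ ((s - 1) + r)"
    proof (cases "card (rsurv k Y j \<inter> V) \<le> N")
      case False
      then show ?thesis using p by (simp add: \<phi>_def)
    next
      case True
      have cT: "card T \<le> N"
      proof -
        have "card T \<le> card (rsurv k Y j \<inter> V)" unfolding T_def using V by (intro card_mono) auto
        then show ?thesis using True by simp
      qed
      define \<D> where "\<D> = {D. D \<subseteq> U \<and> card D = r}"
      have cD: "card \<D> \<le> 2 ^ s"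
      proof -
        have "card \<D> \<le> card (Pow U)" using finU by (intro card_mono) (auto simp: \<D>_def)
        then show ?thesis using card_Pow[OF finU] U(2) by simp
      qed
      have "pr (random_subset A p) {X. \<phi> X Y} \<le> pr (random_subset A p)
        {X. s - 1 \<le> card (edges_in X U) \<and> (\<exists>D\<in>\<D>. \<forall>x\<in>D. \<exists>y\<in>T. {x, y} \<in> X)}"
      proof (rule measure_pmf.finite_measure_mono)
        show "{X. \<phi> X Y} \<subseteq> {X. s - 1 \<le> card (edges_in X U) \<and> (\<exists>D\<in>\<D>. \<forall>x\<in>D. \<exists>y\<in>T. {x, y} \<in> X)}"
        proof
          fix X assume "X \<in> {X. \<phi> X Y}"
          then have h: "s - 1 \<le> card (edges_in X U)" "r \<le> card {x \<in> U. \<exists>y \<in> T. {x, y} \<in> X}"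
            by (auto simp: \<phi>_def T_def)
          obtain D where "D \<subseteq> {x \<in> U. \<exists>y \<in> T. {x, y} \<in> X}" "card D = r"
            using h(2) by (rule obtain_subset_with_card_n)
          then have "D \<in> \<D>" "\<forall>x\<in>D. \<exists>y\<in>T. {x, y} \<in> X" by (auto simp: \<D>_def)
          then show "X \<in> {X. s - 1 \<le> card (edges_in X U) \<and> (\<exists>D\<in>\<D>. \<forall>x\<in>D. \<exists>y\<in>T. {x, y} \<in> X)}"
            using h(1) by blast
        qed
      qed simp
      also have "\<dots> \<le> real (s\<^sup>2 choose (s - 1)) * real (card \<D>) * real N ^ r * p ^ ((s - 1) + r)"
      proof (rule prob_tree_with_star_le[OF AB(3) _ _ finU U(2) _ _ finT cT _ p])
        show "all_edges U \<subseteq> A"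
        proof
          fix e assume "e \<in> all_edges U"
          then have e: "e \<subseteq> U" "card e = 2" by (auto simp: all_edges_def)
          have "e \<noteq> {}" using e(2) by auto
          then have "e \<inter> U \<noteq> {}" using e(1) by blast
          then show "e \<in> A" using e U(1) by (auto simp: A_def B_def all_edges_def)
        qed
        show "card e = 2" if "e \<in> A" for e using that by (auto simp: A_def all_edges_def)
        show "finite D \<and> card D = r \<and> D \<inter> T = {}" if "D \<in> \<D>" for D
          using that finU by (auto simp: \<D>_def T_def intro: finite_subset)
        show "{x, y} \<in> A \<and> \<not> {x, y} \<subseteq> U" if "D \<in> \<D>" "x \<in> D" "y \<in> T" for D x y
        proof -
          have "x \<in> U" "x \<in> V" "y \<in> V" "y \<notin> U" using that U(1) by (auto simp: \<D>_def T_def)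
          moreover from this have "x \<noteq> y" by blast
          ultimately show ?thesis by (auto simp: A_def B_def all_edges_def)
        qed
      qed (use finU in \<open>simp add: \<D>_def\<close>)
      also have "\<dots> \<le> real (s\<^sup>2 choose (s - 1)) * 2 ^ s * real N ^ r * p ^ ((s - 1) + r)"
        using of_nat_mono[OF cD, where 'a = real] p by (intro mult_right_mono mult_left_mono) auto
      finally show ?thesis .
    qed
  qed
  finally show ?thesis .
qed

text \<open>The quantifier order is essential: \<epsilon> depends on \<open>c\<close> only, because
  the number of rounds \<open>j\<close> will be chosen in terms of \<epsilon>.\<close>

lemma cluster_bound:
  fixes c :: real
  assumes c: "0 < c"
  shows "\<exists>\<epsilon>>0. \<forall>n s k j N. c < real n \<longrightarrow> 1 \<le> s \<longrightarrow> ln (real n) \<le> real s \<longrightarrow> real N \<le> \<epsilon> * real n \<longrightarrow>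
    pr (Gnp n (c / real n))
      {G. \<exists>U\<subseteq>{..<n}. card U = s \<and> s - 1 \<le> card (edges_in G U) \<and>
        s \<le> 4 * card (attached k G U j) \<and>
        card (rsurv k (avoiding G U) j \<inter> {..<n}) \<le> N} \<le> 1 / real n"
proof -
  define c1 where "c1 = max 1 c"
  have c1: "1 \<le> c1" "c \<le> c1" by (auto simp: c1_def)
  \<comment> \<open>Chosen so that 2 exp 2 * c1 * \<kappa> = exp(-2). The fourth power in \<epsilon>
    compensates for only a quarter of the vertices being attached.\<close>
  define \<kappa> where "\<kappa> = exp (- 4) / (2 * c1)"
  have \<kappa>: "0 < \<kappa>" "\<kappa> \<le> 1"
  proof -
    show "0 < \<kappa>" using c1 by (simp add: \<kappa>_def)
    have "exp (- 4) \<le> (1::real)" by simp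
    also have "\<dots> \<le> 2 * c1" using c1 by simp
    finally show "\<kappa> \<le> 1" using c1 by (simp add: \<kappa>_def)
  qed
  define \<epsilon> where "\<epsilon> = \<kappa> ^ 4 / c1"
  have \<epsilon>: "0 < \<epsilon>" using \<kappa> c1 by (simp add: \<epsilon>_def)
  show ?thesis
  proof (intro exI[of _ \<epsilon>] conjI allI impI \<epsilon>)
    fix n s k j N :: nat
    assume n: "c < real n" and s: "1 \<le> s" "ln (real n) \<le> real s" and N: "real N \<le> \<epsilon> * real n"
    let ?V = "{..<n}"
    let ?p = "c / real n"
    let ?P = "Gnp n ?p"
    have n0: "0 < n" using c n by (cases n) auto
    have p: "0 \<le> ?p" "?p \<le> 1" using c n by (simp_all add: field_simps)
    \<comment> \<open>This is s / 4 rounded up.\<close>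
    define r where "r = (s + 3) div 4"
    have r: "s \<le> 4 * r" unfolding r_def by linarith
    define \<U> where "\<U> = {U. U \<subseteq> ?V \<and> card U = s}"
    define Ev where "Ev U = {G. s - 1 \<le> card (edges_in G U) \<and>
      r \<le> card (attached k G U j) \<and>
        card (rsurv k (avoiding G U) j \<inter> ?V) \<le> N}" for U
    have "pr ?P {G. \<exists>U\<subseteq>?V. card U = s \<and> s - 1 \<le> card (edges_in G U) \<and>
        s \<le> 4 * card (attached k G U j) \<and>
        card (rsurv k (avoiding G U) j \<inter> ?V) \<le> N} \<le> pr ?P (\<Union>U\<in>\<U>. Ev U)"
    proof (rule measure_pmf.finite_measure_mono)
      show "{G. \<exists>U\<subseteq>?V. card U = s \<and> s - 1 \<le> card (edges_in G U) \<and>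
        s \<le> 4 * card (attached k G U j) \<and>
        card (rsurv k (avoiding G U) j \<inter> ?V) \<le> N} \<subseteq> (\<Union>U\<in>\<U>. Ev U)"
      proof
        fix G assume "G \<in> {G. \<exists>U\<subseteq>?V. card U = s \<and> s - 1 \<le> card (edges_in G U) \<and>
          s \<le> 4 * card (attached k G U j) \<and>
          card (rsurv k (avoiding G U) j \<inter> ?V) \<le> N}"
        then obtain U where h: "U \<subseteq> ?V" "card U = s" "s - 1 \<le> card (edges_in G U)"
          "s \<le> 4 * card (attached k G U j)"
          "card (rsurv k (avoiding G U) j \<inter> ?V) \<le> N" by blast
        from h(4) have "r \<le> card (attached k G U j)"
          unfolding r_def by linarith
        then have "G \<in> Ev U" using h(3,5) by (simp add: Ev_def)
        then show "G \<in> (\<Union>U\<in>\<U>. Ev U)" using h(1,2) by (auto simp: \<U>_def)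
      qed
    qed simp
    also have "\<dots> \<le> (\<Sum>U\<in>\<U>. pr ?P (Ev U))"
      by (rule measure_pmf.finite_measure_subadditive_finite) (auto simp: \<U>_def)
    also have "\<dots> \<le> (\<Sum>U\<in>\<U>. real (s\<^sup>2 choose (s - 1)) * 2 ^ s * real N ^ r * ?p ^ ((s - 1) + r))"
    proof (rule sum_mono)
      fix U assume "U \<in> \<U>"
      then show "pr ?P (Ev U) \<le> real (s\<^sup>2 choose (s - 1)) * 2 ^ s * real N ^ r * ?p ^ ((s - 1) + r)"
        unfolding Ev_def Gnp_eq_random_subset by (intro prob_attached_cluster_le p) (auto simp: \<U>_def)
    qed
    also have "\<dots> = real (n choose s) * (real (s\<^sup>2 choose (s - 1)) * 2 ^ s * real N ^ r * ?p ^ ((s - 1) + r))"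
      unfolding \<U>_def using n_subsets[of ?V s] by simp
    also have "\<dots> = (real (n choose s) * real (s\<^sup>2 choose (s - 1)) * ?p ^ (s - 1)) * (2 ^ s * (real N * ?p) ^ r)"
      by (simp only: power_add power_mult_distrib mult_ac)
    also have "\<dots> \<le> (real n * (exp 2 * c1) ^ s) * (2 ^ s * \<kappa> ^ s)"
    proof (rule mult_mono)
      show "real (n choose s) * real (s\<^sup>2 choose (s - 1)) * ?p ^ (s - 1) \<le> real n * (exp 2 * c1) ^ s"
        by (rule tree_count_le) (use s n0 c c1 in auto)
      have "real N * ?p \<le> \<epsilon> * real n * ?p" using N p by (intro mult_right_mono) auto
      also have "\<dots> = \<epsilon> * c" using n0 by simp
      also have "\<dots> \<le> \<epsilon> * c1" using \<epsilon> c1 by simp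
      also have "\<dots> = \<kappa> ^ 4" using c1 by (simp add: \<epsilon>_def)
      finally have "(real N * ?p) ^ r \<le> (\<kappa> ^ 4) ^ r" using c by (intro power_mono) auto
      also have "\<dots> = \<kappa> ^ (4 * r)" by (simp add: power_mult)
      also have "\<dots> \<le> \<kappa> ^ s" using \<kappa> r by (intro power_decreasing) auto
      finally show "2 ^ s * (real N * ?p) ^ r \<le> 2 ^ s * \<kappa> ^ s" by simp
    qed (use c p c1 in auto)
    also have "\<dots> = real n * (exp 2 * c1 * 2 * \<kappa>) ^ s" by (simp add: power_mult_distrib)
    also have "exp 2 * c1 * 2 * \<kappa> = exp (- 2)"
    proof -
      have "exp 2 * c1 * 2 * \<kappa> = exp 2 * exp (- 4)" using c1 by (simp add: \<kappa>_def)
      also have "\<dots> = exp (- 2)" by (simp flip: exp_add)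
      finally show ?thesis .
    qed
    also have "real n * exp (- 2) ^ s \<le> 1 / real n" by (rule exp_minus_2_ln_le[OF n0 s(2)])
    finally show "pr ?P {G. \<exists>U\<subseteq>?V. card U = s \<and> s - 1 \<le> card (edges_in G U) \<and>
        s \<le> 4 * card (attached k G U j) \<and>
        card (rsurv k (avoiding G U) j \<inter> ?V) \<le> N} \<le> 1 / real n" .
  qed
qed

section \<open>The main theorem\<close>

text \<open>The deterministic half: randomness enters only through the four assumptions on density,
  number of rooted survivors, clusters and volumes.\<close>

lemma breaker_bounds_components:
  fixes G :: "nat set set"
  assumes G: "G \<subseteq> all_edges V" and V: "finite V" and b: "1 \<le> b" and k: "k = b + 2" and s: "20 \<le> s"
    and sparse: "\<And>W. W \<subseteq> V \<Longrightarrow> W \<noteq> {} \<Longrightarrow> card W \<le> (j + 3) * s \<Longrightarrow>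
      real (card (edges_in G W)) \<le> (1 + 1 / (16 * real (j + 3))) * real (card W)"
    and N: "card (rsurv k G j \<inter> V) \<le> N"
    and cluster: "\<And>U. U \<subseteq> V \<Longrightarrow> card U = s \<Longrightarrow> s - 1 \<le> card (edges_in G U) \<Longrightarrow>
      s \<le> 4 * card (attached k G U j) \<Longrightarrow>
      \<not> card (rsurv k (avoiding G U) j \<inter> V) \<le> N"
    and L: "L = Suc j * k"
    and volume: "\<And>i U. i < L \<Longrightarrow> U \<subseteq> V \<Longrightarrow> card U = (C + 1) ^ i * s \<Longrightarrow> (C + 1) ^ i * s - 1 \<le> card (edges_in G U) \<Longrightarrow>
      card ((\<Union>x\<in>U. nbrs G x) - U) \<le> C * ((C + 1) ^ i * s)"
  shows "can_ensure b G first Breaker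
    (\<lambda>M. \<forall>Q \<in> graph_components V M. card Q \<le> (C + 1) ^ L * s)"
proof -
  define d where "d = b + 1"
  have kd: "k = Suc d" "3 \<le> k" using k b by (simp_all add: d_def)
  have gG: "graph G" using graph_subset[OF graph_all_edges[OF V] G] .
  have inV: "a \<in> V \<and> b \<in> V" if "{a, b} \<in> G" for a b using that G by (auto simp: all_edges_def)
  define S where "S = V \<inter> surv k G {} (Suc j)"
  have finsub: "finite W" if "W \<subseteq> V" for W using that V finite_subset by blast
  \<comment> \<open>The attachment lemma asks for sparsity of arbitrary finite sets; vertices
    outside \<open>V\<close> carry no edges.\<close>
  have sparse': "real (card (edges_in G W)) \<le> (1 + 1 / (16 * real (j + 3))) * real (card W)"
    if W: "finite W" "card W \<le> (j + 3) * s" for W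
  proof -
    have eq: "edges_in G W = edges_in G (W \<inter> V)" using G by (auto simp: edges_in_def all_edges_def)
    have cW: "card (W \<inter> V) \<le> card W" using W(1) by (intro card_mono) auto
    show ?thesis
    proof (cases "W \<inter> V = {}")
      case True
      have "e \<noteq> {}" if "e \<in> G" for e using that G by (auto simp: all_edges_def)
      then have "edges_in G (W \<inter> V) = {}" unfolding True edges_in_def by blast
      then show ?thesis using eq by simp
    next
      case False
      have "real (card (edges_in G W)) \<le> (1 + 1 / (16 * real (j + 3))) * real (card (W \<inter> V))"
        unfolding eq using False W(2) cW by (intro sparse) auto
      also have "\<dots> \<le> (1 + 1 / (16 * real (j + 3))) * real (card W)"
        using cW by (intro mult_left_mono) auto
      finally show ?thesis .
    qed
  qed
  have no_cluster: False if U: "U \<subseteq> S" "conn G U" "card U = s" for U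
  proof -
    have UV: "U \<subseteq> V" and Us: "U \<subseteq> surv k G {} (Suc j)" using U(1) by (auto simp: S_def)
    have "s \<le> 4 * card (attached k G U j)"
      using many_attached_to_rsurv[OF gG kd(2) finsub[OF UV] U(2) _ Us] sparse' s U(3) by simp
    moreover have "s - 1 \<le> card (edges_in G U)"
      using conn_card_le_edges[OF gG U(2) finsub[OF UV]] U(3) by (simp add: edges_in_def)
    moreover have "card (rsurv k (avoiding G U) j \<inter> V) \<le> card (rsurv k G j \<inter> V)"
      using rsurv_mono[OF gG, of "(avoiding G U)" k j] V by (intro card_mono) auto
    ultimately show False using cluster[OF UV U(3)] N by linarith
  qed
  \<comment> \<open>A larger connected subset of \<open>S\<close> would contain a connected one of
    size exactly \<open>s\<close>.\<close>
  have small: "card K < s" if K: "K \<subseteq> S" "conn G K" "K \<noteq> {}" for K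
  proof (rule ccontr)
    assume "\<not> card K < s"
    then have sK: "s \<le> card K" by simp
    obtain x where x: "x \<in> K" using K(3) by blast
    have "finite K" using K(1) by (intro finsub) (auto simp: S_def)
    then obtain U where "U \<subseteq> K" "conn G U" "card U = s"
      using conn_enlarge[OF K(2) _ conn_singleton[of G x], of s] x s sK by auto
    then show False using no_cluster[of U] K(1) by auto
  qed
  \<comment> \<open>A component of \<open>B\<close> has fewer than \<open>s\<close> vertices, so by
    sparsity its average degree is below 3. Some vertex has degree at most 2, and 2 \<le> b +
    1.\<close>
  have "\<exists>x\<in>B. card (nbrs G x \<inter> B) \<le> d" if B: "B \<subseteq> S" "B \<noteq> {}" for B
  proof -
    obtain x where x: "x \<in> B" using B(2) by blast
    let ?K = "comp_in G B x"
    have KB: "?K \<subseteq> B" by (rule comp_in_subset[OF x])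
    have "x \<in> ?K" by (rule comp_in_self)
    then have K: "?K \<noteq> {}" by blast
    have KV: "?K \<subseteq> V" using KB B(1) by (auto simp: S_def)
    have finK: "finite ?K" by (rule finsub[OF KV])
    have "card ?K < s" using KB B(1) K by (intro small conn_comp_in) auto
    moreover have "s \<le> (j + 3) * s" by simp
    ultimately have "card ?K \<le> (j + 3) * s" by linarith
    then have "real (card (edges_in G ?K)) \<le> (1 + 1 / (16 * real (j + 3))) * real (card ?K)" by (rule sparse[OF KV K])
    also have "\<dots> \<le> (1 + 1 / 48) * real (card ?K)"
      by (intro mult_right_mono add_left_mono) (auto simp: field_simps)
    finally have "2 * real (card (edges_in G ?K)) \<le> 2 * ((1 + 1 / 48) * real (card ?K))" by simp
    also have "\<dots> < 3 * real (card ?K)" using K finK by (simp add: card_gt_0_iff)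
    finally obtain y where y: "y \<in> ?K" "card (nbrs G y \<inter> ?K) \<le> 2" using ex_low_degree[OF gG finK K] by blast
    have "nbrs G y \<inter> B = nbrs G y \<inter> ?K"
    proof
      show "nbrs G y \<inter> B \<subseteq> nbrs G y \<inter> ?K"
      proof
        fix z assume z: "z \<in> nbrs G y \<inter> B"
        then have "z \<in> ?K" using y(1) KB by (intro comp_in_closed[of y G B x z]) (auto simp: nbrs_def)
        then show "z \<in> nbrs G y \<inter> ?K" using z by blast
      qed
    qed (use KB in blast)
    then have "card (nbrs G y \<inter> B) \<le> d" using y(2) b by (simp add: d_def)
    then show ?thesis using y(1) KB by blast
  qed
  moreover have "finite S" by (rule finsub) (simp add: S_def)
  ultimately obtain r0 where "good_rank G S d r0" using degenerate_good_rank[OF gG] by blast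
  then have "good_rank G (V \<inter> surv (Suc d) G {} (Suc j)) d r0" by (simp only: S_def kd(1))
  from peeling_good_rank[OF G V this] obtain r where r: "good_rank G V d r"
    "\<And>x. x \<in> V - surv (Suc d) G {} (Suc j) \<Longrightarrow> r x < Suc j * Suc d" by blast
  have distinct: "r x \<noteq> r y" if "{x, y} \<in> G" for x y
    using r(1) that inV[OF that] unfolding good_rank_def by blast
  have deg: "card (upedges r G v) \<le> b + 1" for v
  proof (cases "v \<in> V")
    case True
    have "upedges r G v \<subseteq> (\<lambda>y. {v, y}) ` {y \<in> nbrs G v \<inter> V. r v < r y}"
      using inV by (auto simp: upedges_def nbrs_def)
    moreover have fin: "finite {y \<in> nbrs G v \<inter> V. r v < r y}" using V by simp
    ultimately have "card (upedges r G v) \<le> card ((\<lambda>y. {v, y}) ` {y \<in> nbrs G v \<inter> V. r v < r y})"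
      by (intro card_mono) auto
    also have "\<dots> \<le> card {y \<in> nbrs G v \<inter> V. r v < r y}" by (rule card_image_le[OF fin])
    also have "\<dots> \<le> d" using r(1) True unfolding good_rank_def by blast
    finally show ?thesis by (simp add: d_def)
  next
    case False
    then have "upedges r G v = {}" using inV by (auto simp: upedges_def)
    then show ?thesis by simp
  qed
  have base: "can_ensure b G first Breaker (\<lambda>M. M \<subseteq> G \<and>
    (\<forall>v. \<forall>e \<in> M \<inter> upedges r G v. \<forall>e' \<in> M \<inter> upedges r G v. e = e'))"
    by (rule breaker_keeps_outdegree_le_1[OF gG]) (use distinct deg in auto)
  show ?thesis
  proof (rule can_ensure_mono[OF base], intro ballI)
    fix M Q
    assume M: "M \<subseteq> G \<and> (\<forall>v. \<forall>e \<in> M \<inter> upedges r G v. \<forall>e' \<in> M \<inter> upedges r G v. e = e')"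
      and Q: "Q \<in> graph_components V M"
    have M2: "e = e'" if "e \<in> M \<inter> upedges r G v" "e' \<in> M \<inter> upedges r G v" for v e e'
      using conjunct2[OF M] that by meson
    have high: "x \<in> S" if "x \<in> V" "L \<le> r x" for x
    proof (rule ccontr)
      assume "x \<notin> S"
      then have "r x < Suc j * Suc d" using that(1) by (intro r(2)) (simp add: S_def kd(1))
      then show False using that(2) by (simp add: L kd(1))
    qed
    have "S \<subseteq> V" by (simp add: S_def)
    have "\<exists>K. conn G K \<and> K \<subseteq> V \<and> K \<noteq> {} \<and> (K \<subseteq> S \<or> card K = 1) \<and> Q \<subseteq> (closed_nbhd G ^^ L) K"
    proof (rule outdegree_le_1_component[OF G V, where r = r and M = M])
      show "r x \<noteq> r y" if "{x, y} \<in> G" for x y using that by (rule distinct)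
      show "M \<subseteq> G" using M by (rule conjunct1)
      show "e = e'" if "e \<in> M \<inter> upedges r G v" "e' \<in> M \<inter> upedges r G v" for v e e' using that by (rule M2)
      show "x \<in> S" if "x \<in> V" "L \<le> r x" for x using that by (rule high)
    qed (fact \<open>S \<subseteq> V\<close> Q)+
    then obtain K where K: "conn G K" "K \<subseteq> V" "K \<noteq> {}" "K \<subseteq> S \<or> card K = 1" "Q \<subseteq> (closed_nbhd G ^^ L) K" by blast
    \<comment> \<open>Either \<open>K\<close> is a connected subset of \<open>S\<close> and
      \<open>small\<close> applies, or \<open>K\<close> is a single vertex.\<close>
    have "card K \<le> s" using K(4) small[OF _ K(1,3)] s by auto
    have "card ((closed_nbhd G ^^ L) K) \<le> (C + 1) ^ L * s \<and> (closed_nbhd G ^^ L) K \<subseteq> V"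
    proof -
      have vol: "card ((\<Union>x\<in>U. nbrs G x) - U) \<le> C * ((C + 1) ^ i * s)"
        if "i < L" "U \<subseteq> V" "conn G U" "card U = (C + 1) ^ i * s" for i U
        using conn_card_le_edges[OF gG that(3) finsub[OF that(2)]] that
        by (intro volume) (auto simp: edges_in_def)
      show ?thesis using card_closed_nbhd_pow_le[OF G V K(1-3) \<open>card K \<le> s\<close> vol, of L L] by simp
    qed
    moreover from this have "card Q \<le> card ((closed_nbhd G ^^ L) K)"
      using K(5) finsub by (intro card_mono) blast+
    ultimately show "card Q \<le> (C + 1) ^ L * s" by linarith
  qed
qed

theorem theorem1:
  fixes b :: nat and c :: real and first :: player
  assumes "b \<ge> 1" and "0 < c" and "c < core_threshold (b + 2)"
  shows "\<exists>g :: nat \<Rightarrow> real. g \<in> o(\<lambda>n. ln (real n) ^ 3) \<and>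
    (\<lambda>n. measure_pmf.prob (Gnp n (c / real n))
       {G. real (s_star b first {..<n} G) \<le> g n \<and>
           can_ensure b G first Breaker (\<lambda>M. \<forall>C \<in> graph_components {..<n} M. real (card C) \<le> g n)})
      \<longlonglongrightarrow> 1"
proof -
  define d where "d = b + 1"
  define k where "k = b + 2"
  have d: "1 \<le> d" "k = Suc d" by (simp_all add: d_def k_def)
  obtain \<epsilon> where \<epsilon>: "0 < \<epsilon>" and clus: "\<And>n s k j N. c < real n \<Longrightarrow> 1 \<le> s \<Longrightarrow> ln (real n) \<le> real s \<Longrightarrow> real N \<le> \<epsilon> * real n \<Longrightarrow>
    pr (Gnp n (c / real n))
      {G. \<exists>U\<subseteq>{..<n}. card U = s \<and> s - 1 \<le> card (edges_in G U) \<and>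
        s \<le> 4 * card (attached k G U j) \<and>
        card (rsurv k (avoiding G U) j \<inter> {..<n}) \<le> N} \<le> 1 / real n"
    using cluster_bound[OF assms(2)] by blast
  obtain C where vol: "\<And>n s. c < real n \<Longrightarrow> 1 \<le> s \<Longrightarrow> ln (real n) \<le> real s \<Longrightarrow>
    pr (Gnp n (c / real n))
      {G. \<exists>U\<subseteq>{..<n}. card U = s \<and> s - 1 \<le> card (edges_in G U) \<and> C * s < card ((\<Union>x\<in>U. nbrs G x) - U)} \<le> 1 / real n"
    using volume_bound[OF assms(2)] by blast
  have "survival_iter d c \<longlonglongrightarrow> 0" using assms by (intro survival_iter_tendsto_0) (auto simp: d_def)
  then have "\<forall>\<^sub>F j in sequentially. survival_iter d c j < \<epsilon> / 2" by (rule order_tendstoD) (use \<epsilon> in simp)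
  \<comment> \<open>The other half of \<epsilon> is reserved for the deviation from the
    limit.\<close>
  then obtain j where j: "survival_iter d c j < \<epsilon> / 2" by (auto simp: eventually_sequentially)
  \<comment> \<open>The number of ranks below the remaining set: \<open>Suc j\<close> peeled layers
    with \<open>k\<close> colours each.\<close>
  define L where "L = Suc j * k"
  define s where "s n = nat \<lceil>ln (real n)\<rceil>" for n :: nat
  define g where "g n = real ((C + 1) ^ L * s n)" for n
  define \<delta> where "\<delta> = 1 / (16 * real (j + 3))"
  define P where "P n = Gnp n (c / real n)" for n
  \<comment> \<open>The exceptional events: \<open>F1\<close> a dense small set, \<open>F2\<close>
    too many rooted survivors, \<open>F3\<close> a cluster, \<open>F4 i\<close> excessive expansion
    at the size reached after \<open>i\<close> steps.\<close>
  define F1 where "F1 n = {G. \<exists>W\<subseteq>{..<n}. W \<noteq> {} \<and> card W \<le> (j + 3) * nat \<lceil>ln (real n)\<rceil> \<and>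
      (1 + \<delta>) * real (card W) < real (card (edges_in G W))}" for n
  define F2 where "F2 n = {G. (survival_iter d c j + \<epsilon> / 2) * real n < real (card (rsurv (Suc d) G j \<inter> {..<n}))}" for n
  define F3 where "F3 n = {G. \<exists>U\<subseteq>{..<n}. card U = s n \<and> s n - 1 \<le> card (edges_in G U) \<and>
        s n \<le> 4 * card (attached k G U j) \<and>
        card (rsurv k (avoiding G U) j \<inter> {..<n}) \<le> nat \<lfloor>\<epsilon> * real n\<rfloor>}" for n
  define F4 where "F4 i n = {G. \<exists>U\<subseteq>{..<n}. card U = (C + 1) ^ i * s n \<and> (C + 1) ^ i * s n - 1 \<le> card (edges_in G U) \<and>
        C * ((C + 1) ^ i * s n) < card ((\<Union>x\<in>U. nbrs G x) - U)}" for i n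
  \<comment> \<open>\<open>Suc L\<close> counts one cluster event and \<open>L\<close> volume
    events, each of probability at most 1 / n.\<close>
  define h where "h n = pr (P n) (F1 n) + pr (P n) (F2 n) + real (Suc L) / real n" for n
  have "(\<lambda>n. pr (P n) (F1 n)) \<longlonglongrightarrow> 0"
    unfolding P_def F1_def by (rule sparse_whp[OF assms(2)]) (simp add: \<delta>_def)
  moreover have "(\<lambda>n. pr (P n) (F2 n)) \<longlonglongrightarrow> 0"
    unfolding P_def F2_def by (rule rsurv_concentrated[OF assms(2) d(1)]) (use \<epsilon> in simp)
  moreover have "(\<lambda>n. real (Suc L) / real n) \<longlonglongrightarrow> 0" by real_asymp
  ultimately have "h \<longlonglongrightarrow> 0 + 0 + 0" unfolding h_def by (intro tendsto_add)
  then have lim: "(\<lambda>n. 1 - h n) \<longlonglongrightarrow> 1" using tendsto_diff[OF tendsto_const[of 1]] by fastforce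
  let ?T = "\<lambda>n. {G. real (s_star b first {..<n} G) \<le> g n \<and>
           can_ensure b G first Breaker (\<lambda>M. \<forall>C \<in> graph_components {..<n} M. real (card C) \<le> g n)}"
  have bound: "\<forall>\<^sub>F n in sequentially. 1 - h n \<le> pr (P n) (?T n)"
    \<comment> \<open>n > c makes c / n a probability, and n \<ge> exp 20 provides s \<ge>
      20.\<close>
    using eventually_gt_at_top[of "nat \<lceil>c\<rceil>"] eventually_ge_at_top[of "nat \<lceil>exp 20 :: real\<rceil>"]
  proof eventually_elim
    case (elim n)
    have n: "c < real n" using elim(1) by linarith
    then have n0: "0 < real n" using assms(2) by linarith
    have "exp 20 \<le> real n" using elim(2) by linarith
    then have "20 \<le> ln (real n)" using n0 by (simp add: ln_ge_iff)
    then have s20: "20 \<le> s n" and lns: "ln (real n) \<le> real (s n)" unfolding s_def by linarith+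
    have Cs: "1 \<le> (C + 1) ^ i * s n" "ln (real n) \<le> real ((C + 1) ^ i * s n)" for i
    proof -
      have "1 * s n \<le> (C + 1) ^ i * s n" by (intro mult_le_mono1) simp
      then have "s n \<le> (C + 1) ^ i * s n" by simp
      then show "1 \<le> (C + 1) ^ i * s n" using s20 by linarith
      show "ln (real n) \<le> real ((C + 1) ^ i * s n)" using \<open>s n \<le> (C + 1) ^ i * s n\<close> lns by linarith
    qed
    let ?F = "F1 n \<union> F2 n \<union> F3 n \<union> (\<Union>i<L. F4 i n)"
    have p3: "pr (P n) (F3 n) \<le> 1 / real n"
      unfolding P_def F3_def
    proof (rule clus[OF n _ lns])
      have "0 \<le> \<epsilon> * real n" using \<epsilon> n0 by simp
      then show "real (nat \<lfloor>\<epsilon> * real n\<rfloor>) \<le> \<epsilon> * real n" by linarith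
    qed (use s20 in simp)
    have "pr (P n) (\<Union>i<L. F4 i n) \<le> (\<Sum>i<L. pr (P n) (F4 i n))"
      by (rule measure_pmf.finite_measure_subadditive_finite) auto
    also have "\<dots> \<le> (\<Sum>i<L. 1 / real n)"
      unfolding P_def F4_def by (rule sum_mono) (rule vol[OF n Cs])
    finally have p4: "pr (P n) (\<Union>i<L. F4 i n) \<le> real L / real n" by simp
    have un: "pr (P n) (A \<union> B) \<le> pr (P n) A + pr (P n) B" for A B
      by (rule measure_subadditive) (simp_all add: measure_pmf.emeasure_eq_measure)
    have "pr (P n) ?F \<le> h n"
      using un[of "F1 n \<union> F2 n \<union> F3 n" "\<Union>i<L. F4 i n"] un[of "F1 n \<union> F2 n" "F3 n"] un[of "F1 n" "F2 n"] p3 p4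
      by (simp add: h_def add_divide_distrib)
    moreover have "pr (P n) (- ?F) = 1 - pr (P n) ?F"
      using measure_pmf.prob_compl[of ?F "P n"] by (simp add: Compl_eq_Diff_UNIV)
    moreover have "pr (P n) (- ?F) \<le> pr (P n) (?T n)"
    proof (rule prob_mono_support)
      fix G assume G: "G \<in> set_pmf (P n)" and "G \<in> - ?F"
      then have nF: "G \<notin> F1 n" "G \<notin> F2 n" "G \<notin> F3 n" "\<And>i. i < L \<Longrightarrow> G \<notin> F4 i n" by auto
      have sub: "G \<subseteq> all_edges {..<n}" using G unfolding P_def Gnp_eq_random_subset by (rule random_subset_subset)
      have ens: "can_ensure b G first Breaker (\<lambda>M. \<forall>Q \<in> graph_components {..<n} M. card Q \<le> (C + 1) ^ L * s n)"
      proof (rule breaker_bounds_components[OF sub _ assms(1) k_def s20 _ _ _ L_def, where N = "nat \<lfloor>\<epsilon> * real n\<rfloor>"])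
        show "real (card (edges_in G W)) \<le> (1 + 1 / (16 * real (j + 3))) * real (card W)"
          if "W \<subseteq> {..<n}" "W \<noteq> {}" "card W \<le> (j + 3) * s n" for W
          using nF(1) that unfolding F1_def \<delta>_def s_def by (auto simp: not_less)
        have "real (card (rsurv k G j \<inter> {..<n})) \<le> (survival_iter d c j + \<epsilon> / 2) * real n"
          using nF(2) unfolding F2_def d(2) by (simp add: not_less)
        also have "\<dots> \<le> \<epsilon> * real n" using j n0 by (intro mult_right_mono) auto
        finally show "card (rsurv k G j \<inter> {..<n}) \<le> nat \<lfloor>\<epsilon> * real n\<rfloor>" by (rule le_nat_floor)
        show "\<not> card (rsurv k (avoiding G U) j \<inter> {..<n}) \<le> nat \<lfloor>\<epsilon> * real n\<rfloor>"
          if "U \<subseteq> {..<n}" "card U = s n" "s n - 1 \<le> card (edges_in G U)"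
            "s n \<le> 4 * card (attached k G U j)" for U
          using nF(3) that unfolding F3_def by blast
        show "card ((\<Union>x\<in>U. nbrs G x) - U) \<le> C * ((C + 1) ^ i * s n)"
          if "i < L" "U \<subseteq> {..<n}" "card U = (C + 1) ^ i * s n" "(C + 1) ^ i * s n - 1 \<le> card (edges_in G U)" for i U
        proof (rule ccontr)
          assume "\<not> ?thesis"
          then have "G \<in> F4 i n" unfolding F4_def using that by (auto simp: not_le)
          then show False using nF(4)[OF that(1)] by simp
        qed
      qed simp
      have ens': "can_ensure b G first Breaker (\<lambda>M. \<forall>Q \<in> graph_components {..<n} M. real (card Q) \<le> g n)"
      proof (rule can_ensure_mono[OF ens])
        fix M assume "\<forall>Q \<in> graph_components {..<n} M. card Q \<le> (C + 1) ^ L * s n"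
        then show "\<forall>Q \<in> graph_components {..<n} M. real (card Q) \<le> g n"
          unfolding g_def of_nat_le_iff .
      qed
      have "finite G" using sub finite_all_edges[of "{..<n}"] finite_subset by blast
      moreover have "{..<n} \<noteq> {}" using n0 by auto
      ultimately have "real (s_star b first {..<n} G) \<le> g n" using s_star_le[OF _ assms(1) _ ens'] by blast
      then show "G \<in> ?T n" using ens' by simp
    qed
    ultimately show ?case by linarith
  qed
  have "(\<lambda>n. pr (P n) (?T n)) \<longlonglongrightarrow> 1"
    by (rule tendsto_sandwich[OF bound _ lim tendsto_const]) simp
  moreover have "g \<in> o(\<lambda>n. ln (real n) ^ 3)"
  proof (rule smalloI_tendsto)
    show "(\<lambda>n. g n / ln (real n) ^ 3) \<longlonglongrightarrow> 0"
    proof (rule tendsto_sandwich[where f = "\<lambda>_. 0"])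
      show "(\<lambda>n. real ((C + 1) ^ L) * ((ln (real n) + 1) / ln (real n) ^ 3)) \<longlonglongrightarrow> 0"
      proof -
        have "(\<lambda>n. (ln (real n) + 1) / ln (real n) ^ 3) \<longlonglongrightarrow> 0" by real_asymp
        from tendsto_mult_right_zero[OF this] show ?thesis .
      qed
      show "\<forall>\<^sub>F n in sequentially. g n / ln (real n) ^ 3 \<le> real ((C + 1) ^ L) * ((ln (real n) + 1) / ln (real n) ^ 3)"
        using eventually_ge_at_top[of 1]
      proof eventually_elim
        case (elim n)
        have "0 \<le> ln (real n)" using elim by simp
        then have "real (s n) \<le> ln (real n) + 1" unfolding s_def by linarith
        then have "real ((C + 1) ^ L) * real (s n) \<le> real ((C + 1) ^ L) * (ln (real n) + 1)" by (intro mult_left_mono) auto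
        from divide_right_mono[OF this, of "ln (real n) ^ 3"] show ?case
          using \<open>0 \<le> ln (real n)\<close> by (simp add: g_def)
      qed
      show "\<forall>\<^sub>F n in sequentially. 0 \<le> g n / ln (real n) ^ 3"
        using eventually_ge_at_top[of 1] by eventually_elim (simp add: g_def)
    qed simp
    show "\<forall>\<^sub>F n in sequentially. ln (real n) ^ 3 \<noteq> 0"
      using eventually_ge_at_top[of 2] by eventually_elim simp
  qed
  ultimately show ?thesis unfolding P_def by blast
qed

end
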